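(* Let $\mathbb{G}$ be a homogeneous Lie group of homogeneous dimension $Q$ and let $|\cdot|$ be an arbitrary homogeneous quasi-norm. Let $0<\lambda<Q$ and $1<p,q<\infty$ be such that $1/p+1/q+(\alpha+\lambda)/Q=2$ with $0\le\alpha<Q/p'$ and $\alpha+\lambda\le Q$, where $1/p+1/p'=1$. Then there exists a positive constant $C=C(Q,\lambda,p,\alpha)$ such that $$\left|\int_{\mathbb{G}}\int_{\mathbb{G}}\frac{\overline{f(x)}\,g(y)}{|x|^{\alpha}|y^{-1}x|^{\lambda}}\,dx\,dy\right|\le C\|f\|_{L^{p}(\mathbb{G})}\|g\|_{L^{q}(\mathbb{G})}$$ holds for all $f\in L^{p}(\mathbb{G})$ and $g\in L^{q}(\mathbb{G})$.
   Context: A homogeneous group $\mathbb{G}$ is a connected simply connected Lie group whose Lie algebra $\mathfrak g$ is equipped with a family of dilations $D_\lambda=\mathrm{Exp}(A\ln\lambda)$, $\lambda>0$, where $A$ is a diagonalisable linear operator on $\mathfrak g$ with positive eigenvalues and each $D_\lambda$ is a Lie algebra morphism. Through the exponential map, $\mathbb G$ is identified with $\mathbb R^n$ (identity element $0$), the dilations act on $\mathbb G$ (written $x\mapsto\lambda x$), and Lebesgue measure $dx$ is a Haar measure. The homogeneous dimension is $Q=\mathrm{Tr}\,A$. A homogeneous quasi-norm is a continuous function $|\cdot|:\mathbb G\to[0,\infty)$ with $|x^{-1}|=|x|$, $|\lambda x|=\lambda|x|$ for $\lambda>0$, and $|x|=0$ iff $x=0$. The group and the quasi-norm are fixed; $C$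 is independent of $f$ and $g$. *)

theory Defs
  imports "HOL-Analysis.Analysis"
begin

text \<open>A homogeneous group is given in exponential coordinates: a Lie group structure on
  \<open>real ^ 'n\<close> with identity 0 whose exponential map is the identity map, so that the Lie algebra
  (the tangent space at 0) and the group have the same underlying space.\<close>

primrec k_times_cont_diff ::
  "nat \<Rightarrow> ('a::real_normed_vector \<Rightarrow> 'b::real_normed_vector) \<Rightarrow> bool" where
  "k_times_cont_diff 0 f \<longleftrightarrow> continuous_on UNIV f"
| "k_times_cont_diff (Suc k) f \<longleftrightarrow>
     (\<forall>x. f differentiable (at x)) \<and>
     (\<forall>v. k_times_cont_diff k (\<lambda>x. frechet_derivative f (at x) v))"

definition smooth :: "('a::real_normed_vector \<Rightarrow> 'b::real_normed_vector) \<Rightarrow> bool" where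
  "smooth f \<longleftrightarrow> (\<forall>k. k_times_cont_diff k f)"

definition left_invariant_field ::
  "(real ^ 'n \<Rightarrow> real ^ 'n \<Rightarrow> real ^ 'n) \<Rightarrow> real ^ 'n \<Rightarrow> real ^ 'n \<Rightarrow> real ^ 'n" where
  "left_invariant_field gmult v x = frechet_derivative (gmult x) (at 0) v"

text \<open>The value at 0 of the commutator of the left-invariant vector fields
  extending \<open>v\<close> and \<open>w\<close>.\<close>

definition lie_bracket ::
  "(real ^ 'n \<Rightarrow> real ^ 'n \<Rightarrow> real ^ 'n) \<Rightarrow> real ^ 'n \<Rightarrow> real ^ 'n \<Rightarrow> real ^ 'n" where
  "lie_bracket gmult v w =
     frechet_derivative (left_invariant_field gmult w) (at 0) v -
     frechet_derivative (left_invariant_field gmult v) (at 0) w"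

definition lie_algebra_morphism ::
  "(real ^ 'n \<Rightarrow> real ^ 'n \<Rightarrow> real ^ 'n) \<Rightarrow> (real ^ 'n \<Rightarrow> real ^ 'n) \<Rightarrow> bool" where
  "lie_algebra_morphism gmult D \<longleftrightarrow>
     linear D \<and> (\<forall>v w. D (lie_bracket gmult v w) = lie_bracket gmult (D v) (D w))"

definition operator_exp :: "(real ^ 'n \<Rightarrow> real ^ 'n) \<Rightarrow> real ^ 'n \<Rightarrow> real ^ 'n" where
  "operator_exp T x = (\<Sum>k. (T ^^ k) x /\<^sub>R fact k)"

definition dilation :: "(real ^ 'n \<Rightarrow> real ^ 'n) \<Rightarrow> real \<Rightarrow> real ^ 'n \<Rightarrow> real ^ 'n" where
  "dilation A r = operator_exp (\<lambda>x. ln r *\<^sub>R A x)"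

definition diagonalisable :: "(real ^ 'n \<Rightarrow> real ^ 'n) \<Rightarrow> bool" where
  "diagonalisable A \<longleftrightarrow>
     (\<exists>B. independent B \<and> span B = UNIV \<and> (\<forall>b\<in>B. \<exists>c. A b = c *\<^sub>R b))"

text \<open>In \<open>exp_id\<close>, \<open>t \<mapsto> t v\<close> is the one-parameter subgroup with initial velocity \<open>v\<close>,
  that is, the exponential map is the identity of \<open>real ^ 'n\<close>.\<close>

locale homogeneous_group =
  Groups.group gmult "0 :: real ^ 'n" ginv
  for gmult :: "real ^ 'n \<Rightarrow> real ^ 'n \<Rightarrow> real ^ 'n" and ginv :: "real ^ 'n \<Rightarrow> real ^ 'n" +
  fixes A :: "real ^ 'n \<Rightarrow> real ^ 'n"
  assumes smooth_mult: "smooth (\<lambda>(x, y). gmult x y)"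
    and smooth_ginv: "smooth ginv"
    and exp_id: "gmult (s *\<^sub>R v) (t *\<^sub>R v) = (s + t) *\<^sub>R v"
    and linear_A: "linear A"
    and diagonalisable_A: "diagonalisable A"
    and eigenvalues_pos: "v \<noteq> 0 \<Longrightarrow> A v = c *\<^sub>R v \<Longrightarrow> 0 < c"
    and dilation_morphism: "0 < r \<Longrightarrow> lie_algebra_morphism gmult (dilation A r)"

definition homogeneous_dimension :: "(real ^ 'n \<Rightarrow> real ^ 'n) \<Rightarrow> real" where
  "homogeneous_dimension A = trace (matrix A)"

definition homogeneous_quasi_norm ::
  "(real ^ 'n \<Rightarrow> real ^ 'n) \<Rightarrow> (real ^ 'n \<Rightarrow> real ^ 'n) \<Rightarrow> (real ^ 'n \<Rightarrow> real) \<Rightarrow> bool" where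
  "homogeneous_quasi_norm ginv A N \<longleftrightarrow>
     continuous_on UNIV N \<and> (\<forall>x. 0 \<le> N x) \<and>
     (\<forall>x. N (ginv x) = N x) \<and>
     (\<forall>r x. 0 < r \<longrightarrow> N (dilation A r x) = r * N x) \<and>
     (\<forall>x. N x = 0 \<longleftrightarrow> x = 0)"

definition in_Lp :: "real \<Rightarrow> (real ^ 'n \<Rightarrow> complex) \<Rightarrow> bool" where
  "in_Lp p f \<longleftrightarrow>
     f \<in> borel_measurable lebesgue \<and> integrable lebesgue (\<lambda>x. norm (f x) powr p)"

definition Lp_norm :: "real \<Rightarrow> (real ^ 'n \<Rightarrow> complex) \<Rightarrow> real" where
  "Lp_norm p f = (LINT x|lebesgue. norm (f x) powr p) powr (1 / p)"

end

theory Submission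
  imports Defs
begin

text \<open>
  The group structure enters only through four facts about \<open>N\<close>: its balls and all their left
  translates have measure at most \<open>c r\<^sup>Q\<close>, a quasi-triangle inequality holds, and \<open>N\<close> is continuous
  and even. They rest on two observations. A dilation, being a Lie algebra morphism, is a group
  morphism: the differential of \<open>exp = id\<close>, trivialised by left translations, is an average of
  \<open>Ad (- s x)\<close> over \<open>0 \<le> s \<le> 1\<close>, and \<open>t \<mapsto> Ad (t v)\<close> solves a linear equation governed by the bracket, so
  a morphism maps left-invariant fields to left-invariant fields and hence their integral curves
  to integral curves. And left translations preserve Lebesgue measure: their Jacobian is unchanged
  when both arguments are dilated, and it tends to 1 as the dilation factor tends to 0.

  The inequality itself follows by real interpolation. On sets \<open>E\<close>, \<open>F\<close> of measure at most \<open>m\<close>, \<open>n\<close>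
  the kernel integrates to at most \<open>C m\<^sup>a n\<^sup>b\<close> for two pairs of exponents \<open>(a, b)\<close> on the line
  \<open>a + b = 1/p + 1/q\<close> on either side of \<open>(1/p, 1/q)\<close>. Cutting both \<open>f\<close> and \<open>g\<close> along level sets of
  measure \<open>2\<^sup>j\<close> and \<open>2\<^sup>k\<close>, the \<open>(j, k)\<close> block then gains a factor \<open>2\<^bsup>-\<delta>\<bar>j-k\<bar>\<^esup>\<close>, and the sum over all
  blocks converges because \<open>1/p + 1/q \<ge> 1\<close>.
\<close>

subsection \<open>Real interpolation of bilinear forms\<close>

text \<open>The weight \<open>N x powr (- \<alpha>)\<close> destroys the left invariance of the
  kernel, so a convolution inequality cannot be applied to it directly. Restricted estimates see
  only how fast the sublevel sets of \<open>N\<close> and of the distance grow. Each condition on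
  the exponents governs one step. That \<alpha> < Q/p' means 1/p < 1 - \<alpha>/Q, which puts the
  first endpoint on one side of 1/p. That q > 1 means 1 - (\<alpha> + lam)/Q < 1/p, which leaves
  room for an endpoint on the other side. That \<alpha> + lam \<le> Q means 1/p + 1/q \<ge> 1. At
  the first endpoint the two factors of the kernel are estimated separately; at the second most of
  the singularity has to sit on a single factor, and moving it there is the work of the
  quasi-triangle inequality. On the group side the obstacle is that dilations are known to respect
  only the bracket at the origin, whereas the measure of a translated ball involves the product
  itself.\<close>

lemma nn_integral_dyadic_below:
  "(\<integral>\<^sup>+j. ennreal (2 powr real_of_int j) * indicator {j. ennreal (2 powr real_of_int j) < v} j \<partial>count_space UNIV)
     \<le> 2 * v"
proof (cases "v = \<infinity>")
  case True
  then show ?thesis by (simp add: ennreal_mult_top)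
next
  case False
  define w where "w = enn2real v"
  have v: "v = ennreal w" and w: "0 \<le> w" using False by (auto simp: w_def less_top)
  define J where "J = {j::int. 2 powr real_of_int j < w}"
  \<comment> \<open>The term \<open>2 powr j\<close> is the length of \<open>X j\<close>. These
    intervals are disjoint and, for \<open>j\<close> in \<open>J\<close>, lie in
    \<open>{0..2 * w}\<close>; this gives the factor 2.\<close>
  define X where "X j = {2 powr real_of_int j <.. 2 powr (real_of_int j + 1)}" for j
  have disj: "disjoint_family_on X J"
    unfolding disjoint_family_on_def
  proof (intro ballI impI)
    have *: "X i \<inter> X j = {}" if "i < j" for i j :: int
    proof -
      have "2 powr (real_of_int i + 1) \<le> 2 powr real_of_int j"
        using that by simp
      then show ?thesis by (auto simp: X_def)
    qed
    fix i j :: int assume "i \<noteq> j"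
    then show "X i \<inter> X j = {}" using *[of i j] *[of j i] by fastforce
  qed
  have "(\<integral>\<^sup>+j. ennreal (2 powr real_of_int j) * indicator {j. ennreal (2 powr real_of_int j) < v} j \<partial>count_space UNIV)
    = (\<integral>\<^sup>+j. ennreal (2 powr real_of_int j) * indicator J j \<partial>count_space UNIV)"
    by (intro nn_integral_cong) (auto simp: v J_def ennreal_less_iff split: split_indicator)
  also have "\<dots> = (\<integral>\<^sup>+j. ennreal (2 powr real_of_int j) \<partial>count_space J)"
    by (simp add: nn_integral_count_space_indicator)
  also have "\<dots> = (\<integral>\<^sup>+j. emeasure lborel (X j) \<partial>count_space J)"
    by (intro nn_integral_cong) (auto simp: X_def powr_add)
  also have "\<dots> = emeasure lborel (\<Union>(X ` J))"
    by (rule emeasure_UN_countable[symmetric, OF _ _ disj]) (auto simp: X_def)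
  also have "\<dots> \<le> emeasure lborel {0..2 * w}"
  proof (rule emeasure_mono)
    show "\<Union>(X ` J) \<subseteq> {0..2 * w}"
    proof
      fix s assume "s \<in> \<Union>(X ` J)"
      then obtain j where j: "2 powr real_of_int j < w" "2 powr real_of_int j < s" "s \<le> 2 * 2 powr real_of_int j"
        by (auto simp: X_def J_def powr_add)
      moreover have "0 < 2 powr real_of_int j" by simp
      ultimately show "s \<in> {0..2 * w}" unfolding atLeastAtMost_iff by linarith
    qed
  qed simp
  also have "\<dots> = 2 * v" using w by (simp add: v ennreal_mult)
  finally show ?thesis .
qed

lemma nn_integral_int_shift:
  "(\<integral>\<^sup>+k. f (k - j :: int) \<partial>count_space UNIV) = (\<integral>\<^sup>+k. f k \<partial>count_space UNIV)"
  by (rule nn_integral_bij_count_space[where g = "\<lambda>k. k - j"])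
    (auto simp: bij_betw_def inj_on_def image_iff intro!: exI[of _ "_ + j"])

lemma nn_integral_int_geometric_finite:
  assumes "0 < \<delta>"
  shows "(\<integral>\<^sup>+k. ennreal (2 powr (- \<delta> * \<bar>real_of_int k\<bar>)) \<partial>count_space UNIV) < \<infinity>"
proof -
  define r where "r = 2 powr (- \<delta>)"
  have r: "0 < r" "r < 1" using assms by (auto simp: r_def powr_less_one)
  have pw: "2 powr (- \<delta> * real n) = r ^ n" for n
    by (simp add: r_def powr_realpow[symmetric] powr_powr)
  \<comment> \<open>The two halves share 0, which is harmless because only an upper bound is
    wanted.\<close>
  define A B :: "int set" where "A = range int" and "B = range (\<lambda>n. - int n)"
  have nat: "(\<integral>\<^sup>+n. ennreal (r ^ n) \<partial>count_space (UNIV::nat set)) < \<infinity>"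
  proof -
    have "(\<Sum>n. ennreal (r ^ n)) = ennreal (\<Sum>n. r ^ n)"
      using r by (intro suminf_ennreal2) (auto intro: summable_geometric)
    then show ?thesis by (simp add: nn_integral_count_space_nat)
  qed
  have 1: "(\<integral>\<^sup>+k. ennreal (2 powr (- \<delta> * \<bar>real_of_int k\<bar>)) \<partial>count_space A) = (\<integral>\<^sup>+n. ennreal (r ^ n) \<partial>count_space (UNIV::nat set))"
    by (subst nn_integral_bij_count_space[where g = int and A = UNIV, symmetric])
      (auto simp: A_def bij_betw_def inj_on_def pw[symmetric])
  have 2: "(\<integral>\<^sup>+k. ennreal (2 powr (- \<delta> * \<bar>real_of_int k\<bar>)) \<partial>count_space B) = (\<integral>\<^sup>+n. ennreal (r ^ n) \<partial>count_space (UNIV::nat set))"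
    by (subst nn_integral_bij_count_space[where g = "\<lambda>n. - int n" and A = UNIV, symmetric])
      (auto simp: B_def bij_betw_def inj_on_def pw[symmetric])
  have cover: "k \<in> A \<or> k \<in> B" for k
    unfolding A_def B_def by (cases k) (auto simp: image_iff simp del: of_nat_Suc)
  have "(\<integral>\<^sup>+k. ennreal (2 powr (- \<delta> * \<bar>real_of_int k\<bar>)) \<partial>count_space UNIV)
     \<le> (\<integral>\<^sup>+k. ennreal (2 powr (- \<delta> * \<bar>real_of_int k\<bar>)) * indicator A k
         + ennreal (2 powr (- \<delta> * \<bar>real_of_int k\<bar>)) * indicator B k \<partial>count_space UNIV)"
    using cover by (intro nn_integral_mono) (auto split: split_indicator)
  also have "\<dots> = (\<integral>\<^sup>+k. ennreal (2 powr (- \<delta> * \<bar>real_of_int k\<bar>)) \<partial>count_space A)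
      + (\<integral>\<^sup>+k. ennreal (2 powr (- \<delta> * \<bar>real_of_int k\<bar>)) \<partial>count_space B)"
    by (subst nn_integral_add) (auto simp: nn_integral_count_space_indicator)
  also have "\<dots> < \<infinity>" using nat unfolding 1 2 by simp
  finally show ?thesis .
qed

text \<open>Levels are chosen by measure, not by height: with F* the decreasing rearrangement,
  \<open>E j\<close> is where \<open>F\<close> lies between F*(2^j) and F*(2^(j-1)), and
  \<open>T j\<close> is F*(2^(j-1)). The bound on each \<open>T j * 2 powr j\<close> is Markov's
  inequality; the bound on their sum is a dyadic form of the fact that F* and \<open>F\<close> have
  the same integral.\<close>

lemma dyadic_level_sets:
  fixes F :: "'a \<Rightarrow> real"
  assumes "sigma_finite_measure M" and F[measurable]: "F \<in> borel_measurable M"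
    and nonneg: "\<And>x. 0 \<le> F x" and int_le: "(\<integral>\<^sup>+x. ennreal (F x) \<partial>M) \<le> 1"
  obtains E :: "int \<Rightarrow> 'a set" and T :: "int \<Rightarrow> real" where
    "\<And>j. E j \<in> sets M" "\<And>j. emeasure M (E j) \<le> ennreal (2 powr real_of_int j)"
    "\<And>j. 0 \<le> T j" "\<And>j. T j * 2 powr real_of_int j \<le> 2" "\<And>j x. x \<in> E j \<Longrightarrow> F x \<le> T j"
    "AE x in M. 0 < F x \<longrightarrow> (\<exists>j. x \<in> E j)"
    "(\<integral>\<^sup>+j. ennreal (T j * 2 powr real_of_int j) \<partial>count_space UNIV) \<le> 4"
proof -
  interpret sigma_finite_measure M by fact
  define v where "v s = emeasure M {x \<in> space M. s < F x}" for s
  define S where "S j = {s. 0 \<le> s \<and> v s \<le> ennreal (2 powr real_of_int j)}" for j :: int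
  define t where "t j = Inf (S j)" for j \<comment> \<open>the decreasing rearrangement of \<open>F\<close> at \<open>2\<^sup>j\<close>\<close>
  have v_mono: "v s' \<le> v s" if "s \<le> s'" for s s'
    unfolding v_def using that by (intro emeasure_mono) auto
  have markov: "v s \<le> ennreal (1 / s)" if "0 < s" for s
  proof -
    have "ennreal s * v s = (\<integral>\<^sup>+x. ennreal s * indicator {x \<in> space M. s < F x} x \<partial>M)"
      unfolding v_def by (subst nn_integral_cmult_indicator) auto
    also have "\<dots> \<le> (\<integral>\<^sup>+x. ennreal (F x) \<partial>M)"
      using that by (intro nn_integral_mono) (auto split: split_indicator intro!: ennreal_leI)
    also have "\<dots> \<le> 1" by (rule int_le)
    finally have *: "ennreal s * v s \<le> 1" .
    have "v s = ennreal (1 / s) * (ennreal s * v s)"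
    proof -
      have "ennreal (1 / s) * ennreal s = 1" using that by (subst ennreal_mult[symmetric]) auto
      then show ?thesis by (simp add: mult.assoc[symmetric])
    qed
    also have "\<dots> \<le> ennreal (1 / s) * 1" by (intro mult_left_mono *) simp
    finally show ?thesis by simp
  qed
  have S_mem: "2 powr (- real_of_int j) \<in> S j" for j
  proof -
    have "v (2 powr (- real_of_int j)) \<le> ennreal (2 powr real_of_int j)"
      using markov[of "2 powr (- real_of_int j)"] by (simp add: powr_minus_divide)
    then show ?thesis by (simp add: S_def)
  qed
  have S_bdd: "bdd_below (S j)" for j unfolding S_def by (auto intro!: bdd_belowI)
  have t0: "0 \<le> t j" for j
  proof -
    have "S j \<noteq> {}" using S_mem[of j] by blast
    then show ?thesis unfolding t_def by (rule cInf_greatest) (simp add: S_def)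
  qed
  have t_le: "t j \<le> 2 powr (- real_of_int j)" for j
    unfolding t_def by (intro cInf_lower S_mem S_bdd)
  have above: "v s \<le> ennreal (2 powr real_of_int j)" if s: "t j < s" for j s
  proof -
    obtain s' where "s' \<in> S j" "s' < s"
      using s S_mem[of j] cInf_less_iff[of "S j" s] S_bdd[of j] unfolding t_def by blast
    then show ?thesis using v_mono[of s' s] by (auto simp: S_def)
  qed
  have below: "ennreal (2 powr real_of_int j) < v s" if s: "0 \<le> s" "s < t j" for j s
  proof (rule ccontr)
    assume "\<not> ?thesis"
    then have "s \<in> S j" using s by (auto simp: S_def)
    then have "t j \<le> s" unfolding t_def by (intro cInf_lower S_bdd)
    then show False using s by simp
  qed
  \<comment> \<open>The infimum defining \<open>t j\<close> is attained: the superlevel sets at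
    \<open>t j + 1 / Suc n\<close> increase to the one at \<open>t j\<close>.\<close>
  have v_t: "v (t j) \<le> ennreal (2 powr real_of_int j)" for j
  proof -
    have eq: "{x \<in> space M. t j < F x} = (\<Union>n. {x \<in> space M. t j + 1 / Suc n < F x})"
    proof safe
      fix x assume "x \<in> space M" "t j < F x"
      then obtain n where "1 / Suc n < F x - t j"
        using nat_approx_posE[of "F x - t j"] by auto
      then show "x \<in> (\<Union>n. {x \<in> space M. t j + 1 / Suc n < F x})"
        using \<open>x \<in> space M\<close> by (auto intro!: exI[of _ n])
    next
      fix x n assume "t j + 1 / real (Suc n) < F x"
      moreover have "0 < 1 / real (Suc n)" by simp
      ultimately show "t j < F x" by linarith
    qed
    have "v (t j) = (SUP n. v (t j + 1 / Suc n))"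
      unfolding v_def eq
    proof (rule SUP_emeasure_incseq[symmetric])
      show "incseq (\<lambda>n. {x \<in> space M. t j + 1 / real (Suc n) < F x})"
      proof (rule incseq_SucI, safe)
        fix n x assume "t j + 1 / real (Suc n) < F x"
        moreover have "1 / real (Suc (Suc n)) \<le> 1 / real (Suc n)" by (simp add: field_simps)
        ultimately show "t j + 1 / real (Suc (Suc n)) < F x" by linarith
      qed
    qed auto
    also have "\<dots> \<le> ennreal (2 powr real_of_int j)"
      by (intro SUP_least above) simp
    finally show ?thesis .
  qed
  \<comment> \<open>Write \<open>t j\<close> as the length of \<open>{0..<t j}\<close> and exchange
    sum and integral. At height \<open>s\<close> only those \<open>j\<close> with
    \<open>2 powr j < v s\<close> contribute, in total at most \<open>2 * v s\<close>, and the
    layer-cake formula turns the integral of \<open>v\<close> back into that of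
    \<open>F\<close>.\<close>
  have sum_t: "(\<integral>\<^sup>+j. ennreal (t j * 2 powr real_of_int j) \<partial>count_space UNIV) \<le> 2"
  proof -
    have "(\<integral>\<^sup>+j. ennreal (t j * 2 powr real_of_int j) \<partial>count_space UNIV)
       = (\<integral>\<^sup>+j. \<integral>\<^sup>+s. ennreal (2 powr real_of_int j) * indicator {0..<t j} s \<partial>lborel \<partial>count_space UNIV)"
      using t0 by (intro nn_integral_cong, subst nn_integral_cmult_indicator)
        (simp_all add: ennreal_mult mult.commute)
    also have "\<dots> = (\<integral>\<^sup>+s. \<integral>\<^sup>+j. ennreal (2 powr real_of_int j) * indicator {0..<t j} s \<partial>count_space UNIV \<partial>lborel)"
      by (rule nn_integral_count_space_nn_integral[symmetric]) auto
    also have "\<dots> \<le> (\<integral>\<^sup>+s. 2 * (v s * indicator {0..} s) \<partial>lborel)"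
    proof (rule nn_integral_mono)
      fix s :: real
      show "(\<integral>\<^sup>+j. ennreal (2 powr real_of_int j) * indicator {0..<t j} s \<partial>count_space UNIV) \<le> 2 * (v s * indicator {0..} s)"
      proof (cases "0 \<le> s")
        case True
        have "(\<integral>\<^sup>+j. ennreal (2 powr real_of_int j) * indicator {0..<t j} s \<partial>count_space UNIV)
          \<le> (\<integral>\<^sup>+j. ennreal (2 powr real_of_int j) * indicator {j. ennreal (2 powr real_of_int j) < v s} j \<partial>count_space UNIV)"
          using below[OF True] by (intro nn_integral_mono) (auto split: split_indicator)
        also have "\<dots> \<le> 2 * v s" by (rule nn_integral_dyadic_below)
        finally show ?thesis using True by simp
      qed simp
    qed
    also have "\<dots> = 2 * (\<integral>\<^sup>+s. v s * indicator {0..} s \<partial>lborel)"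
    proof (rule nn_integral_cmult)
      have "v = (\<lambda>s. \<integral>\<^sup>+x. indicator {x \<in> space M. s < F x} x \<partial>M)"
        by (rule ext) (simp add: v_def)
      moreover have "\<dots> \<in> borel_measurable lborel"
        by (rule borel_measurable_nn_integral) (simp add: indicator_def case_prod_beta)
      ultimately have [measurable]: "v \<in> borel_measurable lborel" by simp
      show "(\<lambda>s. v s * indicator {0..} s) \<in> borel_measurable lborel"
        by (intro borel_measurable_times_ennreal borel_measurable_indicator) simp_all
    qed
    also have "(\<integral>\<^sup>+s. v s * indicator {0..} s \<partial>lborel)
        = (\<integral>\<^sup>+s. \<integral>\<^sup>+x. indicator {0..<F x} s \<partial>M \<partial>lborel)"
    proof (rule nn_integral_cong)
      fix s :: real
      have "v s * indicator {0..} s = (\<integral>\<^sup>+x. indicator {x \<in> space M. s < F x} x * indicator {0..} s \<partial>M)"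
        by (subst nn_integral_multc) (auto simp: v_def)
      also have "\<dots> = (\<integral>\<^sup>+x. indicator {0..<F x} s \<partial>M)"
        by (intro nn_integral_cong) (auto split: split_indicator)
      finally show "v s * indicator {0..} s = (\<integral>\<^sup>+x. indicator {0..<F x} s \<partial>M)" .
    qed
    also have "\<dots> = (\<integral>\<^sup>+x. \<integral>\<^sup>+s. indicator {0..<F x} s \<partial>lborel \<partial>M)"
    proof -
      interpret P: pair_sigma_finite M lborel ..
      show ?thesis by (rule P.Fubini') (simp add: indicator_def case_prod_beta)
    qed
    also have "\<dots> = (\<integral>\<^sup>+x. ennreal (F x) \<partial>M)"
      using nonneg by (intro nn_integral_cong) simp
    also have "2 * \<dots> \<le> 2 * 1" by (intro mult_left_mono int_le) simp
    finally show ?thesis by simp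
  qed
  \<comment> \<open>On \<open>E j\<close> the measure is controlled by the lower level
    \<open>t j\<close> and the height by the upper level \<open>t (j - 1)\<close>. This shift by one
    costs the factor 2 in both bounds on \<open>T j * 2 powr j\<close>.\<close>
  define E where "E j = {x \<in> space M. t j < F x \<and> F x \<le> t (j - 1)}" for j
  define T where "T j = t (j - 1)" for j
  show thesis
  proof (rule that[of E T])
    fix j
    show "E j \<in> sets M" by (simp add: E_def)
    have "emeasure M (E j) \<le> v (t j)" unfolding v_def E_def by (intro emeasure_mono) auto
    then show "emeasure M (E j) \<le> ennreal (2 powr real_of_int j)" using v_t[of j] by (rule order_trans)
    show "0 \<le> T j" by (simp add: T_def t0)
    have "T j * 2 powr real_of_int j \<le> 2 powr (- real_of_int (j - 1)) * 2 powr real_of_int j"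
      unfolding T_def by (intro mult_right_mono t_le) simp
    also have "\<dots> = 2" by (simp add: powr_add[symmetric])
    finally show "T j * 2 powr real_of_int j \<le> 2" .
  next
    fix j x assume "x \<in> E j" then show "F x \<le> T j" by (simp add: E_def T_def)
  next
    \<comment> \<open>Points above every level \<open>t (- n)\<close> belong to no
      \<open>E j\<close>. Their measure is at most 2^(-n) for all n, so the cover fails only on a
      null set.\<close>
    define Z where "Z = (\<Inter>n::nat. {x \<in> space M. t (- int n) < F x})"
    have "emeasure M Z \<le> ennreal (inverse (2 ^ n))" for n
    proof -
      have "emeasure M Z \<le> v (t (- int n))" unfolding v_def Z_def by (intro emeasure_mono) auto
      also have "\<dots> \<le> ennreal (2 powr real_of_int (- int n))" by (rule v_t)
      finally show ?thesis by (simp add: powr_minus powr_realpow)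
    qed
    moreover have "(\<lambda>n. ennreal (inverse (2 ^ n))) \<longlonglongrightarrow> ennreal 0"
      by (intro tendsto_ennrealI LIMSEQ_inverse_realpow_zero) simp
    ultimately have "emeasure M Z \<le> ennreal 0"
      by (intro LIMSEQ_le_const[of "\<lambda>n. ennreal (inverse (2 ^ n))"]) auto
    then have "AE x in M. x \<notin> Z"
      by (intro AE_not_in) (auto simp: null_sets_def Z_def)
    with AE_space show "AE x in M. 0 < F x \<longrightarrow> (\<exists>j. x \<in> E j)"
    proof (eventually_elim, intro impI)
      fix x assume xs: "x \<in> space M" and x: "x \<notin> Z" "0 < F x"
      obtain n :: nat where n: "F x \<le> t (- int n)" using x xs by (auto simp: Z_def not_less)
      obtain m :: nat where m: "t (int m) < F x"
      proof -
        obtain m where "inverse (2 ^ m) < F x"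
          using x(2) real_arch_pow_inv[of "F x" "1/2"] by (auto simp: power_one_over inverse_eq_divide)
        then have "t (int m) < F x" using t_le[of "int m"] by (simp add: powr_minus powr_realpow)
        then show ?thesis by (rule that)
      qed
      have "\<exists>k. t (- int n + int k) < F x"
        by (rule exI[of _ "n + m"]) (simp add: m)
      \<comment> \<open>The first index at which the level drops below \<open>F x\<close> yields two
        neighbouring levels that enclose it.\<close>
      define k where "k = (LEAST k. t (- int n + int k) < F x)"
      have k: "t (- int n + int k) < F x" unfolding k_def by (rule LeastI_ex) fact
      have "k \<noteq> 0" using k n by (intro notI) simp
      then have "\<not> t (- int n + int (k - 1)) < F x"
        unfolding k_def by (intro not_less_Least) simp
      then have "x \<in> E (- int n + int k)"
        using k xs \<open>k \<noteq> 0\<close> by (simp add: E_def not_less of_nat_diff algebra_simps)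
      then show "\<exists>j. x \<in> E j" ..
    qed
  next
    have "(\<integral>\<^sup>+j. ennreal (T j * 2 powr real_of_int j) \<partial>count_space UNIV)
        = (\<integral>\<^sup>+j. 2 * ennreal (t (j - 1) * 2 powr real_of_int (j - 1)) \<partial>count_space UNIV)"
      unfolding T_def using t0 by (intro nn_integral_cong)
        (simp add: powr_diff ennreal_mult[symmetric] flip: ennreal_numeral)
    also have "\<dots> = 2 * (\<integral>\<^sup>+j. ennreal (t (j - 1) * 2 powr real_of_int (j - 1)) \<partial>count_space UNIV)"
      by (rule nn_integral_cmult) simp
    also have "\<dots> = 2 * (\<integral>\<^sup>+j. ennreal (t j * 2 powr real_of_int j) \<partial>count_space UNIV)"
      by (subst nn_integral_int_shift) simp
    also have "\<dots> \<le> 2 * 2" by (intro mult_left_mono sum_t) simp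
    finally show "(\<integral>\<^sup>+j. ennreal (T j * 2 powr real_of_int j) \<partial>count_space UNIV) \<le> 4" by simp
  qed
qed

text \<open>The kernel is tested on pairs of sets only. Since \<open>a + b\<close> has the same
  value at both endpoints as at \<open>(1/p, 1/q)\<close>, passing from that point to an endpoint
  multiplies the bound for the block \<open>(j, k)\<close> by a power of
  \<open>2 powr (j - k)\<close> alone. The conclusion is for functions of norm at most 1;
  \<open>stein_weiss\<close> restores the norms by homogeneity.\<close>

lemma restricted_interpolation:
  fixes K :: "'a \<Rightarrow> 'a \<Rightarrow> ennreal" and p q C a\<^sub>0 b\<^sub>0 a\<^sub>1 b\<^sub>1 :: real
  assumes "sigma_finite_measure M"
    and K[measurable]: "(\<lambda>(x, y). K x y) \<in> borel_measurable (M \<Otimes>\<^sub>M M)"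
    and C: "0 \<le> C"
    and R0: "\<And>E F m n. E \<in> sets M \<Longrightarrow> F \<in> sets M \<Longrightarrow> 0 < m \<Longrightarrow> 0 < n \<Longrightarrow>
      emeasure M E \<le> ennreal m \<Longrightarrow> emeasure M F \<le> ennreal n \<Longrightarrow>
      (\<integral>\<^sup>+y. \<integral>\<^sup>+x. indicator E x * indicator F y * K x y \<partial>M \<partial>M) \<le> ennreal (C * (m powr a\<^sub>0 * n powr b\<^sub>0))"
    and R1: "\<And>E F m n. E \<in> sets M \<Longrightarrow> F \<in> sets M \<Longrightarrow> 0 < m \<Longrightarrow> 0 < n \<Longrightarrow>
      emeasure M E \<le> ennreal m \<Longrightarrow> emeasure M F \<le> ennreal n \<Longrightarrow>
      (\<integral>\<^sup>+y. \<integral>\<^sup>+x. indicator E x * indicator F y * K x y \<partial>M \<partial>M) \<le> ennreal (C * (m powr a\<^sub>1 * n powr b\<^sub>1))"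
    and sums: "a\<^sub>0 + b\<^sub>0 = 1 / p + 1 / q" "a\<^sub>1 + b\<^sub>1 = 1 / p + 1 / q" and ge1: "1 \<le> 1 / p + 1 / q"
    and between: "a\<^sub>1 < 1 / p" "1 / p < a\<^sub>0" and pq: "0 < p" "0 < q"
  shows "\<exists>B\<ge>0. \<forall>f g :: 'a \<Rightarrow> real. f \<in> borel_measurable M \<longrightarrow> g \<in> borel_measurable M \<longrightarrow>
    (\<forall>x. 0 \<le> f x) \<longrightarrow> (\<forall>x. 0 \<le> g x) \<longrightarrow>
    (\<integral>\<^sup>+x. ennreal (f x powr p) \<partial>M) \<le> 1 \<longrightarrow> (\<integral>\<^sup>+x. ennreal (g x powr q) \<partial>M) \<le> 1 \<longrightarrow>
    (\<integral>\<^sup>+y. \<integral>\<^sup>+x. ennreal (f x) * ennreal (g y) * K x y \<partial>M \<partial>M) \<le> ennreal B"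
proof -
  interpret sigma_finite_measure M by fact
  interpret P: pair_sigma_finite M M ..
  define \<delta> where "\<delta> = min (a\<^sub>0 - 1 / p) (1 / p - a\<^sub>1)"
  have \<delta>: "0 < \<delta>" using between by (auto simp: \<delta>_def)
  define G where "G = (\<integral>\<^sup>+k. ennreal (2 powr (- \<delta> * \<bar>real_of_int k\<bar>)) \<partial>count_space UNIV)"
  have G: "G < \<infinity>" unfolding G_def by (rule nn_integral_int_geometric_finite) fact
  define c where "c = 2 powr (1 / p + 1 / q)"
  define B where "B = enn2real (ennreal (C * c) * (2 * (2 * G)))"
  have B: "ennreal B = ennreal (C * c) * (2 * (2 * G))"
    unfolding B_def by (rule ennreal_enn2real) (use G in \<open>auto simp: ennreal_mult_less_top\<close>)
  show ?thesis
  proof (intro exI[of _ B] conjI allI impI)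
    show "0 \<le> B" by (simp add: B_def)
    fix f g :: "'a \<Rightarrow> real"
    assume fg[measurable]: "f \<in> borel_measurable M" "g \<in> borel_measurable M"
      and f0: "\<forall>x. 0 \<le> f x" and g0: "\<forall>x. 0 \<le> g x"
      and f1: "(\<integral>\<^sup>+x. ennreal (f x powr p) \<partial>M) \<le> 1" and g1: "(\<integral>\<^sup>+x. ennreal (g x powr q) \<partial>M) \<le> 1"
    obtain E T where E: "\<And>j. E j \<in> sets M" "\<And>j. emeasure M (E j) \<le> ennreal (2 powr real_of_int j)"
      and T: "\<And>j. 0 \<le> T j" "\<And>j. T j * 2 powr real_of_int j \<le> 2" "\<And>j x. x \<in> E j \<Longrightarrow> f x powr p \<le> T j"
      and E_cover: "AE x in M. 0 < f x powr p \<longrightarrow> (\<exists>j. x \<in> E j)"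
      and T_sum: "(\<integral>\<^sup>+j. ennreal (T j * 2 powr real_of_int j) \<partial>count_space UNIV) \<le> 4"
      using dyadic_level_sets[of M "\<lambda>x. f x powr p"] assms(1) f1 by (auto simp del: powr_gt_zero)
    obtain F S where F: "\<And>j. F j \<in> sets M" "\<And>j. emeasure M (F j) \<le> ennreal (2 powr real_of_int j)"
      and S: "\<And>j. 0 \<le> S j" "\<And>j. S j * 2 powr real_of_int j \<le> 2" "\<And>j x. x \<in> F j \<Longrightarrow> g x powr q \<le> S j"
      and F_cover: "AE x in M. 0 < g x powr q \<longrightarrow> (\<exists>j. x \<in> F j)"
      and S_sum: "(\<integral>\<^sup>+j. ennreal (S j * 2 powr real_of_int j) \<partial>count_space UNIV) \<le> 4"
      using dyadic_level_sets[of M "\<lambda>x. g x powr q"] assms(1) g1 by (auto simp del: powr_gt_zero)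
    note [measurable] = E(1) F(1)
    define w where "w j k = T j powr (1 / p) * S k powr (1 / q)" for j k
    have w0: "0 \<le> w j k" for j k by (simp add: w_def)
    have root_f: "f x \<le> T j powr (1 / p)" if "x \<in> E j" for x j
    proof -
      have "f x = (f x powr p) powr (1 / p)" using pq f0 by (simp add: powr_powr)
      also have "\<dots> \<le> T j powr (1 / p)" using T(3)[OF that] pq by (intro powr_mono2) auto
      finally show ?thesis .
    qed
    have root_g: "g x \<le> S j powr (1 / q)" if "x \<in> F j" for x j
    proof -
      have "g x = (g x powr q) powr (1 / q)" using pq g0 by (simp add: powr_powr)
      also have "\<dots> \<le> S j powr (1 / q)" using S(3)[OF that] pq by (intro powr_mono2) auto
      finally show ?thesis .
    qed
    have count_point: "h j \<le> (\<integral>\<^sup>+i. h i \<partial>count_space UNIV)" for h :: "int \<Rightarrow> ennreal" and j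
      using nn_integral_mono[of "count_space UNIV" "\<lambda>i. h j * indicator {j} i" h]
      by (auto split: split_indicator)
    define H where "H x y = (\<integral>\<^sup>+j. \<integral>\<^sup>+k. ennreal (w j k) * (indicator (E j) x * indicator (F k) y * K x y)
        \<partial>count_space UNIV \<partial>count_space UNIV)" for x y
    have pointwise: "ennreal (f x) * ennreal (g y) * K x y \<le> H x y"
      if "0 < f x powr p \<longrightarrow> (\<exists>j. x \<in> E j)" "0 < g y powr q \<longrightarrow> (\<exists>j. y \<in> F j)" for x y
    proof (cases "f x = 0 \<or> g y = 0")
      case False
      then have "\<exists>j. x \<in> E j" "\<exists>k. y \<in> F k" using that f0 g0 by auto
      then obtain j k where jk: "x \<in> E j" "y \<in> F k" by blast
      have "ennreal (f x) * ennreal (g y) * K x y \<le> ennreal (w j k) * K x y"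
        unfolding w_def using root_f[OF jk(1)] root_g[OF jk(2)] f0 g0
        by (intro mult_right_mono) (auto simp: ennreal_mult[symmetric] intro!: ennreal_leI mult_mono)
      also have "\<dots> = ennreal (w j k) * (indicator (E j) x * indicator (F k) y * K x y)"
        using jk by simp
      also have "\<dots> \<le> (\<integral>\<^sup>+k. ennreal (w j k) * (indicator (E j) x * indicator (F k) y * K x y) \<partial>count_space UNIV)"
        by (rule count_point)
      also have "\<dots> \<le> H x y" unfolding H_def by (rule count_point)
      finally show ?thesis .
    qed auto
    have term_le: "w j k * (C * ((2 powr j) powr s * (2 powr k) powr t))
        \<le> C * c * ((T j * 2 powr j / 2 + S k * 2 powr k / 2) * 2 powr (- \<delta> * \<bar>real_of_int (k - j)\<bar>))"
      if st: "s + t = 1 / p + 1 / q" "(s - 1 / p) * real_of_int (j - k) \<le> - \<delta> * \<bar>real_of_int (k - j)\<bar>"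
      for s t :: real and j k :: int
    proof -
      define X where "X = T j * 2 powr j / 2"
      define Y where "Y = S k * 2 powr k / 2"
      have XY: "0 \<le> X" "X \<le> 1" "0 \<le> Y" "Y \<le> 1" using T(1,2)[of j] S(1,2)[of k] by (auto simp: X_def Y_def)
      \<comment> \<open>Halving put \<open>X\<close> and \<open>Y\<close> into the unit interval, so
        an exponent of at least 1 can be lowered to 1. Bounding the product by a sum takes the place
        of Hoelder's inequality: each summand then depends on one index, and the other index meets
        only a geometric factor.\<close>
      have "X powr (1 / p) * Y powr (1 / q) \<le> max X Y powr (1 / p) * max X Y powr (1 / q)"
        using XY pq by (intro mult_mono powr_mono2) auto
      also have "\<dots> = max X Y powr (1 / p + 1 / q)" by (simp add: powr_add)
      also have "\<dots> \<le> max X Y powr 1"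
        using XY ge1 by (intro powr_mono') (auto simp: max_def)
      also have "\<dots> \<le> X + Y" using XY by (auto simp: max_def)
      finally have young: "X powr (1 / p) * Y powr (1 / q) \<le> X + Y" .
      have Tj: "T j powr (1 / p) * 2 powr (j / p) = 2 powr (1 / p) * X powr (1 / p)"
        unfolding X_def using T(1)[of j] by (simp add: powr_mult powr_divide powr_powr)
      have Sk: "S k powr (1 / q) * 2 powr (k / q) = 2 powr (1 / q) * Y powr (1 / q)"
        unfolding Y_def using S(1)[of k] by (simp add: powr_mult powr_divide powr_powr)
      have "j * s + k * t = j / p + k / q + (s - 1 / p) * (j - k)"
      proof -
        have t: "t = 1 / p + 1 / q - s" using st(1) by simp
        show ?thesis unfolding t by (simp add: algebra_simps)
      qed
      then have "(2 powr j) powr s * (2 powr k) powr t = 2 powr (j / p) * 2 powr (k / q) * 2 powr ((s - 1 / p) * (j - k))"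
        by (simp add: powr_powr powr_add[symmetric])
      then have "w j k * (C * ((2 powr j) powr s * (2 powr k) powr t))
         = C * ((T j powr (1 / p) * 2 powr (j / p)) * (S k powr (1 / q) * 2 powr (k / q)) * 2 powr ((s - 1 / p) * (j - k)))"
        unfolding w_def by (simp add: mult_ac)
      also have "\<dots> = C * c * ((X powr (1 / p) * Y powr (1 / q)) * 2 powr ((s - 1 / p) * (j - k)))"
        unfolding Tj Sk c_def powr_add by (simp add: mult_ac)
      also have "\<dots> \<le> C * c * ((X + Y) * 2 powr (- \<delta> * \<bar>real_of_int (k - j)\<bar>))"
      proof (intro mult_left_mono mult_mono)
        show "2 powr ((s - 1 / p) * real_of_int (j - k)) \<le> 2 powr (- \<delta> * \<bar>real_of_int (k - j)\<bar>)"
          using st(2) by (intro powr_mono) auto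
      qed (use young C XY in \<open>auto simp: c_def\<close>)
      finally show ?thesis unfolding X_def Y_def by simp
    qed
    have block: "(\<integral>\<^sup>+y. \<integral>\<^sup>+x. ennreal (w j k) * (indicator (E j) x * indicator (F k) y * K x y) \<partial>M \<partial>M)
        \<le> ennreal (C * c * ((T j * 2 powr j / 2 + S k * 2 powr k / 2) * 2 powr (- \<delta> * \<bar>real_of_int (k - j)\<bar>)))" for j k
    proof -
      have "(\<integral>\<^sup>+y. \<integral>\<^sup>+x. ennreal (w j k) * (indicator (E j) x * indicator (F k) y * K x y) \<partial>M \<partial>M)
         = ennreal (w j k) * (\<integral>\<^sup>+y. \<integral>\<^sup>+x. indicator (E j) x * indicator (F k) y * K x y \<partial>M \<partial>M)"
      proof -
        have "(\<integral>\<^sup>+y. \<integral>\<^sup>+x. ennreal (w j k) * (indicator (E j) x * indicator (F k) y * K x y) \<partial>M \<partial>M)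
          = (\<integral>\<^sup>+y. ennreal (w j k) * (\<integral>\<^sup>+x. indicator (E j) x * indicator (F k) y * K x y \<partial>M) \<partial>M)"
          by (intro nn_integral_cong nn_integral_cmult) measurable
        also have "\<dots> = ennreal (w j k) * (\<integral>\<^sup>+y. \<integral>\<^sup>+x. indicator (E j) x * indicator (F k) y * K x y \<partial>M \<partial>M)"
          by (rule nn_integral_cmult) measurable
        finally show ?thesis .
      qed
      also have "\<dots> \<le> ennreal (C * c * ((T j * 2 powr j / 2 + S k * 2 powr k / 2) * 2 powr (- \<delta> * \<bar>real_of_int (k - j)\<bar>)))"
      \<comment> \<open>The block bound carries \<open>2 powr ((s - 1 / p) * (j - k))\<close>, where
        \<open>s\<close> is the exponent of the set \<open>E j\<close>. It decays for
        \<open>j \<le> k\<close> if \<open>s > 1 / p\<close>, which calls for the first estimate,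
        and for \<open>j > k\<close> if \<open>s < 1 / p\<close>, which calls for the
        second.\<close>
      proof (cases "j \<le> k")
        case True
        have "ennreal (w j k) * (\<integral>\<^sup>+y. \<integral>\<^sup>+x. indicator (E j) x * indicator (F k) y * K x y \<partial>M \<partial>M)
          \<le> ennreal (w j k) * ennreal (C * ((2 powr real_of_int j) powr a\<^sub>0 * (2 powr real_of_int k) powr b\<^sub>0))"
          by (intro mult_left_mono R0 E F) auto
        also have "\<dots> = ennreal (w j k * (C * ((2 powr real_of_int j) powr a\<^sub>0 * (2 powr real_of_int k) powr b\<^sub>0)))"
          using C w0 by (simp add: ennreal_mult)
        also have "\<dots> \<le> ennreal (C * c * ((T j * 2 powr j / 2 + S k * 2 powr k / 2) * 2 powr (- \<delta> * \<bar>real_of_int (k - j)\<bar>)))"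
        proof (rule ennreal_leI[OF term_le[OF sums(1)]])
          have "\<delta> * (real_of_int k - j) \<le> (a\<^sub>0 - 1 / p) * (real_of_int k - j)"
            using True by (intro mult_right_mono) (auto simp: \<delta>_def)
          then show "(a\<^sub>0 - 1 / p) * real_of_int (j - k) \<le> - \<delta> * \<bar>real_of_int (k - j)\<bar>"
            using True by (simp add: algebra_simps)
        qed
        finally show ?thesis .
      next
        case False
        have "ennreal (w j k) * (\<integral>\<^sup>+y. \<integral>\<^sup>+x. indicator (E j) x * indicator (F k) y * K x y \<partial>M \<partial>M)
          \<le> ennreal (w j k) * ennreal (C * ((2 powr real_of_int j) powr a\<^sub>1 * (2 powr real_of_int k) powr b\<^sub>1))"
          by (intro mult_left_mono R1 E F) auto
        also have "\<dots> = ennreal (w j k * (C * ((2 powr real_of_int j) powr a\<^sub>1 * (2 powr real_of_int k) powr b\<^sub>1)))"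
          using C w0 by (simp add: ennreal_mult)
        also have "\<dots> \<le> ennreal (C * c * ((T j * 2 powr j / 2 + S k * 2 powr k / 2) * 2 powr (- \<delta> * \<bar>real_of_int (k - j)\<bar>)))"
        proof (rule ennreal_leI[OF term_le[OF sums(2)]])
          have "\<delta> * (real_of_int j - k) \<le> (1 / p - a\<^sub>1) * (real_of_int j - k)"
            using False by (intro mult_right_mono) (auto simp: \<delta>_def)
          then show "(a\<^sub>1 - 1 / p) * real_of_int (j - k) \<le> - \<delta> * \<bar>real_of_int (k - j)\<bar>"
            using False by (simp add: algebra_simps)
        qed
        finally show ?thesis .
      qed
      finally show ?thesis .
    qed
    have swap: "(\<integral>\<^sup>+y. \<integral>\<^sup>+x. H x y \<partial>M \<partial>M) = (\<integral>\<^sup>+j. \<integral>\<^sup>+k. \<integral>\<^sup>+y. \<integral>\<^sup>+x.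
        ennreal (w j k) * (indicator (E j) x * indicator (F k) y * K x y) \<partial>M \<partial>M \<partial>count_space UNIV \<partial>count_space UNIV)"
    proof -
      \<comment> \<open>Packing both indices into one pair lets each of the two integrals be
        exchanged with the double sum in a single step.\<close>
      define h where "h jk x y = ennreal (w (fst jk) (snd jk)) * (indicator (E (fst jk)) x * indicator (F (snd jk)) y * K x y)" for jk x y
      have [measurable]: "(\<lambda>(x, y). h jk x y) \<in> borel_measurable (M \<Otimes>\<^sub>M M)" for jk unfolding h_def by measurable
      have [measurable]: "(\<lambda>(y, x). h jk x y) \<in> borel_measurable (M \<Otimes>\<^sub>M M)" for jk unfolding h_def by measurable
      have H: "H x y = (\<integral>\<^sup>+jk. h jk x y \<partial>count_space UNIV)" for x y
        unfolding H_def using nn_integral_fst_count_space[of "\<lambda>jk. h jk x y"] by (simp add: h_def)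
      have "(\<integral>\<^sup>+y. \<integral>\<^sup>+x. H x y \<partial>M \<partial>M) = (\<integral>\<^sup>+y. \<integral>\<^sup>+jk. \<integral>\<^sup>+x. h jk x y \<partial>M \<partial>count_space UNIV \<partial>M)"
        unfolding H by (intro nn_integral_cong nn_integral_count_space_nn_integral) auto
      also have "\<dots> = (\<integral>\<^sup>+jk. \<integral>\<^sup>+y. \<integral>\<^sup>+x. h jk x y \<partial>M \<partial>M \<partial>count_space UNIV)"
        by (intro nn_integral_count_space_nn_integral) auto
      finally show ?thesis
        using nn_integral_fst_count_space[of "\<lambda>jk. \<integral>\<^sup>+y. \<integral>\<^sup>+x. h jk x y \<partial>M \<partial>M"] by (simp add: h_def)
    qed
    have "(\<integral>\<^sup>+y. \<integral>\<^sup>+x. ennreal (f x) * ennreal (g y) * K x y \<partial>M \<partial>M) \<le> (\<integral>\<^sup>+y. \<integral>\<^sup>+x. H x y \<partial>M \<partial>M)"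
    proof (rule nn_integral_mono_AE, use F_cover in eventually_elim)
      fix y assume y: "0 < g y powr q \<longrightarrow> (\<exists>j. y \<in> F j)"
      show "(\<integral>\<^sup>+x. ennreal (f x) * ennreal (g y) * K x y \<partial>M) \<le> (\<integral>\<^sup>+x. H x y \<partial>M)"
        by (rule nn_integral_mono_AE, use E_cover in eventually_elim) (use y pointwise in blast)
    qed
    also have "\<dots> \<le> (\<integral>\<^sup>+j. \<integral>\<^sup>+k. ennreal (C * c * ((T j * 2 powr j / 2 + S k * 2 powr k / 2) * 2 powr (- \<delta> * \<bar>real_of_int (k - j)\<bar>)))
         \<partial>count_space UNIV \<partial>count_space UNIV)"
      unfolding swap by (intro nn_integral_mono block)
    also have "\<dots> = (\<integral>\<^sup>+j. \<integral>\<^sup>+k. ennreal (C * c) * (ennreal (T j * 2 powr j / 2) * ennreal (2 powr (- \<delta> * \<bar>real_of_int (k - j)\<bar>))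
           + ennreal (S k * 2 powr k / 2) * ennreal (2 powr (- \<delta> * \<bar>real_of_int (k - j)\<bar>)))
         \<partial>count_space UNIV \<partial>count_space UNIV)"
      using T(1) S(1) C by (intro nn_integral_cong)
        (simp add: ennreal_mult[symmetric] ennreal_plus[symmetric] c_def distrib_right del: ennreal_plus)
    also have "\<dots> = ennreal (C * c) * ((\<integral>\<^sup>+j. \<integral>\<^sup>+k. ennreal (T j * 2 powr j / 2) * ennreal (2 powr (- \<delta> * \<bar>real_of_int (k - j)\<bar>)) \<partial>count_space UNIV \<partial>count_space UNIV)
       + (\<integral>\<^sup>+j. \<integral>\<^sup>+k. ennreal (S k * 2 powr k / 2) * ennreal (2 powr (- \<delta> * \<bar>real_of_int (k - j)\<bar>)) \<partial>count_space UNIV \<partial>count_space UNIV))"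
      by (simp add: nn_integral_cmult nn_integral_add)
    also have "(\<integral>\<^sup>+j. \<integral>\<^sup>+k. ennreal (T j * 2 powr j / 2) * ennreal (2 powr (- \<delta> * \<bar>real_of_int (k - j)\<bar>)) \<partial>count_space UNIV \<partial>count_space UNIV)
        = (\<integral>\<^sup>+j. ennreal (T j * 2 powr j / 2) \<partial>count_space UNIV) * G"
      using nn_integral_int_shift[of "\<lambda>k. ennreal (2 powr (- \<delta> * \<bar>real_of_int k\<bar>))"]
      by (simp add: nn_integral_cmult nn_integral_multc G_def)
    \<comment> \<open>The order of summation is exchanged so that the geometric factor is again the
      inner sum.\<close>
    also have "(\<integral>\<^sup>+j. \<integral>\<^sup>+k. ennreal (S k * 2 powr k / 2) * ennreal (2 powr (- \<delta> * \<bar>real_of_int (k - j)\<bar>)) \<partial>count_space UNIV \<partial>count_space UNIV)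
        = (\<integral>\<^sup>+k. \<integral>\<^sup>+j. ennreal (S k * 2 powr k / 2) * ennreal (2 powr (- \<delta> * \<bar>real_of_int (j - k)\<bar>)) \<partial>count_space UNIV \<partial>count_space UNIV)"
      by (subst nn_integral_count_space_nn_integral) (auto simp: abs_minus_commute)
    also have "\<dots> = (\<integral>\<^sup>+j. ennreal (S j * 2 powr j / 2) \<partial>count_space UNIV) * G"
      using nn_integral_int_shift[of "\<lambda>k. ennreal (2 powr (- \<delta> * \<bar>real_of_int k\<bar>))"]
      by (simp add: nn_integral_cmult nn_integral_multc G_def)
    also have "ennreal (C * c) * ((\<integral>\<^sup>+j. ennreal (T j * 2 powr j / 2) \<partial>count_space UNIV) * G
        + (\<integral>\<^sup>+j. ennreal (S j * 2 powr j / 2) \<partial>count_space UNIV) * G) \<le> ennreal (C * c) * (2 * G + 2 * G)"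
    proof -
      have half: "(\<integral>\<^sup>+j. ennreal (h j * 2 powr j / 2) \<partial>count_space UNIV) \<le> 2"
        if "(\<integral>\<^sup>+j. ennreal (h j * 2 powr real_of_int j) \<partial>count_space UNIV) \<le> 4" "\<And>j. 0 \<le> h j" for h :: "int \<Rightarrow> real"
      proof -
        have "(\<integral>\<^sup>+j. ennreal (h j * 2 powr j / 2) \<partial>count_space UNIV)
          = (\<integral>\<^sup>+j. ennreal (1 / 2) * ennreal (h j * 2 powr j) \<partial>count_space UNIV)"
          using that(2) by (intro nn_integral_cong) (subst ennreal_mult[symmetric], auto)
        also have "\<dots> = ennreal (1 / 2) * (\<integral>\<^sup>+j. ennreal (h j * 2 powr j) \<partial>count_space UNIV)"
          by (rule nn_integral_cmult) simp
        also have "\<dots> \<le> ennreal (1 / 2) * ennreal 4"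
          using that(1) by (intro mult_left_mono) auto
        also have "\<dots> = 2" by (subst ennreal_mult[symmetric]) auto
        finally show ?thesis .
      qed
      show ?thesis by (intro mult_left_mono add_mono mult_right_mono half T_sum S_sum T S) auto
    qed
    also have "\<dots> = ennreal B" unfolding B by (simp add: mult.assoc[symmetric] mult_2[symmetric])
    finally show "(\<integral>\<^sup>+y. \<integral>\<^sup>+x. ennreal (f x) * ennreal (g y) * K x y \<partial>M \<partial>M) \<le> ennreal B" .
  qed
qed

subsection \<open>Restricted estimates for the Stein--Weiss kernel\<close>

text \<open>Cut at the radius \<open>r\<close> with \<open>r powr Q = m\<close>. Where
  \<open>h \<ge> r\<close> the integrand is at most \<open>r powr (- s)\<close> on a set of measure
  at most \<open>m\<close>. Where \<open>h < r\<close>, the dyadic shells contribute a geometric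
  series of ratio \<open>2 powr (- (Q - s))\<close>, convergent because \<open>s < Q\<close>. The
  constant is chosen before \<open>h\<close>, so the bound is uniform when \<open>h\<close> runs
  through all distance functions \<open>d x\<close> and all their counterparts in the other
  variable.\<close>

lemma nn_integral_powr_neg_le:
  fixes c Q s :: real
  assumes c: "0 \<le> c" and s: "0 \<le> s" "s < Q"
  shows "\<exists>B\<ge>0. \<forall>h E m. h \<in> borel_measurable M \<longrightarrow> (\<forall>x. 0 \<le> h x) \<longrightarrow>
    (\<forall>r>0. emeasure M {x \<in> space M. h x < r} \<le> ennreal (c * r powr Q)) \<longrightarrow>
    E \<in> sets M \<longrightarrow> 0 < m \<longrightarrow> emeasure M E \<le> ennreal m \<longrightarrow>
    (\<integral>\<^sup>+x. indicator E x * ennreal (h x powr (- s)) \<partial>M) \<le> ennreal (B * m powr (1 - s / Q))"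
proof -
  define \<rho> where "\<rho> = 2 powr (- (Q - s))"
  have \<rho>: "0 < \<rho>" "\<rho> < 1" using s by (auto simp: \<rho>_def powr_less_one)
  define A where "A = (\<Sum>k. c * 2 powr s * \<rho> ^ k)"
  have A_summable: "summable (\<lambda>k. c * 2 powr s * \<rho> ^ k)"
    using \<rho> by (intro summable_mult summable_geometric) simp
  have A0: "0 \<le> A" unfolding A_def using c \<rho> by (intro suminf_nonneg A_summable) auto
  show ?thesis
  proof (intro exI[of _ "1 + A"] conjI allI impI)
    show "0 \<le> 1 + A" using A0 by simp
    fix h E and m :: real
    assume h[measurable]: "h \<in> borel_measurable M" and h0: "\<forall>x. 0 \<le> h x"
      and ball: "\<forall>r>0. emeasure M {x \<in> space M. h x < r} \<le> ennreal (c * r powr Q)"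
      and E[measurable]: "E \<in> sets M" and m: "0 < m" "emeasure M E \<le> ennreal m"
    define r where "r = m powr (1 / Q)"
    have r: "0 < r" using m by (simp add: r_def)
    have rQ: "r powr Q = m" using m s by (simp add: r_def powr_powr)
    have rs: "r powr (Q - s) = m powr (1 - s / Q)"
      using s by (simp add: r_def powr_powr diff_divide_distrib)
    define e where "e k = (r / 2 ^ Suc k) powr (- s)" for k :: nat
    define U where "U k = {x \<in> space M. h x < r / 2 ^ k}" for k :: nat
    have [measurable]: "U k \<in> sets M" for k by (simp add: U_def)
    have point: "indicator E x * ennreal (h x powr (- s))
        \<le> ennreal (r powr (- s)) * indicator E x + (\<Sum>k. ennreal (e k) * indicator (U k) x)"
      if x: "x \<in> space M" for x
    proof (cases "r \<le> h x")
      case True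
      have "h x powr (- s) \<le> r powr (- s)" using True r s by (intro powr_mono2') auto
      then show ?thesis by (auto split: split_indicator intro!: add_increasing2 ennreal_leI)
    next
      case hr: False
      show ?thesis
      \<comment> \<open>At a zero of \<open>h\<close> the integrand is
        \<open>0 powr (- s) = 0\<close>, so only positive values have to be placed in a
        shell.\<close>
      proof (cases "h x = 0")
        case False
        then have hx: "0 < h x" using h0[rule_format, of x] by simp
        obtain k0 where "(1 / 2) ^ k0 < h x / r"
          using real_arch_pow_inv[of "h x / r" "1 / 2"] hx r by auto
        then have "\<exists>k. r / 2 ^ k \<le> h x"
          using r by (intro exI[of _ k0]) (auto simp: power_one_over field_simps)
        define l where "l = (LEAST k. r / 2 ^ k \<le> h x)"
        have l: "r / 2 ^ l \<le> h x" unfolding l_def by (rule LeastI_ex) fact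
        have "l \<noteq> 0" using l hr by (intro notI) simp
        then obtain k where k: "l = Suc k" by (cases l) auto
        have "\<not> r / 2 ^ k \<le> h x" using not_less_Least[of k "\<lambda>k. r / 2 ^ k \<le> h x"] k by (simp add: l_def)
        then have xU: "x \<in> U k" using x by (simp add: U_def)
        have "h x powr (- s) \<le> e k" unfolding e_def using l k r s by (intro powr_mono2') auto
        then have "indicator E x * ennreal (h x powr (- s)) \<le> ennreal (e k) * indicator (U k) x"
          using xU by (auto split: split_indicator intro!: ennreal_leI)
        also have "\<dots> \<le> (\<Sum>k. ennreal (e k) * indicator (U k) x)"
          using sum_le_suminf[of "\<lambda>k. ennreal (e k) * indicator (U k) x" "{k}"]
          by (simp del: sum_mult_indicator)
        finally show ?thesis by (simp add: add_increasing)
      qed simp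
    qed
    have "(\<integral>\<^sup>+x. indicator E x * ennreal (h x powr (- s)) \<partial>M)
      \<le> (\<integral>\<^sup>+x. ennreal (r powr (- s)) * indicator E x + (\<Sum>k. ennreal (e k) * indicator (U k) x) \<partial>M)"
      by (intro nn_integral_mono point)
    also have "\<dots> = ennreal (r powr (- s)) * emeasure M E + (\<Sum>k. ennreal (e k) * emeasure M (U k))"
      by (simp add: nn_integral_add nn_integral_suminf nn_integral_cmult_indicator)
    also have "\<dots> \<le> ennreal (m powr (1 - s / Q)) + ennreal (A * m powr (1 - s / Q))"
    proof (rule add_mono)
      have "ennreal (r powr (- s)) * emeasure M E \<le> ennreal (r powr (- s)) * ennreal m"
        using m by (intro mult_left_mono) auto
      also have "\<dots> = ennreal (r powr (Q - s))"
        using m rQ by (simp add: ennreal_mult[symmetric] powr_diff powr_minus field_simps)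
      finally show "ennreal (r powr (- s)) * emeasure M E \<le> ennreal (m powr (1 - s / Q))" by (simp add: rs)
      have "ennreal (e k) * emeasure M (U k) \<le> ennreal (c * 2 powr s * \<rho> ^ k * m powr (1 - s / Q))" for k
      proof -
        have "ennreal (e k) * emeasure M (U k) \<le> ennreal (e k) * ennreal (c * (r / 2 ^ k) powr Q)"
          unfolding U_def using r by (intro mult_left_mono ball[rule_format]) auto
        also have "\<dots> = ennreal (e k * (c * (r / 2 ^ k) powr Q))"
          using c by (simp add: ennreal_mult e_def)
        also have "e k * (c * (r / 2 ^ k) powr Q) = c * 2 powr s * \<rho> ^ k * r powr (Q - s)"
        proof -
          have "r / 2 ^ Suc k = r * 2 powr (- real k - 1)" "r / 2 ^ k = r * 2 powr (- real k)"
            by (simp_all add: powr_diff powr_minus powr_realpow field_simps)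
          then have "e k = r powr (- s) * 2 powr (real k * s + s)" "(r / 2 ^ k) powr Q = r powr Q * 2 powr (- real k * Q)"
            using r by (simp_all add: e_def powr_mult powr_powr algebra_simps)
          moreover have "\<rho> ^ k = 2 powr (real k * s) * 2 powr (- real k * Q)"
            by (simp add: \<rho>_def powr_realpow[symmetric] powr_powr powr_add[symmetric] algebra_simps)
          moreover have "r powr (Q - s) = r powr Q * r powr (- s)" by (simp add: powr_add[symmetric])
          ultimately show ?thesis by (simp only: powr_add mult_ac)
        qed
        finally show ?thesis unfolding rs .
      qed
      then have "(\<Sum>k. ennreal (e k) * emeasure M (U k)) \<le> (\<Sum>k. ennreal (c * 2 powr s * \<rho> ^ k * m powr (1 - s / Q)))"
        by (intro suminf_le) auto
      also have "\<dots> = ennreal (\<Sum>k. c * 2 powr s * \<rho> ^ k * m powr (1 - s / Q))"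
        using c \<rho> by (intro suminf_ennreal2 summable_mult2 A_summable) auto
      also have "(\<Sum>k. c * 2 powr s * \<rho> ^ k * m powr (1 - s / Q)) = A * m powr (1 - s / Q)"
        unfolding A_def by (rule suminf_mult2[symmetric]) (rule A_summable)
      finally show "(\<Sum>k. ennreal (e k) * emeasure M (U k)) \<le> ennreal (A * m powr (1 - s / Q))" .
    qed
    also have "\<dots> = ennreal ((1 + A) * m powr (1 - s / Q))"
      using A0 by (subst ennreal_plus[symmetric]) (auto simp: algebra_simps)
    finally show "(\<integral>\<^sup>+x. indicator E x * ennreal (h x powr (- s)) \<partial>M) \<le> ennreal ((1 + A) * m powr (1 - s / Q))" .
  qed
qed

text \<open>Here \<open>d x y\<close> stands for the quasi-norm of y^(-1)x. The endpoint with
  exponents \<open>1 - \<alpha> / Q\<close> and \<open>1 - lam / Q\<close> comes from the kernel as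
  it stands. For the endpoint \<open>1 - \<mu> / Q\<close>, \<open>1 - \<epsilon> / Q\<close> the
  kernel is first dominated by two products with powers \<mu> and \<epsilon>. In one of them the
  distance carries the power \<mu>, and \<epsilon> is the power of \<open>N y\<close>.\<close>

lemma stein_weiss_kernel_bound:
  fixes N :: "'a \<Rightarrow> real" and d :: "'a \<Rightarrow> 'a \<Rightarrow> real" and \<alpha> lam p q Q c \<kappa> :: real
  assumes "sigma_finite_measure M"
    and N[measurable]: "N \<in> borel_measurable M"
    and d[measurable]: "(\<lambda>(x, y). d x y) \<in> borel_measurable (M \<Otimes>\<^sub>M M)"
    and space: "space M = UNIV"
    and N0: "\<And>x. 0 \<le> N x" and d0: "\<And>x y. 0 \<le> d x y" and c: "0 \<le> c" and \<kappa>: "0 < \<kappa>"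
    and ball_N: "\<And>r. 0 < r \<Longrightarrow> emeasure M {x. N x < r} \<le> ennreal (c * r powr Q)"
    and ball_left: "\<And>y r. 0 < r \<Longrightarrow> emeasure M {x. d x y < r} \<le> ennreal (c * r powr Q)"
    and ball_right: "\<And>x r. 0 < r \<Longrightarrow> emeasure M {y. d x y < r} \<le> ennreal (c * r powr Q)"
    and triangle: "\<And>x y. N y \<le> \<kappa> * (N x + d x y)"
    and origin: "\<And>x y. N y = 0 \<Longrightarrow> d x y = N x"
    and lam: "0 < lam" "lam < Q" and p: "1 < p" and q: "1 < q"
    and homog: "1 / p + 1 / q + (\<alpha> + lam) / Q = 2"
    and \<alpha>: "0 \<le> \<alpha>" "\<alpha> < Q * (1 - 1 / p)" "\<alpha> + lam \<le> Q"
  shows "\<exists>B\<ge>0. \<forall>f g. f \<in> borel_measurable M \<longrightarrow> g \<in> borel_measurable M \<longrightarrow>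
    (\<forall>x. 0 \<le> f x) \<longrightarrow> (\<forall>x. 0 \<le> g x) \<longrightarrow>
    (\<integral>\<^sup>+x. ennreal (f x powr p) \<partial>M) \<le> 1 \<longrightarrow> (\<integral>\<^sup>+x. ennreal (g x powr q) \<partial>M) \<le> 1 \<longrightarrow>
    (\<integral>\<^sup>+y. \<integral>\<^sup>+x. ennreal (f x) * ennreal (g y) * ennreal (N x powr (- \<alpha>) * d x y powr (- lam)) \<partial>M \<partial>M)
      \<le> ennreal B"
proof -
  interpret sigma_finite_measure M by fact
  interpret P: pair_sigma_finite M M ..
  have Q: "0 < Q" using lam by simp
  have \<alpha>Q: "\<alpha> < Q" using \<alpha>(2) Q p by (smt (verit) divide_pos_pos mult_less_cancel_left2)
  \<comment> \<open>With \<open>\<epsilon> = 0\<close> the second endpoint has exponents \<open>(1 - (\<alpha> + lam)/Q, 1)\<close>, which diverges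
    logarithmically if \<open>\<alpha> + lam = Q\<close>; a small \<open>\<epsilon>\<close> moves it inside without passing \<open>1/p\<close>.\<close>
  define \<epsilon> where "\<epsilon> = min \<alpha> (min lam (Q / p - Q + \<alpha> + lam)) / 2"
  define \<mu> where "\<mu> = \<alpha> + lam - \<epsilon>"
  \<comment> \<open>By the homogeneity relation this quantity equals \<open>Q - Q / q\<close>, so it
    is positive because \<open>q > 1\<close>.\<close>
  have gap: "0 < Q / p - Q + \<alpha> + lam"
  proof -
    have "Q / p + Q / q + (\<alpha> + lam) = 2 * Q"
      using homog Q by (simp add: field_simps)
    moreover have "Q / q < Q" using Q q by (simp add: field_simps)
    ultimately show ?thesis by linarith
  qed
  have \<epsilon>: "0 \<le> \<epsilon>" "\<epsilon> \<le> \<alpha>" "\<epsilon> \<le> lam" "\<epsilon> < Q / p - Q + \<alpha> + lam" "\<alpha> = 0 \<or> 0 < \<epsilon>"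
  proof -
    define b where "b = min lam (Q / p - Q + \<alpha> + lam)"
    have "0 < b" "b \<le> lam" "b \<le> Q / p - Q + \<alpha> + lam" using lam gap by (auto simp: b_def)
    moreover have "\<epsilon> = min \<alpha> b / 2" by (simp add: \<epsilon>_def b_def)
    ultimately show "0 \<le> \<epsilon>" "\<epsilon> \<le> \<alpha>" "\<epsilon> \<le> lam" "\<epsilon> < Q / p - Q + \<alpha> + lam" "\<alpha> = 0 \<or> 0 < \<epsilon>"
      using \<alpha>(1) by (auto simp: min_def split: if_splits)
  qed
  have \<mu>: "0 \<le> \<mu>" "\<mu> < Q" using \<epsilon> \<alpha> lam by (auto simp: \<mu>_def)
  have \<epsilon>Q: "\<epsilon> < Q" using \<epsilon> lam by simp
  have bound: "\<exists>B\<ge>0. \<forall>h E m. h \<in> borel_measurable M \<longrightarrow> (\<forall>x. 0 \<le> h x) \<longrightarrow>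
    (\<forall>r>0. emeasure M {x \<in> space M. h x < r} \<le> ennreal (c * r powr Q)) \<longrightarrow>
    E \<in> sets M \<longrightarrow> 0 < m \<longrightarrow> emeasure M E \<le> ennreal m \<longrightarrow>
    (\<integral>\<^sup>+x. indicator E x * ennreal (h x powr (- s)) \<partial>M) \<le> ennreal (B * m powr (1 - s / Q))"
    if "0 \<le> s" "s < Q" for s
    using nn_integral_powr_neg_le[OF c that] .
  have d_left[measurable]: "(\<lambda>x. d x y) \<in> borel_measurable M" for y
    using measurable_compose[OF measurable_Pair2'[of y M M] d] space by simp
  have d_right[measurable]: "(\<lambda>y. d x y) \<in> borel_measurable M" for x
    using measurable_compose[OF measurable_Pair1'[of x M M] d] space by simp
  \<comment> \<open>The inner integral is bounded independently of \<open>x\<close>, so the outer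
    one is another instance of \<open>bound\<close>. The distance is a parameter \<open>d'\<close>
    because the estimate is also used with the two variables interchanged, when the weight sits on
    \<open>y\<close>.\<close>
  have iterated: "\<exists>B\<ge>0. \<forall>E F m n. E \<in> sets M \<longrightarrow> F \<in> sets M \<longrightarrow> 0 < m \<longrightarrow> 0 < n \<longrightarrow>
      emeasure M E \<le> ennreal m \<longrightarrow> emeasure M F \<le> ennreal n \<longrightarrow>
      (\<integral>\<^sup>+x. indicator E x * ennreal (N x powr (- s)) * (\<integral>\<^sup>+y. indicator F y * ennreal (d' x y powr (- t)) \<partial>M) \<partial>M)
        \<le> ennreal (B * (m powr (1 - s / Q) * n powr (1 - t / Q)))"
    if st: "0 \<le> s" "s < Q" "0 \<le> t" "t < Q"
      and d': "\<And>x. (\<lambda>y. d' x y) \<in> borel_measurable M" "\<And>x y. 0 \<le> d' x y"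
        "\<And>x r. 0 < r \<Longrightarrow> emeasure M {y. d' x y < r} \<le> ennreal (c * r powr Q)"
    for s t and d' :: "'a \<Rightarrow> 'a \<Rightarrow> real"
  proof -
    obtain B1 where B1: "0 \<le> B1" "\<And>h E m. h \<in> borel_measurable M \<Longrightarrow> (\<forall>x. 0 \<le> h x) \<Longrightarrow>
      (\<forall>r>0. emeasure M {x \<in> space M. h x < r} \<le> ennreal (c * r powr Q)) \<Longrightarrow>
      E \<in> sets M \<Longrightarrow> 0 < m \<Longrightarrow> emeasure M E \<le> ennreal m \<Longrightarrow>
      (\<integral>\<^sup>+x. indicator E x * ennreal (h x powr (- s)) \<partial>M) \<le> ennreal (B1 * m powr (1 - s / Q))"
      by atomize_elim (rule bound[OF st(1,2)])
    obtain B2 where B2: "0 \<le> B2" "\<And>h E m. h \<in> borel_measurable M \<Longrightarrow> (\<forall>x. 0 \<le> h x) \<Longrightarrow>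
      (\<forall>r>0. emeasure M {x \<in> space M. h x < r} \<le> ennreal (c * r powr Q)) \<Longrightarrow>
      E \<in> sets M \<Longrightarrow> 0 < m \<Longrightarrow> emeasure M E \<le> ennreal m \<Longrightarrow>
      (\<integral>\<^sup>+x. indicator E x * ennreal (h x powr (- t)) \<partial>M) \<le> ennreal (B2 * m powr (1 - t / Q))"
      by atomize_elim (rule bound[OF st(3,4)])
    show ?thesis
    proof (intro exI[of _ "B1 * B2"] conjI allI impI)
      show "0 \<le> B1 * B2" using B1 B2 by simp
      fix E F and m n :: real
      assume EF[measurable]: "E \<in> sets M" "F \<in> sets M" and mn: "0 < m" "0 < n"
        and EFm: "emeasure M E \<le> ennreal m" "emeasure M F \<le> ennreal n"
      have inner: "(\<integral>\<^sup>+y. indicator F y * ennreal (d' x y powr (- t)) \<partial>M) \<le> ennreal (B2 * n powr (1 - t / Q))" for x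
        using d' EF mn EFm space by (intro B2(2)) auto
      have "(\<integral>\<^sup>+x. indicator E x * ennreal (N x powr (- s)) * (\<integral>\<^sup>+y. indicator F y * ennreal (d' x y powr (- t)) \<partial>M) \<partial>M)
        \<le> (\<integral>\<^sup>+x. indicator E x * ennreal (N x powr (- s)) * ennreal (B2 * n powr (1 - t / Q)) \<partial>M)"
        by (intro nn_integral_mono mult_left_mono inner) simp
      also have "\<dots> = (\<integral>\<^sup>+x. indicator E x * ennreal (N x powr (- s)) \<partial>M) * ennreal (B2 * n powr (1 - t / Q))"
        by (rule nn_integral_multc) measurable
      also have "\<dots> \<le> ennreal (B1 * m powr (1 - s / Q)) * ennreal (B2 * n powr (1 - t / Q))"
        using ball_N EF mn EFm space N0 by (intro mult_right_mono B1(2)) auto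
      also have "\<dots> = ennreal (B1 * B2 * (m powr (1 - s / Q) * n powr (1 - t / Q)))"
        using B1 B2 by (simp add: ennreal_mult[symmetric] mult_ac)
      finally show "(\<integral>\<^sup>+x. indicator E x * ennreal (N x powr (- s)) * (\<integral>\<^sup>+y. indicator F y * ennreal (d' x y powr (- t)) \<partial>M) \<partial>M)
        \<le> ennreal (B1 * B2 * (m powr (1 - s / Q) * n powr (1 - t / Q)))" .
    qed
  qed
  obtain C0 where C0: "0 \<le> C0" "\<And>E F m n. E \<in> sets M \<Longrightarrow> F \<in> sets M \<Longrightarrow> 0 < m \<Longrightarrow> 0 < n \<Longrightarrow>
      emeasure M E \<le> ennreal m \<Longrightarrow> emeasure M F \<le> ennreal n \<Longrightarrow>
      (\<integral>\<^sup>+x. indicator E x * ennreal (N x powr (- \<alpha>)) * (\<integral>\<^sup>+y. indicator F y * ennreal (d x y powr (- lam)) \<partial>M) \<partial>M)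
        \<le> ennreal (C0 * (m powr (1 - \<alpha> / Q) * n powr (1 - lam / Q)))"
    by atomize_elim (rule iterated[OF \<alpha>(1) \<alpha>Q less_imp_le[OF lam(1)] lam(2) d_right d0 ball_right])
  obtain C1 where C1: "0 \<le> C1" "\<And>E F m n. E \<in> sets M \<Longrightarrow> F \<in> sets M \<Longrightarrow> 0 < m \<Longrightarrow> 0 < n \<Longrightarrow>
      emeasure M E \<le> ennreal m \<Longrightarrow> emeasure M F \<le> ennreal n \<Longrightarrow>
      (\<integral>\<^sup>+x. indicator E x * ennreal (N x powr (- \<mu>)) * (\<integral>\<^sup>+y. indicator F y * ennreal (d x y powr (- \<epsilon>)) \<partial>M) \<partial>M)
        \<le> ennreal (C1 * (m powr (1 - \<mu> / Q) * n powr (1 - \<epsilon> / Q)))"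
    by atomize_elim (rule iterated[OF \<mu> \<epsilon>(1) \<epsilon>Q d_right d0 ball_right])
  obtain C2 where C2: "0 \<le> C2" "\<And>E F m n. E \<in> sets M \<Longrightarrow> F \<in> sets M \<Longrightarrow> 0 < m \<Longrightarrow> 0 < n \<Longrightarrow>
      emeasure M E \<le> ennreal m \<Longrightarrow> emeasure M F \<le> ennreal n \<Longrightarrow>
      (\<integral>\<^sup>+y. indicator E y * ennreal (N y powr (- \<epsilon>)) * (\<integral>\<^sup>+x. indicator F x * ennreal (d x y powr (- \<mu>)) \<partial>M) \<partial>M)
        \<le> ennreal (C2 * (m powr (1 - \<epsilon> / Q) * n powr (1 - \<mu> / Q)))"
    by atomize_elim (rule iterated[OF \<epsilon>(1) \<epsilon>Q \<mu> d_left d0 ball_left])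
  define D where "D = (2 * \<kappa>) powr \<epsilon>"
  have D: "0 < D" using \<kappa> by (simp add: D_def)
  \<comment> \<open>If \<open>N x \<le> d x y\<close>, the power \<open>lam - \<epsilon>\<close> of
    the distance is traded for a power of \<open>N x\<close>. Otherwise the triangle inequality
    gives \<open>N y \<le> 2 * \<kappa> * N x\<close>, so the power \<epsilon> of \<open>N x\<close>
    moves to \<open>N y\<close> and the remaining \<open>\<alpha> - \<epsilon>\<close> moves to the
    distance. If \<open>N x\<close> or \<open>d x y\<close> vanishes, the left side is 0 because
    \<open>0 powr a = 0\<close>.\<close>
  have split: "N x powr (- \<alpha>) * d x y powr (- lam)
      \<le> N x powr (- \<mu>) * d x y powr (- \<epsilon>) + D * (N y powr (- \<epsilon>) * d x y powr (- \<mu>))" for x y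
  proof (cases "N x = 0 \<or> d x y = 0")
    case False
    then have pos: "0 < N x" "0 < d x y" using N0[of x] d0[of x y] by auto
    show ?thesis
    proof (cases "N x \<le> d x y")
      case True
      have "d x y powr (- lam) = d x y powr (- (lam - \<epsilon>)) * d x y powr (- \<epsilon>)"
        by (simp add: powr_add[symmetric])
      also have "\<dots> \<le> N x powr (- (lam - \<epsilon>)) * d x y powr (- \<epsilon>)"
        using True pos \<epsilon> by (intro mult_right_mono powr_mono2') auto
      finally have "N x powr (- \<alpha>) * d x y powr (- lam) \<le> N x powr (- \<alpha>) * (N x powr (- (lam - \<epsilon>)) * d x y powr (- \<epsilon>))"
        by (intro mult_left_mono) auto
      also have "\<dots> = N x powr (- \<mu>) * d x y powr (- \<epsilon>)"
        by (simp add: \<mu>_def powr_add[symmetric] mult.assoc[symmetric] algebra_simps)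
      also have "\<dots> \<le> N x powr (- \<mu>) * d x y powr (- \<epsilon>) + D * (N y powr (- \<epsilon>) * d x y powr (- \<mu>))"
        using D by simp
      finally show ?thesis .
    next
      case False
      \<comment> \<open>A vanishing \<open>N y\<close> would make
        \<open>N y powr (- \<epsilon>)\<close> equal to 0 by convention and spoil the bound. It
        would also force \<open>d x y = N x\<close>, contrary to the present case.\<close>
      then have "N y \<noteq> 0" using origin[of y x] by auto
      then have Ny: "0 < N y" using N0[of y] by simp
      have "N y \<le> \<kappa> * (N x + N x)"
        using triangle[of y x] False \<kappa> by (smt (verit) mult_left_mono)
      then have "N y / (2 * \<kappa>) \<le> N x" using \<kappa> by (simp add: field_simps)
      then have "N x powr (- \<epsilon>) \<le> (N y / (2 * \<kappa>)) powr (- \<epsilon>)"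
        using \<epsilon> Ny \<kappa> by (intro powr_mono2') auto
      also have "\<dots> = D * N y powr (- \<epsilon>)"
        using Ny \<kappa> by (simp add: D_def powr_divide powr_minus field_simps)
      finally have 1: "N x powr (- \<epsilon>) \<le> D * N y powr (- \<epsilon>)" .
      have 2: "N x powr (- (\<alpha> - \<epsilon>)) \<le> d x y powr (- (\<alpha> - \<epsilon>))"
        using False pos \<epsilon> by (intro powr_mono2') auto
      have "N x powr (- \<alpha>) = N x powr (- \<epsilon>) * N x powr (- (\<alpha> - \<epsilon>))"
        by (simp add: powr_add[symmetric])
      also have "\<dots> \<le> (D * N y powr (- \<epsilon>)) * d x y powr (- (\<alpha> - \<epsilon>))"
        using D by (intro mult_mono 1 2) auto
      finally have "N x powr (- \<alpha>) * d x y powr (- lam)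
          \<le> ((D * N y powr (- \<epsilon>)) * d x y powr (- (\<alpha> - \<epsilon>))) * d x y powr (- lam)"
        by (intro mult_right_mono) auto
      also have "\<dots> = D * (N y powr (- \<epsilon>) * d x y powr (- \<mu>))"
        by (simp add: \<mu>_def powr_add[symmetric] mult.assoc algebra_simps)
      also have "\<dots> \<le> N x powr (- \<mu>) * d x y powr (- \<epsilon>) + D * (N y powr (- \<epsilon>) * d x y powr (- \<mu>))"
        by simp
      finally show ?thesis .
    qed
  qed (use D in auto)
  define K where "K x y = ennreal (N x powr (- \<alpha>) * d x y powr (- lam))" for x y
  have K[measurable]: "(\<lambda>(x, y). K x y) \<in> borel_measurable (M \<Otimes>\<^sub>M M)"
    unfolding K_def by measurable
  have Q1: "\<alpha> / Q < 1 - 1 / p" using \<alpha>(2) Q by (simp add: field_simps)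
  have Q2: "1 - \<mu> / Q < 1 / p" using \<epsilon>(4) Q by (simp add: \<mu>_def field_simps)
  have fub: "(\<integral>\<^sup>+y. \<integral>\<^sup>+x. indicator E x * indicator F y * ennreal (N x powr (- s) * d x y powr (- t)) \<partial>M \<partial>M)
     = (\<integral>\<^sup>+x. indicator E x * ennreal (N x powr (- s)) * (\<integral>\<^sup>+y. indicator F y * ennreal (d x y powr (- t)) \<partial>M) \<partial>M)"
    if [measurable]: "E \<in> sets M" "F \<in> sets M" for E F s t
  proof -
    have "(\<integral>\<^sup>+y. \<integral>\<^sup>+x. indicator E x * indicator F y * ennreal (N x powr (- s) * d x y powr (- t)) \<partial>M \<partial>M)
      = (\<integral>\<^sup>+x. \<integral>\<^sup>+y. indicator E x * indicator F y * ennreal (N x powr (- s) * d x y powr (- t)) \<partial>M \<partial>M)"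
      by (rule P.Fubini') measurable
    also have "\<dots> = (\<integral>\<^sup>+x. \<integral>\<^sup>+y. (indicator E x * ennreal (N x powr (- s))) * (indicator F y * ennreal (d x y powr (- t))) \<partial>M \<partial>M)"
      by (intro nn_integral_cong) (simp add: ennreal_mult mult_ac)
    also have "\<dots> = (\<integral>\<^sup>+x. indicator E x * ennreal (N x powr (- s)) * (\<integral>\<^sup>+y. indicator F y * ennreal (d x y powr (- t)) \<partial>M) \<partial>M)"
      by (intro nn_integral_cong nn_integral_cmult) measurable
    finally show ?thesis .
  qed
  have "\<exists>B\<ge>0. \<forall>f g :: 'a \<Rightarrow> real. f \<in> borel_measurable M \<longrightarrow> g \<in> borel_measurable M \<longrightarrow>
    (\<forall>x. 0 \<le> f x) \<longrightarrow> (\<forall>x. 0 \<le> g x) \<longrightarrow>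
    (\<integral>\<^sup>+x. ennreal (f x powr p) \<partial>M) \<le> 1 \<longrightarrow> (\<integral>\<^sup>+x. ennreal (g x powr q) \<partial>M) \<le> 1 \<longrightarrow>
    (\<integral>\<^sup>+y. \<integral>\<^sup>+x. ennreal (f x) * ennreal (g y) * K x y \<partial>M \<partial>M) \<le> ennreal B"
  proof (rule restricted_interpolation[where C = "C0 + (C1 + D * C2)" and a\<^sub>0 = "1 - \<alpha> / Q" and b\<^sub>0 = "1 - lam / Q"
        and a\<^sub>1 = "1 - \<mu> / Q" and b\<^sub>1 = "1 - \<epsilon> / Q"])
    show "1 - \<alpha> / Q + (1 - lam / Q) = 1 / p + 1 / q" using homog by (simp add: add_divide_distrib)
    show "1 - \<mu> / Q + (1 - \<epsilon> / Q) = 1 / p + 1 / q"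
      using homog by (simp add: \<mu>_def add_divide_distrib diff_divide_distrib)
    have "(\<alpha> + lam) / Q \<le> 1" using \<alpha>(3) Q by simp
    then show "1 \<le> 1 / p + 1 / q" using homog by linarith
    show "1 - \<mu> / Q < 1 / p" "1 / p < 1 - \<alpha> / Q" using Q1 Q2 by auto
    show "0 < p" "0 < q" using p q by auto
    show "0 \<le> C0 + (C1 + D * C2)" using C0 C1 C2 D by auto
  next
    fix E F and m n :: real
    assume EF[measurable]: "E \<in> sets M" "F \<in> sets M" and mn: "0 < m" "0 < n"
      and EFm: "emeasure M E \<le> ennreal m" "emeasure M F \<le> ennreal n"
    have "(\<integral>\<^sup>+y. \<integral>\<^sup>+x. indicator E x * indicator F y * K x y \<partial>M \<partial>M) \<le> ennreal (C0 * (m powr (1 - \<alpha> / Q) * n powr (1 - lam / Q)))"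
      unfolding K_def fub[OF EF] using EF mn EFm by (rule C0(2))
    also have "\<dots> \<le> ennreal ((C0 + (C1 + D * C2)) * (m powr (1 - \<alpha> / Q) * n powr (1 - lam / Q)))"
      using C1 C2 D by (intro ennreal_leI mult_right_mono) auto
    finally show "(\<integral>\<^sup>+y. \<integral>\<^sup>+x. indicator E x * indicator F y * K x y \<partial>M \<partial>M)
      \<le> ennreal ((C0 + (C1 + D * C2)) * (m powr (1 - \<alpha> / Q) * n powr (1 - lam / Q)))" .
    have "(\<integral>\<^sup>+y. \<integral>\<^sup>+x. indicator E x * indicator F y * K x y \<partial>M \<partial>M)
      \<le> (\<integral>\<^sup>+y. \<integral>\<^sup>+x. indicator E x * indicator F y * ennreal (N x powr (- \<mu>) * d x y powr (- \<epsilon>))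
        + ennreal D * ((indicator F y * ennreal (N y powr (- \<epsilon>))) * (indicator E x * ennreal (d x y powr (- \<mu>)))) \<partial>M \<partial>M)"
    proof (intro nn_integral_mono)
      fix x y
      have "K x y \<le> ennreal (N x powr (- \<mu>) * d x y powr (- \<epsilon>)) + ennreal D * (ennreal (N y powr (- \<epsilon>)) * ennreal (d x y powr (- \<mu>)))"
        unfolding K_def using split[of x y] D
        by (simp add: ennreal_mult[symmetric] ennreal_plus[symmetric] ennreal_leI del: ennreal_plus)
      then show "indicator E x * indicator F y * K x y \<le> indicator E x * indicator F y * ennreal (N x powr (- \<mu>) * d x y powr (- \<epsilon>))
        + ennreal D * ((indicator F y * ennreal (N y powr (- \<epsilon>))) * (indicator E x * ennreal (d x y powr (- \<mu>))))"
        by (auto split: split_indicator)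
    qed
    also have "\<dots> = (\<integral>\<^sup>+y. (\<integral>\<^sup>+x. indicator E x * indicator F y * ennreal (N x powr (- \<mu>) * d x y powr (- \<epsilon>)) \<partial>M)
        + ennreal D * (indicator F y * ennreal (N y powr (- \<epsilon>)) * (\<integral>\<^sup>+x. indicator E x * ennreal (d x y powr (- \<mu>)) \<partial>M)) \<partial>M)"
      by (intro nn_integral_cong) (simp add: nn_integral_add nn_integral_cmult)
    also have "\<dots> = (\<integral>\<^sup>+y. \<integral>\<^sup>+x. indicator E x * indicator F y * ennreal (N x powr (- \<mu>) * d x y powr (- \<epsilon>)) \<partial>M \<partial>M)
        + ennreal D * (\<integral>\<^sup>+y. indicator F y * ennreal (N y powr (- \<epsilon>)) * (\<integral>\<^sup>+x. indicator E x * ennreal (d x y powr (- \<mu>)) \<partial>M) \<partial>M)"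
    proof -
      have [measurable]: "(\<lambda>(y, x). d x y) \<in> borel_measurable (M \<Otimes>\<^sub>M M)"
        using measurable_pair_swap[OF d] by (simp add: case_prod_beta)
      show ?thesis by (subst nn_integral_add, measurable) (subst nn_integral_cmult, auto)
    qed
    also have "\<dots> \<le> ennreal (C1 * (m powr (1 - \<mu> / Q) * n powr (1 - \<epsilon> / Q))) + ennreal D * ennreal (C2 * (n powr (1 - \<epsilon> / Q) * m powr (1 - \<mu> / Q)))"
      unfolding fub[OF EF] using EF mn EFm by (intro add_mono mult_left_mono C1(2) C2(2)) auto
    also have "\<dots> = ennreal ((C1 + D * C2) * (m powr (1 - \<mu> / Q) * n powr (1 - \<epsilon> / Q)))"
      using C1 C2 D by (subst ennreal_mult[symmetric], simp, simp, subst ennreal_plus[symmetric]) (auto simp: algebra_simps)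
    also have "\<dots> \<le> ennreal ((C0 + (C1 + D * C2)) * (m powr (1 - \<mu> / Q) * n powr (1 - \<epsilon> / Q)))"
      using C0 C1 C2 D by (intro ennreal_leI mult_right_mono) auto
    finally show "(\<integral>\<^sup>+y. \<integral>\<^sup>+x. indicator E x * indicator F y * K x y \<partial>M \<partial>M)
      \<le> ennreal ((C0 + (C1 + D * C2)) * (m powr (1 - \<mu> / Q) * n powr (1 - \<epsilon> / Q)))" .
  qed (fact assms(1), fact K)
  then show ?thesis unfolding K_def .
qed

subsection \<open>Calculus of smooth maps\<close>

lemma smooth_differentiable:
  assumes "smooth f"
  shows "f differentiable (at x)"
  using assms[unfolded smooth_def, rule_format, of "Suc 0"] by simp

lemma smooth_has_derivative:
  assumes "smooth f"
  shows "(f has_derivative frechet_derivative f (at x)) (at x)"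
  using smooth_differentiable[OF assms] frechet_derivative_works by blast

lemma smooth_frechet_derivative:
  assumes "smooth f"
  shows "smooth (\<lambda>x. frechet_derivative f (at x) v)"
  unfolding smooth_def
proof
  fix k show "k_times_cont_diff k (\<lambda>x. frechet_derivative f (at x) v)"
    using assms[unfolded smooth_def, rule_format, of "Suc k"] by simp
qed

lemma smooth_continuous_on:
  assumes "smooth f"
  shows "continuous_on S f"
  using assms[unfolded smooth_def, rule_format, of 0] continuous_on_subset by auto

lemma linear_frechet_derivative_smooth:
  "smooth f \<Longrightarrow> linear (frechet_derivative f (at x))"
  using smooth_has_derivative has_derivative_linear by blast

text \<open>The mean value theorem, first in \<open>s\<close> and then in \<open>t\<close>. The
  second difference is symmetric in the two variables, so applying this in both orders compares the
  two mixed derivatives.\<close>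

lemma second_difference_mean_value:
  fixes g gs gst :: "real \<Rightarrow> real \<Rightarrow> real"
  assumes h: "0 < h"
    and 1: "\<And>s t. ((\<lambda>s. g s t) has_real_derivative gs s t) (at s)"
    and 2: "\<And>s t. ((\<lambda>t. gs s t) has_real_derivative gst s t) (at t)"
  obtains s t where "0 < s" "s < h" "0 < t" "t < h" "g h h - g h 0 - g 0 h + g 0 0 = h * h * gst s t"
proof -
  have "((\<lambda>s. g s h - g s 0) has_real_derivative gs s h - gs s 0) (at s)" for s
    by (intro derivative_intros 1)
  from MVT2[OF h, of "\<lambda>s. g s h - g s 0" "\<lambda>s. gs s h - gs s 0", OF this]
  obtain s where s: "0 < s" "s < h" "(g h h - g h 0) - (g 0 h - g 0 0) = (h - 0) * (gs s h - gs s 0)"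
    by blast
  from MVT2[OF h, of "gs s" "gst s", OF 2]
  obtain t where t: "0 < t" "t < h" "gs s h - gs s 0 = (h - 0) * gst s t" by blast
  show thesis using s t by (intro that[of s t]) (auto simp: algebra_simps)
qed

text \<open>Each component of either mixed derivative equals, somewhere in the parallelogram spanned
  by \<open>h a\<close> and \<open>h b\<close> at \<open>z\<close>, the same second difference
  divided by h^2. Letting \<open>h\<close> tend to 0, continuity of the second derivatives gives
  equality at \<open>z\<close>.\<close>

lemma smooth_second_derivative_symmetric:
  fixes f :: "'a::real_normed_vector \<Rightarrow> 'b::euclidean_space"
  assumes f: "smooth f"
  shows "frechet_derivative (\<lambda>x. frechet_derivative f (at x) a) (at z) b =
    frechet_derivative (\<lambda>x. frechet_derivative f (at x) b) (at z) a"
proof (rule euclidean_eqI)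
  fix e :: 'b assume "e \<in> Basis"
  define D where "D v x = frechet_derivative f (at x) v" for v x
  define DD where "DD v w x = frechet_derivative (D v) (at x) w" for v w x
  have smD: "smooth (D v)" for v unfolding D_def by (rule smooth_frechet_derivative[OF f])
  have smDD: "smooth (DD v w)" for v w unfolding DD_def by (rule smooth_frechet_derivative[OF smD])
  define pt where "pt s t = z + s *\<^sub>R a + t *\<^sub>R b" for s t
  have line: "((\<lambda>s. F (p s) \<bullet> e) has_real_derivative frechet_derivative F (at (p s)) v \<bullet> e) (at s)"
    if F: "smooth F" and p: "(p has_vector_derivative v) (at s)" for F :: "'a \<Rightarrow> 'b" and p v s
  proof -
    have "((\<lambda>s. F (p s)) has_vector_derivative frechet_derivative F (at (p s)) v) (at s)"
      using vector_derivative_diff_chain_within[OF p, of F "frechet_derivative F (at (p s))"]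
        smooth_has_derivative[OF F, of "p s"] has_derivative_at_withinI by (auto simp: o_def)
    then have "((\<lambda>s. F (p s) \<bullet> e) has_vector_derivative frechet_derivative F (at (p s)) v \<bullet> e) (at s)"
      by (rule bounded_linear.has_vector_derivative[OF bounded_linear_inner_left])
    then show ?thesis by (simp add: has_real_derivative_iff_has_vector_derivative)
  qed
  have p1: "((\<lambda>s. pt s t) has_vector_derivative a) (at s)" for s t
    unfolding pt_def by (auto intro!: derivative_eq_intros)
  have p2: "((\<lambda>t. pt s t) has_vector_derivative b) (at t)" for s t
    unfolding pt_def by (auto intro!: derivative_eq_intros)
  have ex: "\<exists>s t s' t'. 0 < s \<and> s < h \<and> 0 < t \<and> t < h \<and> 0 < s' \<and> s' < h \<and> 0 < t' \<and> t' < h \<and>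
      DD a b (pt s t) \<bullet> e = DD b a (pt s' t') \<bullet> e" if h: "0 < h" for h
  proof -
    obtain s t where st: "0 < s" "s < h" "0 < t" "t < h"
      "f (pt h h) \<bullet> e - f (pt h 0) \<bullet> e - f (pt 0 h) \<bullet> e + f (pt 0 0) \<bullet> e = h * h * (DD a b (pt s t) \<bullet> e)"
      using second_difference_mean_value[OF h, of "\<lambda>s t. f (pt s t) \<bullet> e" "\<lambda>s t. D a (pt s t) \<bullet> e"
          "\<lambda>s t. DD a b (pt s t) \<bullet> e"] line[OF f p1] line[OF smD p2]
      unfolding D_def[symmetric] DD_def[symmetric] by blast
    obtain t' s' where st': "0 < t'" "t' < h" "0 < s'" "s' < h"
      "f (pt h h) \<bullet> e - f (pt 0 h) \<bullet> e - f (pt h 0) \<bullet> e + f (pt 0 0) \<bullet> e = h * h * (DD b a (pt s' t') \<bullet> e)"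
      using second_difference_mean_value[OF h, of "\<lambda>t s. f (pt s t) \<bullet> e" "\<lambda>t s. D b (pt s t) \<bullet> e"
          "\<lambda>t s. DD b a (pt s t) \<bullet> e"] line[OF f p2] line[OF smD p1]
      unfolding D_def[symmetric] DD_def[symmetric] by blast
    have "h * h * (DD a b (pt s t) \<bullet> e) = h * h * (DD b a (pt s' t') \<bullet> e)"
      using st(5) st'(5) by linarith
    then have "DD a b (pt s t) \<bullet> e = DD b a (pt s' t') \<bullet> e" using h by simp
    then show ?thesis using st st' by blast
  qed
  define h where "h n = 1 / real (Suc n)" for n
  have h0: "0 < h n" for n by (simp add: h_def)
  have hlim: "h \<longlonglongrightarrow> 0" unfolding h_def using LIMSEQ_inverse_real_of_nat by (simp add: inverse_eq_divide)
  obtain s t s' t' where w: "\<And>n. 0 < s n \<and> s n < h n \<and> 0 < t n \<and> t n < h n \<and> 0 < s' n \<and> s' n < h n \<and> 0 < t' n \<and> t' n < h n \<and>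
      DD a b (pt (s n) (t n)) \<bullet> e = DD b a (pt (s' n) (t' n)) \<bullet> e"
    using ex[OF h0] by metis
  have lim0: "r \<longlonglongrightarrow> 0" if "\<And>n. 0 < r n \<and> r n < h n" for r :: "nat \<Rightarrow> real"
    by (rule tendsto_sandwich[OF _ _ tendsto_const hlim]) (use that in \<open>auto intro!: always_eventually less_imp_le\<close>)
  have ptlim: "(\<lambda>n. pt (u n) (v n)) \<longlonglongrightarrow> z" if "\<And>n. 0 < u n \<and> u n < h n" "\<And>n. 0 < v n \<and> v n < h n" for u v
  proof -
    have "(\<lambda>n. z + u n *\<^sub>R a + v n *\<^sub>R b) \<longlonglongrightarrow> z + 0 *\<^sub>R a + 0 *\<^sub>R b"
      by (intro tendsto_intros lim0 that)
    then show ?thesis by (simp add: pt_def)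
  qed
  have cont: "(\<lambda>n. DD v w (q n) \<bullet> e) \<longlonglongrightarrow> DD v w z \<bullet> e" if "q \<longlonglongrightarrow> z" for v w q
    using smooth_continuous_on[OF smDD, of UNIV v w] that
    by (intro tendsto_inner tendsto_const) (auto simp: continuous_on_eq_continuous_at isCont_tendsto_compose)
  have "(\<lambda>n. DD a b (pt (s n) (t n)) \<bullet> e) \<longlonglongrightarrow> DD a b z \<bullet> e" using w by (intro cont ptlim) auto
  moreover have "(\<lambda>n. DD a b (pt (s n) (t n)) \<bullet> e) \<longlonglongrightarrow> DD b a z \<bullet> e"
    using cont[OF ptlim[of s' t'], of b a] w by auto
  ultimately have "DD a b z \<bullet> e = DD b a z \<bullet> e" by (rule LIMSEQ_unique)
  then show "frechet_derivative (\<lambda>x. frechet_derivative f (at x) a) (at z) b \<bullet> e =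
    frechet_derivative (\<lambda>x. frechet_derivative f (at x) b) (at z) a \<bullet> e"
    by (simp add: DD_def D_def[abs_def])
qed

text \<open>A Gronwall argument: with \<open>L\<close> a Lipschitz constant on a ball containing
  both trajectories up to time \<open>T\<close>, the squared distance times exp(-2Lt) is
  nonincreasing and starts at 0.\<close>

lemma autonomous_ode_unique:
  fixes F :: "'a::real_inner \<Rightarrow> 'a"
  assumes lip: "\<And>R. \<exists>L. \<forall>x\<in>cball 0 R. \<forall>y\<in>cball 0 R. norm (F x - F y) \<le> L * norm (x - y)"
    and z1: "\<And>t. (z1 has_vector_derivative F (z1 t)) (at t)"
    and z2: "\<And>t. (z2 has_vector_derivative F (z2 t)) (at t)"
    and init: "z1 0 = z2 0" and T: "0 \<le> T"
  shows "z1 T = z2 T"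
proof -
  have cont: "continuous_on {0..T} z1" "continuous_on {0..T} z2"
    using z1 z2 by (auto intro!: continuous_at_imp_continuous_on has_vector_derivative_continuous)
  obtain R1 where R1: "\<forall>t\<in>{0..T}. norm (z1 t) \<le> R1"
    using compact_imp_bounded[OF compact_continuous_image[OF cont(1)]] unfolding bounded_iff by auto
  obtain R2 where R2: "\<forall>t\<in>{0..T}. norm (z2 t) \<le> R2"
    using compact_imp_bounded[OF compact_continuous_image[OF cont(2)]] unfolding bounded_iff by auto
  obtain L where L: "\<forall>x\<in>cball 0 (max R1 R2). \<forall>y\<in>cball 0 (max R1 R2). norm (F x - F y) \<le> L * norm (x - y)"
    using lip by blast
  define w where "w t = z1 t - z2 t" for t
  define u where "u t = (w t \<bullet> w t) * exp (- 2 * L * t)" for t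
  have w': "(w has_vector_derivative F (z1 t) - F (z2 t)) (at t)" for t
    unfolding w_def by (intro derivative_intros z1 z2)
  have u': "(u has_real_derivative (2 * (w t \<bullet> (F (z1 t) - F (z2 t))) - 2 * L * (w t \<bullet> w t)) * exp (- 2 * L * t)) (at t)" for t
  proof -
    have "((\<lambda>t. w t \<bullet> w t) has_vector_derivative w t \<bullet> (F (z1 t) - F (z2 t)) + (F (z1 t) - F (z2 t)) \<bullet> w t) (at t)"
      by (rule bounded_bilinear.has_vector_derivative[OF bounded_bilinear_inner w' w'])
    then have "((\<lambda>t. w t \<bullet> w t) has_real_derivative 2 * (w t \<bullet> (F (z1 t) - F (z2 t)))) (at t)"
      by (simp add: has_real_derivative_iff_has_vector_derivative inner_commute)
    then show ?thesis unfolding u_def by (auto intro!: derivative_eq_intros simp: algebra_simps)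
  qed
  have "u T \<le> u 0"
  proof (rule DERIV_nonpos_imp_nonincreasing[OF T])
    fix t assume t: "0 \<le> t" "t \<le> T"
    have "w t \<bullet> (F (z1 t) - F (z2 t)) \<le> norm (w t) * norm (F (z1 t) - F (z2 t))"
      by (rule norm_cauchy_schwarz)
    also have "norm (F (z1 t) - F (z2 t)) \<le> L * norm (w t)"
    proof -
      have "z1 t \<in> cball 0 (max R1 R2)" "z2 t \<in> cball 0 (max R1 R2)"
        using R1[rule_format, of t] R2[rule_format, of t] t by auto
      then show ?thesis unfolding w_def using L by blast
    qed
    also have "norm (w t) * (L * norm (w t)) = L * (w t \<bullet> w t)"
      by (simp add: dot_square_norm power2_eq_square)
    finally have "w t \<bullet> (F (z1 t) - F (z2 t)) \<le> L * (w t \<bullet> w t)" by (simp add: mult_left_mono)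
    then have "(2 * (w t \<bullet> (F (z1 t) - F (z2 t))) - 2 * L * (w t \<bullet> w t)) * exp (- 2 * L * t) \<le> 0"
      by (intro mult_nonpos_nonneg) auto
    then show "\<exists>y. (u has_real_derivative y) (at t) \<and> y \<le> 0" using u' by blast
  qed
  also have "u 0 = 0" by (simp add: u_def w_def init)
  finally have "w T \<bullet> w T \<le> 0" by (simp add: u_def mult_le_0_iff)
  then have "w T = 0" using inner_ge_zero[of "w T"] by (simp add: antisym)
  then show ?thesis by (simp add: w_def)
qed

text \<open>Continuity of the derivative is available direction by direction, so its operator norm
  is bounded by the sum of its values on the basis, which is continuous and hence bounded on
  balls.\<close>

lemma locally_lipschitz_if_C1:
  fixes F :: "'a::euclidean_space \<Rightarrow> 'b::real_normed_vector"
  assumes F: "\<And>x. (F has_derivative F' x) (at x)" and cont: "\<And>v. continuous_on UNIV (\<lambda>x. F' x v)"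
  shows "\<exists>L. \<forall>x\<in>cball 0 R. \<forall>y\<in>cball 0 R. norm (F x - F y) \<le> L * norm (x - y)"
proof -
  have "continuous_on (cball 0 R) (\<lambda>x. \<Sum>i\<in>Basis. norm (F' x i))"
    by (intro continuous_intros continuous_on_subset[OF cont]) auto
  then have "compact ((\<lambda>x. \<Sum>i\<in>Basis. norm (F' x i)) ` cball 0 R)"
    by (intro compact_continuous_image) auto
  then obtain L where L: "\<And>x. x \<in> cball 0 R \<Longrightarrow> norm (\<Sum>i\<in>Basis. norm (F' x i)) \<le> L"
    using compact_imp_bounded by (force simp: bounded_iff)
  have "norm (F x - F y) \<le> L * norm (x - y)" if "x \<in> cball 0 R" "y \<in> cball 0 R" for x y
  proof (rule differentiable_bound[of "cball 0 R" F F'])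
    fix x :: 'a assume x: "x \<in> cball 0 R"
    show "(F has_derivative F' x) (at x within cball 0 R)" by (rule has_derivative_at_withinI[OF F])
    have "onorm (F' x) \<le> (\<Sum>i\<in>Basis. norm (F' x i))"
      by (rule onorm_componentwise[OF has_derivative_bounded_linear[OF F]])
    then show "onorm (F' x) \<le> L" using L[OF x] by simp
  qed (use that in auto)
  then show ?thesis by blast
qed

text \<open>Reduces a linear map that varies together with its argument to fixed directions, the
  only ones about which \<open>smooth\<close> speaks.\<close>

lemma linear_sum_components:
  fixes f :: "'a::euclidean_space \<Rightarrow> 'b::real_vector"
  assumes "linear f"
  shows "f h = (\<Sum>i\<in>Basis. (h \<bullet> i) *\<^sub>R f i)"
  by (metis (no_types, lifting) assms euclidean_representation linear_cmul linear_sum sum.cong)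

lemma has_vector_derivative_shift:
  assumes "((\<lambda>s. f (t + s)) has_vector_derivative d) (at 0)"
  shows "(f has_vector_derivative d) (at (t::real))"
proof -
  have "((\<lambda>s. s - t) has_vector_derivative 1) (at t)" by (auto intro!: derivative_eq_intros)
  from vector_diff_chain_at[OF this, of "\<lambda>s. f (t + s)" d] assms show ?thesis by (simp add: o_def)
qed

subsection \<open>Lie algebra morphisms are group morphisms\<close>

context homogeneous_group begin

section \<open>Partial differentials of the multiplication\<close>

definition D1 :: "real ^ 'n \<Rightarrow> real ^ 'n \<Rightarrow> real ^ 'n \<Rightarrow> real ^ 'n" where
  "D1 x y h = frechet_derivative (\<lambda>(x, y). gmult x y) (at (x, y)) (h, 0)"

definition D2 :: "real ^ 'n \<Rightarrow> real ^ 'n \<Rightarrow> real ^ 'n \<Rightarrow> real ^ 'n" where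
  "D2 x y k = frechet_derivative (\<lambda>(x, y). gmult x y) (at (x, y)) (0, k)"

text \<open>The chain rule for conjugation z -> g z g^(-1) at 0. The inverse of \<open>g\<close> is
  \<open>- g\<close> because lines through 0 are one-parameter subgroups.\<close>

definition Ad :: "real ^ 'n \<Rightarrow> real ^ 'n \<Rightarrow> real ^ 'n" where
  "Ad g w = D1 g (- g) (D2 g 0 w)"

text \<open>The left Maurer--Cartan form, i.e. the left-trivialised differential of \<open>exp = id\<close>.\<close>

definition left_trivialization :: "real ^ 'n \<Rightarrow> real ^ 'n \<Rightarrow> real ^ 'n" where
  "left_trivialization x w = D2 (- x) x w"

lemma gmult_scaleR: "gmult (s *\<^sub>R v) (t *\<^sub>R v) = (s + t) *\<^sub>R v"
  by (rule exp_id)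

lemma ginv_eq_minus: "ginv v = - v"
  using inverse_unique[of v "- v"] gmult_scaleR[of 1 v "-1"] by simp

lemma minus_gmult [simp]: "gmult (- v) v = 0"
  using left_inverse[of v] by (simp add: ginv_eq_minus)

lemma gmult_minus [simp]: "gmult v (- v) = 0"
  using right_inverse[of v] by (simp add: ginv_eq_minus)

lemma gmult_0_left [simp]: "gmult 0 x = x" by (rule left_neutral)

lemma gmult_0_right [simp]: "gmult x 0 = x" by (rule right_neutral)

lemma gmult_has_derivative:
  "((\<lambda>(x, y). gmult x y) has_derivative (\<lambda>(h, k). D1 x y h + D2 x y k)) (at (x, y))"
proof -
  let ?D = "frechet_derivative (\<lambda>(x, y). gmult x y) (at (x, y))"
  have "?D = (\<lambda>(h, k). D1 x y h + D2 x y k)"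
  proof (rule ext, clarify)
    fix h k
    have "?D ((h, 0) + (0, k)) = ?D (h, 0) + ?D (0, k)"
      by (rule linear_add[OF linear_frechet_derivative_smooth[OF smooth_mult]])
    then show "?D (h, k) = D1 x y h + D2 x y k" by (simp add: D1_def D2_def)
  qed
  then show ?thesis using smooth_has_derivative[OF smooth_mult, of "(x, y)"] by simp
qed

lemma has_derivative_gmult:
  assumes f: "(f has_derivative f') (at x within S)" and g: "(g has_derivative g') (at x within S)"
  shows "((\<lambda>x. gmult (f x) (g x)) has_derivative (\<lambda>h. D1 (f x) (g x) (f' h) + D2 (f x) (g x) (g' h))) (at x within S)"
  using has_derivative_compose[OF has_derivative_Pair[OF f g] gmult_has_derivative] by simp

lemma D1_has_derivative: "((\<lambda>x. gmult x y) has_derivative D1 x y) (at x)"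
proof -
  have "((\<lambda>x. gmult x y) has_derivative (\<lambda>h. D1 x y h + D2 x y 0)) (at x)"
    by (rule has_derivative_gmult) (auto intro: derivative_intros)
  then show ?thesis
    by (simp add: D2_def linear_0[OF linear_frechet_derivative_smooth[OF smooth_mult]] flip: zero_prod_def)
qed

lemma D2_has_derivative: "((\<lambda>y. gmult x y) has_derivative D2 x y) (at y)"
proof -
  have "((\<lambda>y. gmult x y) has_derivative (\<lambda>k. D1 x y 0 + D2 x y k)) (at y)"
    by (rule has_derivative_gmult) (auto intro: derivative_intros)
  then show ?thesis
    by (simp add: D1_def linear_0[OF linear_frechet_derivative_smooth[OF smooth_mult]] flip: zero_prod_def)
qed

lemma linear_D1: "linear (D1 x y)" using D1_has_derivative has_derivative_linear by blast

lemma linear_D2: "linear (D2 x y)" using D2_has_derivative has_derivative_linear by blast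

lemma D1_eq: "(\<lambda>(x, y). D1 x y h) = (\<lambda>z. frechet_derivative (\<lambda>(x, y). gmult x y) (at z) (h, 0))"
  by (auto simp: D1_def fun_eq_iff)

lemma D2_eq: "(\<lambda>(x, y). D2 x y k) = (\<lambda>z. frechet_derivative (\<lambda>(x, y). gmult x y) (at z) (0, k))"
  by (auto simp: D2_def fun_eq_iff)

lemma smooth_D1: "smooth (\<lambda>(x, y). D1 x y h)"
  unfolding D1_eq by (rule smooth_frechet_derivative[OF smooth_mult])

lemma smooth_D2: "smooth (\<lambda>(x, y). D2 x y h)"
  unfolding D2_eq by (rule smooth_frechet_derivative[OF smooth_mult])

lemma continuous_on_gmult [continuous_intros]:
  assumes "continuous_on S f" "continuous_on S g"
  shows "continuous_on S (\<lambda>x. gmult (f x) (g x))"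
  using continuous_on_compose2[OF smooth_continuous_on[OF smooth_mult, of UNIV] continuous_on_Pair[OF assms]] by simp

lemma continuous_on_D1 [continuous_intros]:
  assumes "continuous_on S f" "continuous_on S g" "continuous_on S h"
  shows "continuous_on S (\<lambda>x. D1 (f x) (g x) (h x))"
proof -
  have "continuous_on S (\<lambda>x. D1 (f x) (g x) i)" for i
    using continuous_on_compose2[OF smooth_continuous_on[OF smooth_D1, of UNIV i] continuous_on_Pair[OF assms(1,2)]] by simp
  then have "continuous_on S (\<lambda>x. \<Sum>i\<in>Basis. (h x \<bullet> i) *\<^sub>R D1 (f x) (g x) i)"
    by (intro continuous_intros assms)
  then show ?thesis by (subst linear_sum_components[OF linear_D1]) simp
qed

lemma continuous_on_D2 [continuous_intros]:
  assumes "continuous_on S f" "continuous_on S g" "continuous_on S h"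
  shows "continuous_on S (\<lambda>x. D2 (f x) (g x) (h x))"
proof -
  have "continuous_on S (\<lambda>x. D2 (f x) (g x) i)" for i
    using continuous_on_compose2[OF smooth_continuous_on[OF smooth_D2, of UNIV i] continuous_on_Pair[OF assms(1,2)]] by simp
  then have "continuous_on S (\<lambda>x. \<Sum>i\<in>Basis. (h x \<bullet> i) *\<^sub>R D2 (f x) (g x) i)"
    by (intro continuous_intros assms)
  then show ?thesis by (subst linear_sum_components[OF linear_D2]) simp
qed

lemma D1_0_right [simp]: "D1 x 0 h = h"
proof -
  have "D1 x 0 = (\<lambda>h. h)"
    by (rule has_derivative_unique[OF D1_has_derivative]) simp
  then show ?thesis by simp
qed

lemma D2_0_left [simp]: "D2 0 y k = k"
proof -
  have "D2 0 y = (\<lambda>h. h)"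
    by (rule has_derivative_unique[OF D2_has_derivative]) simp
  then show ?thesis by simp
qed

lemma left_invariant_field_eq: "left_invariant_field gmult v = (\<lambda>x. D2 x 0 v)"
  unfolding left_invariant_field_def using frechet_derivative_at[OF D2_has_derivative] by metis

lemma D2_curve:
  assumes p: "(p has_vector_derivative a) (at t)" and q: "(q has_vector_derivative b) (at t)"
  shows "((\<lambda>t. D2 (p t) (q t) k) has_vector_derivative
    frechet_derivative (\<lambda>(x, y). D2 x y k) (at (p t, q t)) (a, b)) (at t)"
proof -
  have "((\<lambda>t. (p t, q t)) has_vector_derivative (a, b)) (at t)"
    using p q by (rule has_vector_derivative_Pair)
  from vector_derivative_diff_chain_within[OF this, of "\<lambda>(x, y). D2 x y k"]
  show ?thesis using smooth_has_derivative[OF smooth_D2[of k], of "(p t, q t)"]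
    by (simp add: o_def has_derivative_at_withinI)
qed

lemma D1_curve:
  assumes p: "(p has_vector_derivative a) (at t)" and q: "(q has_vector_derivative b) (at t)"
  shows "((\<lambda>t. D1 (p t) (q t) k) has_vector_derivative
    frechet_derivative (\<lambda>(x, y). D1 x y k) (at (p t, q t)) (a, b)) (at t)"
proof -
  have "((\<lambda>t. (p t, q t)) has_vector_derivative (a, b)) (at t)"
    using p q by (rule has_vector_derivative_Pair)
  from vector_derivative_diff_chain_within[OF this, of "\<lambda>(x, y). D1 x y k"]
  show ?thesis using smooth_has_derivative[OF smooth_D1[of k], of "(p t, q t)"]
    by (simp add: o_def has_derivative_at_withinI)
qed

lemma left_invariant_field_has_derivative:
  "((\<lambda>x. D2 x 0 v) has_derivative (\<lambda>h. frechet_derivative (\<lambda>(x, y). D2 x y v) (at (x, 0)) (h, 0))) (at x)"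
  using has_derivative_compose[OF has_derivative_Pair[OF has_derivative_ident has_derivative_const]
      smooth_has_derivative[OF smooth_D2[of v], of "(x, 0)"]] by simp

section \<open>The adjoint representation\<close>

lemma Ad_has_derivative: "((\<lambda>z. gmult (gmult g z) (- g)) has_derivative Ad g) (at 0)"
proof -
  have "((\<lambda>z. gmult (gmult g z) (- g)) has_derivative (\<lambda>h. D1 (gmult g 0) (- g) (D2 g 0 h))) (at 0)"
    by (rule has_derivative_compose[OF D2_has_derivative D1_has_derivative])
  then show ?thesis by (simp add: Ad_def[abs_def])
qed

lemma linear_Ad: "linear (Ad g)" using Ad_has_derivative has_derivative_linear by blast

lemma Ad_0 [simp]: "Ad 0 w = w" by (simp add: Ad_def)

lemma minus_gmult_distrib: "- gmult g h = gmult (- h) (- g)"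
  using inverse_unique[of "gmult g h" "gmult (- h) (- g)"]
  by (metis assoc ginv_eq_minus gmult_0_left gmult_minus)

lemma Ad_gmult: "Ad (gmult g h) w = Ad g (Ad h w)"
proof -
  have "((\<lambda>z. gmult (gmult g (gmult (gmult h z) (- h))) (- g)) has_derivative (\<lambda>w. Ad g (Ad h w))) (at 0)"
    by (rule has_derivative_compose[OF Ad_has_derivative]) (simp add: Ad_has_derivative)
  moreover have "gmult (gmult g (gmult (gmult h z) (- h))) (- g) = gmult (gmult (gmult g h) z) (- gmult g h)" for z
    unfolding minus_gmult_distrib by (simp add: assoc)
  ultimately have "((\<lambda>z. gmult (gmult (gmult g h) z) (- gmult g h)) has_derivative (\<lambda>w. Ad g (Ad h w))) (at 0)"
    by simp
  from has_derivative_unique[OF Ad_has_derivative this] show ?thesis by metis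
qed

lemma continuous_on_Ad [continuous_intros]:
  assumes "continuous_on S f" "continuous_on S h"
  shows "continuous_on S (\<lambda>x. Ad (f x) (h x))"
  unfolding Ad_def by (intro continuous_intros assms)

text \<open>Differentiating \<open>Ad\<close> along a line moves the second argument of
  \<open>D1\<close>, whereas \<open>lie_bracket\<close> differentiates \<open>D2\<close> in its
  first argument. Symmetry of second derivatives identifies the two.\<close>

lemma mixed_derivative:
  "frechet_derivative (\<lambda>(x, y). D1 x y h) (at z) (0, v) = frechet_derivative (\<lambda>(x, y). D2 x y v) (at z) (h, 0)"
  unfolding D1_eq D2_eq by (rule smooth_second_derivative_symmetric[OF smooth_mult])

text \<open>The derivative of Ad is ad, by the product rule. The factor \<open>D2 (t v) 0 w\<close>
  yields the first term of the bracket. In \<open>D1 (t v) (- t v)\<close> the motion of the first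
  slot contributes nothing, since \<open>D1 x 0\<close> is the identity for every \<open>x\<close>,
  and the motion of the second slot yields the other term through
  \<open>mixed_derivative\<close>.\<close>

lemma Ad_curve_at_0: "((\<lambda>t. Ad (t *\<^sub>R v) w) has_vector_derivative lie_bracket gmult v w) (at 0)"
proof -
  define X' where "X' u h = frechet_derivative (\<lambda>(x, y). D2 x y u) (at (0, 0)) (h, 0)" for u h
  have X': "((\<lambda>x. D2 x 0 u) has_derivative X' u) (at 0)" for u
    unfolding X'_def[abs_def] by (rule left_invariant_field_has_derivative)
  have linX': "linear (X' u)" for u using X' has_derivative_linear by blast
  have br: "lie_bracket gmult v w = X' w v - X' v w"
    unfolding lie_bracket_def left_invariant_field_eq using frechet_derivative_at[OF X'] by metis
  have line: "((\<lambda>t. t *\<^sub>R v) has_vector_derivative v) (at 0)"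
    and mline: "((\<lambda>t. - (t *\<^sub>R v)) has_vector_derivative - v) (at 0)"
    by (auto intro!: derivative_eq_intros)
  have XA: "((\<lambda>t. D2 (t *\<^sub>R v) 0 w) has_vector_derivative X' w v) (at 0)"
    using D2_curve[OF line has_vector_derivative_const[of 0], of w] by (simp add: X'_def)
  have D1': "((\<lambda>t. D1 (t *\<^sub>R v) (- (t *\<^sub>R v)) h) has_vector_derivative - X' v h) (at 0)" for h
  proof -
    let ?D = "frechet_derivative (\<lambda>(x, y). D1 x y h) (at (0, 0))"
    have lin: "linear ?D" by (rule linear_frechet_derivative_smooth[OF smooth_D1])
    have "((\<lambda>t. D1 (t *\<^sub>R v) 0 h) has_vector_derivative ?D (v, 0)) (at 0)"
      using D1_curve[OF line has_vector_derivative_const[of 0], of h] by simp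
    then have "((\<lambda>t. h) has_vector_derivative ?D (v, 0)) (at (0::real))" by simp
    then have z: "?D (v, 0) = 0"
      using vector_derivative_unique_at has_vector_derivative_const by blast
    have "?D (v, - v) = ?D ((v, 0) - (0, v))" by simp
    also have "\<dots> = ?D (v, 0) - ?D (0, v)" by (rule linear_diff[OF lin])
    also have "\<dots> = - X' v h" by (simp only: z mixed_derivative X'_def) simp
    finally show ?thesis using D1_curve[OF line mline, of h] by simp
  qed
  have "((\<lambda>t. \<Sum>i\<in>Basis. (D2 (t *\<^sub>R v) 0 w \<bullet> i) *\<^sub>R D1 (t *\<^sub>R v) (- (t *\<^sub>R v)) i) has_vector_derivative
      (\<Sum>i\<in>Basis. (D2 (0 *\<^sub>R v) 0 w \<bullet> i) *\<^sub>R (- X' v i) + (X' w v \<bullet> i) *\<^sub>R D1 (0 *\<^sub>R v) (- (0 *\<^sub>R v)) i)) (at 0)"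
  proof (intro has_vector_derivative_sum bounded_bilinear.has_vector_derivative[OF bounded_bilinear_scaleR])
    fix i show "((\<lambda>t. D2 (t *\<^sub>R v) 0 w \<bullet> i) has_vector_derivative X' w v \<bullet> i) (at 0)"
      by (rule bounded_linear.has_vector_derivative[OF bounded_linear_inner_left XA])
  qed (rule D1')
  also have "(\<Sum>i\<in>Basis. (D2 (0 *\<^sub>R v) 0 w \<bullet> i) *\<^sub>R (- X' v i) + (X' w v \<bullet> i) *\<^sub>R D1 (0 *\<^sub>R v) (- (0 *\<^sub>R v)) i)
      = X' w v - (\<Sum>i\<in>Basis. (w \<bullet> i) *\<^sub>R X' v i)"
    by (simp add: sum_subtractf euclidean_representation)
  also have "(\<Sum>i\<in>Basis. (w \<bullet> i) *\<^sub>R X' v i) = X' v w" by (rule linear_sum_components[OF linX', symmetric])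
  finally show ?thesis unfolding br Ad_def by (subst linear_sum_components[OF linear_D1])
qed

lemma linear_lie_bracket: "linear (lie_bracket gmult v)"
proof (rule linearI)
  fix a b and r :: real
  have "((\<lambda>t. Ad (t *\<^sub>R v) a + Ad (t *\<^sub>R v) b) has_vector_derivative lie_bracket gmult v a + lie_bracket gmult v b) (at 0)"
    by (intro derivative_intros Ad_curve_at_0)
  then have "((\<lambda>t. Ad (t *\<^sub>R v) (a + b)) has_vector_derivative lie_bracket gmult v a + lie_bracket gmult v b) (at 0)"
    by (simp add: linear_add[OF linear_Ad])
  then show "lie_bracket gmult v (a + b) = lie_bracket gmult v a + lie_bracket gmult v b"
    using vector_derivative_unique_at Ad_curve_at_0 by blast
  have "((\<lambda>t. r *\<^sub>R Ad (t *\<^sub>R v) a) has_vector_derivative r *\<^sub>R lie_bracket gmult v a) (at 0)"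
    by (rule bounded_linear.has_vector_derivative[OF bounded_linear_scaleR_right Ad_curve_at_0])
  then have "((\<lambda>t. Ad (t *\<^sub>R v) (r *\<^sub>R a)) has_vector_derivative r *\<^sub>R lie_bracket gmult v a) (at 0)"
    by (simp add: linear_cmul[OF linear_Ad])
  then show "lie_bracket gmult v (r *\<^sub>R a) = r *\<^sub>R lie_bracket gmult v a"
    using vector_derivative_unique_at Ad_curve_at_0 by blast
qed

lemma Ad_curve: "((\<lambda>t. Ad (t *\<^sub>R v) w) has_vector_derivative lie_bracket gmult v (Ad (t *\<^sub>R v) w)) (at t)"
proof (rule has_vector_derivative_shift)
  have "Ad ((t + s) *\<^sub>R v) w = Ad (s *\<^sub>R v) (Ad (t *\<^sub>R v) w)" for s
    by (simp add: Ad_gmult[symmetric] gmult_scaleR add.commute)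
  then show "((\<lambda>s. Ad ((t + s) *\<^sub>R v) w) has_vector_derivative lie_bracket gmult v (Ad (t *\<^sub>R v) w)) (at 0)"
    using Ad_curve_at_0 by simp
qed

text \<open>With \<open>x\<close> replaced by \<open>t x\<close>, both sides solve the linear
  equation z' = [D x, z] with initial value \<open>D w\<close>.\<close>

lemma morphism_Ad:
  assumes D: "lie_algebra_morphism gmult D"
  shows "D (Ad x w) = Ad (D x) (D w)"
proof -
  have lin: "linear D" and br: "\<And>v w. D (lie_bracket gmult v w) = lie_bracket gmult (D v) (D w)"
    using D by (auto simp: lie_algebra_morphism_def)
  have "D (Ad (1 *\<^sub>R x) w) = Ad (1 *\<^sub>R D x) (D w)"
  proof (rule autonomous_ode_unique[where F = "lie_bracket gmult (D x)" and T = 1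
        and ?z1.0 = "\<lambda>t. D (Ad (t *\<^sub>R x) w)" and ?z2.0 = "\<lambda>t. Ad (t *\<^sub>R D x) (D w)"])
    fix R
    have "(lie_bracket gmult (D x) has_derivative lie_bracket gmult (D x)) (at y)" for y
      by (rule linear_imp_has_derivative[OF linear_lie_bracket])
    then show "\<exists>L. \<forall>y\<in>cball 0 R. \<forall>z\<in>cball 0 R.
        norm (lie_bracket gmult (D x) y - lie_bracket gmult (D x) z) \<le> L * norm (y - z)"
      by (rule locally_lipschitz_if_C1) simp
  next
    fix t :: real
    show "((\<lambda>t. D (Ad (t *\<^sub>R x) w)) has_vector_derivative lie_bracket gmult (D x) (D (Ad (t *\<^sub>R x) w))) (at t)"
      unfolding br[symmetric]
      using bounded_linear.has_vector_derivative[OF linear_conv_bounded_linear[THEN iffD1, OF lin] Ad_curve] .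
  qed (auto simp: Ad_curve)
  then show ?thesis by simp
qed

section \<open>The left-trivialised differential of the exponential map\<close>

lemma left_trivialization_has_derivative:
  "((\<lambda>z. gmult (- x) z) has_derivative left_trivialization x) (at x)"
  using D2_has_derivative[of "- x" x] by (simp add: left_trivialization_def[abs_def])

lemma linear_left_trivialization: "linear (left_trivialization x)"
  using left_trivialization_has_derivative has_derivative_linear by blast

text \<open>Differentiates \<open>(n u)\<^sup>-\<^sup>1 z\<^sup>n\<close> at \<open>z = u\<close>, where \<open>z\<^sup>n = n z\<close> in exponential coordinates. As
  \<open>n \<rightarrow> \<infinity>\<close> with \<open>n u\<close> fixed this is a Riemann sum for the classical formula for \<open>d exp\<close>.\<close>

lemma left_trivialization_average:
  "real n *\<^sub>R left_trivialization (real n *\<^sub>R u) w = (\<Sum>k<n. Ad (- (real k *\<^sub>R u)) (left_trivialization u w))"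
proof -
  define P where "P k z = gmult (- (real k *\<^sub>R u)) (real k *\<^sub>R z)" for k z
  have "(P k has_derivative (\<lambda>w. \<Sum>j<k. Ad (- (real j *\<^sub>R u)) (left_trivialization u w))) (at u)" for k
  proof (induction k)
    case 0
    have "P 0 = (\<lambda>z. 0)" by (rule ext) (simp add: P_def)
    then show ?case by simp
  next
    case (Suc k)
    \<comment> \<open>In group notation u^(-k-1) z^(k+1) is the product of u^(-1) (u^(-k) z^k) u and
      u^(-1) z. Differentiating therefore applies \<open>Ad (- u)\<close> to the previous sum and
      adds one new term.\<close>
    have P_Suc: "P (Suc k) z = gmult (gmult (gmult (- u) (P k z)) (- (- u))) (gmult (- u) z)" for z
    proof -
      have "- (real (Suc k) *\<^sub>R u) = gmult (- u) (- (real k *\<^sub>R u))"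
        using gmult_scaleR[of "-1" u "- real k"] by (simp add: algebra_simps)
      moreover have "real (Suc k) *\<^sub>R z = gmult (real k *\<^sub>R z) z"
        using gmult_scaleR[of "real k" z 1] by (simp add: algebra_simps)
      moreover have "gmult u (gmult (- u) z) = z"
        by (metis assoc gmult_0_left gmult_minus)
      ultimately show ?thesis by (simp add: P_def assoc)
    qed
    have Pu: "P k u = 0" by (simp add: P_def)
    have "((\<lambda>z. gmult (gmult (- u) (P k z)) (- (- u))) has_derivative
        (\<lambda>w. Ad (- u) (\<Sum>j<k. Ad (- (real j *\<^sub>R u)) (left_trivialization u w)))) (at u)"
      by (rule has_derivative_compose[OF Suc.IH]) (simp only: Pu, rule Ad_has_derivative)
    from has_derivative_gmult[OF this left_trivialization_has_derivative]
    have "(P (Suc k) has_derivative (\<lambda>w. Ad (- u) (\<Sum>j<k. Ad (- (real j *\<^sub>R u)) (left_trivialization u w)) + left_trivialization u w)) (at u)"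
      by (simp add: P_Suc[abs_def] Pu)
    moreover have "Ad (- u) (\<Sum>j<k. Ad (- (real j *\<^sub>R u)) (left_trivialization u w)) + left_trivialization u w
      = (\<Sum>j<Suc k. Ad (- (real j *\<^sub>R u)) (left_trivialization u w))" for w
    proof -
      have "Ad (- u) (Ad (- (real j *\<^sub>R u)) v) = Ad (- (real (Suc j) *\<^sub>R u)) v" for j v
      proof -
        have "- (real (Suc j) *\<^sub>R u) = gmult (- u) (- (real j *\<^sub>R u))"
          using gmult_scaleR[of "-1" u "- real j"] by (simp add: algebra_simps)
        then show ?thesis by (simp only: Ad_gmult)
      qed
      then show ?thesis
        by (simp add: sum.lessThan_Suc_shift linear_sum[OF linear_Ad] add.commute del: sum.lessThan_Suc of_nat_Suc)
    qed
    ultimately show ?case by simp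
  qed
  \<comment> \<open>The same derivative computed directly: scaling by \<open>n\<close> followed by
    one left translation.\<close>
  moreover have "(P n has_derivative (\<lambda>w. left_trivialization (real n *\<^sub>R u) (real n *\<^sub>R w))) (at u)"
    unfolding P_def[abs_def]
    by (rule has_derivative_compose[OF _ left_trivialization_has_derivative])
      (auto intro!: derivative_eq_intros)
  ultimately have "(\<lambda>w. \<Sum>j<n. Ad (- (real j *\<^sub>R u)) (left_trivialization u w)) = (\<lambda>w. left_trivialization (real n *\<^sub>R u) (real n *\<^sub>R w))"
    by (rule has_derivative_unique)
  then show ?thesis by (metis linear_cmul[OF linear_left_trivialization])
qed

text \<open>Apply \<open>left_trivialization_average\<close> with \<open>u = x / n\<close> before
  and after \<open>D\<close>, and let \<open>D\<close> pass through \<open>Ad\<close>. The defect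
  \<open>d\<close> at \<open>x\<close> becomes the average over \<open>k < n\<close> of
  \<open>Ad (- (k / n) D x)\<close> applied to the defect \<open>e n\<close> at
  \<open>x / n\<close>. The latter tends to 0, because the trivialisation at 0 is the identity, and
  \<open>Ad\<close> is bounded along the segment; hence \<open>d = 0\<close>. The finite averages do
  the work of the integral formula.\<close>

lemma morphism_left_trivialization:
  assumes D: "lie_algebra_morphism gmult D"
  shows "D (left_trivialization x w) = left_trivialization (D x) (D w)"
proof -
  have lin: "linear D" using D by (auto simp: lie_algebra_morphism_def)
  define e where "e n = D (left_trivialization (x /\<^sub>R real n) w) - left_trivialization (D x /\<^sub>R real n) (D w)" for n
  have e_lim: "e \<longlonglongrightarrow> 0"
  proof -
    have inv: "(\<lambda>n. inverse (real n)) \<longlonglongrightarrow> 0" by (rule lim_inverse_n)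
    have "(\<lambda>n. left_trivialization (y /\<^sub>R real n) k) \<longlonglongrightarrow> k" for y k
    proof -
      have "continuous_on UNIV (\<lambda>s. left_trivialization (s *\<^sub>R y) k)"
        unfolding left_trivialization_def by (intro continuous_intros)
      then have "(\<lambda>n. left_trivialization (inverse (real n) *\<^sub>R y) k) \<longlonglongrightarrow> left_trivialization (0 *\<^sub>R y) k"
        using inv by (rule continuous_on_tendsto_compose) auto
      then show ?thesis by (simp add: left_trivialization_def)
    qed
    then have "e \<longlonglongrightarrow> D w - D w"
      unfolding e_def[abs_def] by (intro tendsto_diff bounded_linear.tendsto[OF linear_conv_bounded_linear[THEN iffD1, OF lin]])
    then show ?thesis by simp
  qed
  have "compact ((\<lambda>s. \<Sum>i\<in>Basis. norm (Ad (- (s *\<^sub>R D x)) i)) ` {0..1})"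
    by (intro compact_continuous_image continuous_intros) auto
  from compact_imp_bounded[OF this]
  obtain B where "\<forall>s\<in>{0..1}. norm (\<Sum>i\<in>Basis. norm (Ad (- (s *\<^sub>R D x)) i)) \<le> B"
    unfolding bounded_iff by auto
  then have B: "(\<Sum>i\<in>Basis. norm (Ad (- (s *\<^sub>R D x)) i)) \<le> B" if "s \<in> {0..1}" for s
    using that by (auto dest: abs_le_D1)
  have Ad_bound: "norm (Ad (- (s *\<^sub>R D x)) h) \<le> B * norm h" if "s \<in> {0..1}" for s h
  proof -
    have bl: "bounded_linear (Ad (- (s *\<^sub>R D x)))" using linear_Ad linear_conv_bounded_linear by blast
    have "norm (Ad (- (s *\<^sub>R D x)) h) \<le> onorm (Ad (- (s *\<^sub>R D x))) * norm h" by (rule onorm[OF bl])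
    also have "\<dots> \<le> B * norm h"
      using onorm_componentwise[OF bl] B[OF that] by (intro mult_right_mono) auto
    finally show ?thesis .
  qed
  define d where "d = D (left_trivialization x w) - left_trivialization (D x) (D w)"
  have d_le: "norm d \<le> B * norm (e n)" if n: "0 < n" for n
  proof -
    let ?u = "x /\<^sub>R real n" and ?v = "D x /\<^sub>R real n"
    have Du: "D ?u = ?v" by (rule linear_cmul[OF lin])
    have "real n *\<^sub>R d = D (real n *\<^sub>R left_trivialization (real n *\<^sub>R ?u) w) - real n *\<^sub>R left_trivialization (real n *\<^sub>R ?v) (D w)"
      using n by (simp add: d_def scaleR_diff_right linear_cmul[OF lin])
    also have "\<dots> = (\<Sum>k<n. Ad (- (real k *\<^sub>R ?v)) (e n))"
      unfolding left_trivialization_average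
      by (simp add: linear_sum[OF lin] morphism_Ad[OF D] linear_neg[OF lin] linear_cmul[OF lin]
          e_def linear_diff[OF linear_Ad] sum_subtractf)
    finally have eq: "real n *\<^sub>R d = (\<Sum>k<n. Ad (- (real k *\<^sub>R ?v)) (e n))" .
    have "norm (real n *\<^sub>R d) \<le> (\<Sum>k<n. norm (Ad (- (real k *\<^sub>R ?v)) (e n)))"
      unfolding eq by (rule norm_sum)
    also have "\<dots> \<le> (\<Sum>k<n. B * norm (e n))"
    proof (rule sum_mono)
      fix k assume "k \<in> {..<n}"
      then show "norm (Ad (- (real k *\<^sub>R ?v)) (e n)) \<le> B * norm (e n)"
        using Ad_bound[of "real k * inverse (real n)" "e n"] n by (simp add: field_simps)
    qed
    finally show ?thesis using n by simp
  qed
  have "(\<lambda>n. B * norm (e n)) \<longlonglongrightarrow> B * norm (0 :: real ^ 'n)" by (intro tendsto_intros e_lim)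
  then have "norm d \<le> B * norm (0 :: real ^ 'n)"
    by (rule LIMSEQ_le_const) (use d_le in \<open>auto intro!: exI[of _ 1]\<close>)
  then show ?thesis by (simp add: d_def)
qed

text \<open>\<open>left_trivialization x\<close> and \<open>D2 x 0\<close> are mutually inverse,
  being the differentials of left translation by x^(-1) and by x. Compatibility of \<open>D\<close>
  with the one gives compatibility with the other.\<close>

lemma morphism_left_invariant_field:
  assumes D: "lie_algebra_morphism gmult D"
  shows "D (D2 x 0 v) = D2 (D x) 0 (D v)"
proof -
  have 1: "left_trivialization x (D2 x 0 v) = v" for x v
  proof -
    have "((\<lambda>z. gmult (- x) (gmult x z)) has_derivative (\<lambda>v. left_trivialization x (D2 x 0 v))) (at 0)"
      by (rule has_derivative_compose[OF D2_has_derivative]) (simp add: left_trivialization_has_derivative)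
    moreover have "gmult (- x) (gmult x z) = z" for z by (simp add: assoc[symmetric])
    ultimately have "((\<lambda>z. z) has_derivative (\<lambda>v. left_trivialization x (D2 x 0 v))) (at 0)" by simp
    from has_derivative_unique[OF this has_derivative_ident] show ?thesis by metis
  qed
  have 2: "D2 x 0 (left_trivialization x w) = w" for x w
  proof -
    have "((\<lambda>z. gmult x (gmult (- x) z)) has_derivative (\<lambda>w. D2 x 0 (left_trivialization x w))) (at x)"
      by (rule has_derivative_compose[OF left_trivialization_has_derivative]) (simp add: D2_has_derivative)
    moreover have "gmult x (gmult (- x) z) = z" for z by (simp add: assoc[symmetric])
    ultimately have "((\<lambda>z. z) has_derivative (\<lambda>w. D2 x 0 (left_trivialization x w))) (at x)" by simp
    from has_derivative_unique[OF this has_derivative_ident] show ?thesis by metis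
  qed
  have "D v = left_trivialization (D x) (D (D2 x 0 v))"
    using morphism_left_trivialization[OF D, of x "D2 x 0 v"] by (simp add: 1)
  then show ?thesis by (simp add: 2)
qed

section \<open>Integral curves of left-invariant fields\<close>

lemma gmult_curve: "((\<lambda>t. gmult x (t *\<^sub>R v)) has_vector_derivative D2 (gmult x (t *\<^sub>R v)) 0 v) (at t)"
proof (rule has_vector_derivative_shift)
  have "gmult x ((t + s) *\<^sub>R v) = gmult (gmult x (t *\<^sub>R v)) (s *\<^sub>R v)" for s
    by (simp add: assoc gmult_scaleR)
  moreover have "((\<lambda>s. gmult (gmult x (t *\<^sub>R v)) (s *\<^sub>R v)) has_vector_derivative D2 (gmult x (t *\<^sub>R v)) 0 v) (at 0)"
  proof -
    have "((\<lambda>s. s *\<^sub>R v) has_vector_derivative v) (at 0)" by (auto intro!: derivative_eq_intros)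
    from vector_derivative_diff_chain_within[OF this, of "gmult (gmult x (t *\<^sub>R v))"]
    show ?thesis using D2_has_derivative[of "gmult x (t *\<^sub>R v)" 0] by (simp add: o_def has_derivative_at_withinI)
  qed
  ultimately show "((\<lambda>s. gmult x ((t + s) *\<^sub>R v)) has_vector_derivative D2 (gmult x (t *\<^sub>R v)) 0 v) (at 0)"
    by simp
qed

theorem lie_algebra_morphism_imp_group_morphism:
  assumes D: "lie_algebra_morphism gmult D"
  shows "D (gmult x y) = gmult (D x) (D y)"
proof -
  have lin: "linear D" using D by (auto simp: lie_algebra_morphism_def)
  have "D (gmult x (1 *\<^sub>R y)) = gmult (D x) (1 *\<^sub>R D y)"
  proof (rule autonomous_ode_unique[where F = "\<lambda>z. D2 z 0 (D y)" and T = 1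
        and ?z1.0 = "\<lambda>t. D (gmult x (t *\<^sub>R y))" and ?z2.0 = "\<lambda>t. gmult (D x) (t *\<^sub>R D y)"])
    fix R
    \<comment> \<open>Left-invariant fields are in general not globally Lipschitz; this is why
      uniqueness works with a constant for each ball.\<close>
    show "\<exists>L. \<forall>a\<in>cball 0 R. \<forall>b\<in>cball 0 R. norm (D2 a 0 (D y) - D2 b 0 (D y)) \<le> L * norm (a - b)"
    proof (rule locally_lipschitz_if_C1[OF left_invariant_field_has_derivative])
      fix h
      show "continuous_on UNIV (\<lambda>a. frechet_derivative (\<lambda>(a, b). D2 a b (D y)) (at (a, 0)) (h, 0))"
        using continuous_on_compose2[OF smooth_continuous_on[OF smooth_frechet_derivative[OF smooth_D2], of UNIV]
            continuous_on_Pair[OF continuous_on_id continuous_on_const]] by simp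
    qed
  next
    fix t :: real
    show "((\<lambda>t. D (gmult x (t *\<^sub>R y))) has_vector_derivative D2 (D (gmult x (t *\<^sub>R y))) 0 (D y)) (at t)"
      unfolding morphism_left_invariant_field[OF D, symmetric]
      using bounded_linear.has_vector_derivative[OF linear_conv_bounded_linear[THEN iffD1, OF lin] gmult_curve] .
  qed (auto simp: gmult_curve)
  then show ?thesis by simp
qed

end

subsection \<open>Change of variables\<close>

text \<open>The change of variables theorems of HOL-Analysis require a well-ordered index type. Hence
  Jacobians on \<open>real ^ 'n\<close> are computed after relabelling the coordinates by \<open>'n idx\<close>.\<close>

typedef ('a::finite) idx = "{..<CARD('a)}"
  by (rule exI[of _ 0]) simp

instantiation idx :: (finite) wellorder
begin

definition less_eq_idx :: "'a idx \<Rightarrow> 'a idx \<Rightarrow> bool" where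
  "less_eq_idx i j \<longleftrightarrow> Rep_idx i \<le> Rep_idx j"

definition less_idx :: "'a idx \<Rightarrow> 'a idx \<Rightarrow> bool" where
  "less_idx i j \<longleftrightarrow> Rep_idx i < Rep_idx j"

instance
proof
  fix P :: "'a idx \<Rightarrow> bool" and a :: "'a idx"
  assume step: "\<And>x. (\<And>y. y < x \<Longrightarrow> P y) \<Longrightarrow> P x"
  show "P a"
    by (induction a rule: measure_induct_rule[of Rep_idx]) (rule step, simp add: less_idx_def)
qed (auto simp: less_eq_idx_def less_idx_def Rep_idx_inject)

end

instance idx :: (finite) finite
proof
  have "(UNIV :: 'a idx set) = Abs_idx ` {..<CARD('a)}"
    by (metis type_definition.Abs_image type_definition_idx)
  then show "finite (UNIV :: 'a idx set)" by (metis finite_imageI finite_lessThan)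
qed

lemma card_idx: "CARD('a::finite idx) = CARD('a)"
  using type_definition.card[OF type_definition_idx] by (metis card_lessThan)

definition idx_of :: "'n::finite \<Rightarrow> 'n idx" where
  "idx_of = (SOME f. bij f)"

lemma bij_idx_of: "bij (idx_of :: 'n::finite \<Rightarrow> 'n idx)"
proof -
  have "\<exists>f :: 'n \<Rightarrow> 'n idx. bij f"
    using finite_same_card_bij[of "UNIV :: 'n set" "UNIV :: 'n idx set"] by (simp add: card_idx)
  then show ?thesis unfolding idx_of_def by (rule someI_ex)
qed

definition relabel :: "real ^ 'n \<Rightarrow> real ^ ('n::finite idx)" where
  "relabel x = (\<chi> j. x $ inv idx_of j)"

definition unlabel :: "real ^ ('n::finite idx) \<Rightarrow> real ^ 'n" where
  "unlabel y = (\<chi> i. y $ idx_of i)"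

lemma unlabel_relabel [simp]: "unlabel (relabel x) = x"
  by (simp add: relabel_def unlabel_def vec_eq_iff bij_is_inj[OF bij_idx_of])

lemma relabel_unlabel [simp]: "relabel (unlabel x) = x"
  by (simp add: relabel_def unlabel_def vec_eq_iff surj_f_inv_f[OF bij_is_surj[OF bij_idx_of]])

lemma linear_relabel: "linear relabel"
  by (rule linearI) (simp_all add: relabel_def vec_eq_iff)

lemma linear_unlabel: "linear unlabel"
  by (rule linearI) (simp_all add: unlabel_def vec_eq_iff)

lemma relabel_measurable [measurable]: "relabel \<in> borel_measurable borel"
  by (intro borel_measurable_continuous_onI linear_continuous_on linear_conv_bounded_linear[THEN iffD1] linear_relabel)

lemma unlabel_measurable [measurable]: "unlabel \<in> borel_measurable borel"
  by (intro borel_measurable_continuous_onI linear_continuous_on linear_conv_bounded_linear[THEN iffD1] linear_unlabel)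

lemma prod_Basis_cart: "(\<Prod>b\<in>Basis. (u :: real ^ 'n) \<bullet> b) = (\<Prod>i\<in>UNIV. u $ i)"
proof -
  have "(\<Prod>b\<in>Basis. u \<bullet> b) = (\<Prod>b\<in>(\<lambda>i. axis i (1::real)) ` UNIV. u \<bullet> b)"
    by (rule prod.cong) (auto simp: Basis_vec_def)
  also have "\<dots> = (\<Prod>i\<in>UNIV. u $ i)"
    by (subst prod.reindex) (simp_all add: inj_on_def axis_eq_axis inner_axis)
  finally show ?thesis .
qed

text \<open>Lebesgue measure is determined by the volumes of boxes, and a permutation of the
  coordinates maps boxes to boxes with the same side lengths.\<close>

lemma distr_relabel: "distr lborel borel relabel = (lborel :: (real ^ ('n::finite idx)) measure)"
proof (rule lborel_eqI[symmetric])
  fix l u :: "real ^ 'n idx"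
  assume le: "\<And>b. b \<in> Basis \<Longrightarrow> l \<bullet> b \<le> u \<bullet> b"
  have lu: "l $ i \<le> u $ i" for i using le[of "axis i 1"] by (simp add: inner_axis axis_in_Basis_iff)
  have "relabel -` box l u = box (unlabel l) (unlabel u)"
  proof -
    have "relabel x \<in> box l u \<longleftrightarrow> x \<in> box (unlabel l) (unlabel u)" for x
      unfolding mem_box_cart relabel_def unlabel_def vec_lambda_beta
      by (metis bij_idx_of bij_inv_eq_iff)
    then show ?thesis by auto
  qed
  then have "emeasure (distr lborel borel relabel) (box l u) = emeasure lborel (box (unlabel l) (unlabel u))"
    by (subst emeasure_distr) auto
  also have "\<dots> = ennreal (\<Prod>b\<in>Basis. (unlabel u - unlabel l) \<bullet> b)"
    by (rule emeasure_lborel_box) (use lu in \<open>auto simp: Basis_vec_def inner_axis unlabel_def\<close>)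
  also have "(\<Prod>b\<in>Basis. (unlabel u - unlabel l) \<bullet> b) = (\<Prod>i\<in>UNIV. (u - l) $ idx_of i)"
    unfolding prod_Basis_cart by (simp add: unlabel_def)
  also have "\<dots> = (\<Prod>i\<in>UNIV. (u - l) $ i)"
    using prod.reindex_bij_betw[OF bij_idx_of, of "\<lambda>i. (u - l) $ i"] by simp
  also have "\<dots> = (\<Prod>b\<in>Basis. (u - l) \<bullet> b)" unfolding prod_Basis_cart ..
  finally show "emeasure (distr lborel borel relabel) (box l u) = ennreal (\<Prod>b\<in>Basis. (u - l) \<bullet> b)" .
qed simp

lemma emeasure_relabel_image:
  assumes "S \<in> sets borel"
  shows "emeasure lborel (relabel ` S) = emeasure lborel S"
proof -
  have eq: "relabel ` S = unlabel -` S"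
    by (auto simp: image_iff) (metis relabel_unlabel)
  have "relabel ` S \<in> sets borel"
    unfolding eq using measurable_sets[OF unlabel_measurable assms] by simp
  then have "emeasure (distr lborel borel relabel) (relabel ` S) = emeasure lborel (relabel -` relabel ` S)"
    by (subst emeasure_distr) auto
  moreover have "relabel -` relabel ` S = S"
    by (auto simp: image_iff) (metis unlabel_relabel)
  ultimately show ?thesis by (simp add: distr_relabel)
qed

text \<open>The determinant of \<open>f\<close> read in the relabelled coordinates, the form in
  which the change of variables theorem produces Jacobians.\<close>

definition ldet :: "(real ^ 'n \<Rightarrow> real ^ 'n) \<Rightarrow> real" where
  "ldet f = det (matrix (\<lambda>x. relabel (f (unlabel x))))"

lemma ldet_compose:
  assumes "linear f" "linear g"
  shows "ldet (\<lambda>x. f (g x)) = ldet f * ldet g"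
proof -
  have lin: "linear (\<lambda>x. relabel (h (unlabel x)))" if "linear h" for h :: "real ^ 'n \<Rightarrow> real ^ 'n"
    using linear_compose[OF linear_compose[OF linear_unlabel that] linear_relabel] by (simp add: o_def)
  have "(\<lambda>x. relabel (f (g (unlabel x)))) = (\<lambda>x. relabel (f (unlabel x))) \<circ> (\<lambda>x. relabel (g (unlabel x)))"
    by (simp add: o_def)
  then show ?thesis unfolding ldet_def
    by (simp add: matrix_compose[OF lin[OF assms(2)] lin[OF assms(1)]] det_mul)
qed

lemma ldet_ident [simp]: "ldet (\<lambda>x. x) = 1"
  by (simp add: ldet_def matrix_id_mat_1[unfolded id_def])

lemma ldet_diagonal: "ldet (\<lambda>x. \<chi> i. d i * x $ i) = (\<Prod>i\<in>UNIV. d i)"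
proof -
  let ?M = "matrix (\<lambda>x. relabel ((\<chi> i. d i * unlabel x $ i) :: real ^ 'a))"
  have M: "?M $ i $ j = (if i = j then d (inv idx_of i) else 0)" for i j
    by (simp add: matrix_def relabel_def unlabel_def axis_def surj_f_inv_f[OF bij_is_surj[OF bij_idx_of]])
  have "det ?M = (\<Prod>i\<in>UNIV. ?M $ i $ i)"
    by (rule det_diagonal) (simp only: M if_False)
  also have "\<dots> = (\<Prod>i\<in>UNIV. d (inv idx_of i))" by (simp add: M)
  also have "\<dots> = (\<Prod>i\<in>UNIV. d i)"
    by (rule prod.reindex_bij_betw[OF bij_imp_bij_inv[OF bij_idx_of]])
  finally show ?thesis by (simp add: ldet_def)
qed

lemma continuous_on_ldet:
  assumes "\<And>v. continuous_on S (\<lambda>x. F x v)"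
  shows "continuous_on S (\<lambda>x. ldet (F x))"
proof -
  have "continuous_on S (\<lambda>x. relabel (F x v))" for v
    unfolding relabel_def by (intro continuous_intros assms)
  then show ?thesis
    unfolding ldet_def det_def matrix_def by (auto intro!: continuous_intros)
qed

text \<open>For a Jacobian of constant modulus the change of variables integral is \<open>c\<close>
  times the measure of the set. The map is conjugated by \<open>relabel\<close>, and measures of
  Borel sets are carried back by \<open>emeasure_relabel_image\<close>.\<close>

lemma emeasure_image_constant_ldet:
  fixes f :: "real ^ 'n \<Rightarrow> real ^ 'n"
  assumes S: "S \<in> sets borel" "bounded S" and fS: "f ` S \<in> sets borel"
    and f: "\<And>x. x \<in> S \<Longrightarrow> (f has_derivative f' x) (at x)"
    and inj: "inj_on f S" and det: "\<And>x. x \<in> S \<Longrightarrow> \<bar>ldet (f' x)\<bar> = c"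
  shows "emeasure lborel (f ` S) = ennreal (c * measure lborel S)"
proof -
  define g where "g x = relabel (f (unlabel x))" for x
  define g' where "g' x v = relabel (f' (unlabel x) (unlabel v))" for x v
  define S' where "S' = relabel ` S"
  have bl: "bounded_linear (relabel :: real ^ 'n \<Rightarrow> _)" "bounded_linear (unlabel :: _ \<Rightarrow> real ^ 'n)"
    using linear_relabel linear_unlabel linear_conv_bounded_linear by auto
  have S'_eq: "S' = unlabel -` S" unfolding S'_def
    by (auto simp: image_iff) (metis relabel_unlabel)
  have S'b: "S' \<in> sets borel"
    unfolding S'_eq using measurable_sets[OF unlabel_measurable S(1)] by simp
  have S'lm: "S' \<in> lmeasurable"
    unfolding S'_def by (intro bounded_set_imp_lmeasurable bounded_linear_image S bl)
      (use S'b in \<open>auto simp: S'_def\<close>)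
  have img: "g ` S' = relabel ` f ` S" by (auto simp: g_def S'_def image_image)
  have der: "(g has_derivative g' x) (at x within S')" if "x \<in> S'" for x
  proof -
    have "unlabel x \<in> S" using that by (auto simp: S'_def)
    from f[OF this] have "((\<lambda>x. relabel (f (unlabel x))) has_derivative (\<lambda>v. relabel (f' (unlabel x) (unlabel v)))) (at x)"
      by (intro bounded_linear.has_derivative[OF bl(1)] has_derivative_compose[OF bounded_linear_imp_has_derivative[OF bl(2)]])
    then show ?thesis unfolding g_def[abs_def] g'_def[abs_def] by (rule has_derivative_at_withinI)
  qed
  have injg: "inj_on g S'"
    unfolding S'_def g_def inj_on_def
    by (auto dest!: arg_cong[of "relabel _" _ unlabel] inj_onD[OF inj])
  have det': "\<bar>det (matrix (g' x))\<bar> = c" if "x \<in> S'" for x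
    using det[of "unlabel x"] that by (auto simp: ldet_def g'_def[abs_def] S'_def)
  have "((\<lambda>x. c) has_integral c * measure lebesgue S') S'"
    using has_integral_mult_right[OF integrable_integral[OF lmeasurable_iff_integrable_on[THEN iffD1, OF S'lm]], of c]
    by (simp add: lmeasure_integral[OF S'lm])
  then have int: "((\<lambda>x. \<bar>det (matrix (g' x))\<bar>) has_integral c * measure lebesgue S') S'"
    by (rule has_integral_eq[rotated]) (simp add: det')
  have S'_leb: "S' \<in> sets lebesgue" using S'lm by auto
  have gS: "g ` S' \<in> lmeasurable" "measure lebesgue (g ` S') = c * measure lebesgue S'"
    using has_measure_differentiable_image[OF S'_leb der injg, of "c * measure lebesgue S'"] int by auto
  have "emeasure lborel (f ` S) = emeasure lborel (g ` S')"
    unfolding img by (rule emeasure_relabel_image[OF fS, symmetric])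
  also have "\<dots> = emeasure lebesgue (g ` S')"
  proof -
    have "relabel ` f ` S = unlabel -` f ` S" by (auto simp: image_iff) (metis relabel_unlabel)
    then have "g ` S' \<in> sets borel" unfolding img using measurable_sets[OF unlabel_measurable fS] by simp
    then show ?thesis by simp
  qed
  also have "\<dots> = ennreal (c * measure lebesgue S')"
    using gS by (simp add: emeasure_eq_measure2)
  also have "measure lebesgue S' = measure lborel S"
    using emeasure_relabel_image[OF S(1)] S'b by (simp add: measure_def S'_def)
  finally show ?thesis .
qed

subsection \<open>Dilations and quasi-norms\<close>

text \<open>In coordinates with respect to an eigenbasis of \<open>A\<close> the exponential series
  is diagonal, with entries exp(c_i ln r) = r^(c_i). Cyclic invariance of the trace identifies the
  homogeneous dimension with the sum of the eigenvalues.\<close>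

lemma dilation_representation:
  fixes A :: "real ^ 'n \<Rightarrow> real ^ 'n"
  assumes lin: "linear A" and "diagonalisable A" and pos: "\<And>v c. v \<noteq> 0 \<Longrightarrow> A v = c *\<^sub>R v \<Longrightarrow> 0 < c"
  obtains T T' :: "real ^ 'n \<Rightarrow> real ^ 'n" and c :: "'n \<Rightarrow> real" where
    "linear T" "linear T'" "\<And>x. T (T' x) = x" "\<And>x. T' (T x) = x" "\<And>i. 0 < c i"
    "\<And>r x. 0 < r \<Longrightarrow> dilation A r x = T (\<chi> i. r powr c i * T' x $ i)"
    "homogeneous_dimension A = (\<Sum>i\<in>UNIV. c i)"
proof -
  obtain B where B: "independent B" "span B = UNIV" "\<And>b. b \<in> B \<Longrightarrow> \<exists>c. A b = c *\<^sub>R b"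
    using assms(2) unfolding diagonalisable_def by blast
  have finB: "finite B" using B(1) by (rule independent_imp_finite)
  have "card B = CARD('n)"
    using dim_eq_card_independent[OF B(1)] dim_span[of B] B(2) by (simp add: dim_UNIV)
  then obtain b :: "'n \<Rightarrow> real ^ 'n" where b: "bij_betw b UNIV B"
    using finite_same_card_bij[of "UNIV :: 'n set" B] finB by auto
  have "\<exists>c. A (b i) = c *\<^sub>R b i" for i using B(3) b by (auto simp: bij_betw_def)
  then obtain c where c: "\<And>i. A (b i) = c i *\<^sub>R b i" by metis
  have b_nz: "b i \<noteq> 0" for i
    using B(1) b dependent_zero[of B] by (metis bij_betw_apply UNIV_I)
  define T where "T x = (\<Sum>i\<in>UNIV. x $ i *\<^sub>R b i)" for x
  have linT: "linear T"
    unfolding T_def by (rule linearI) (simp_all add: scaleR_add_left sum.distrib scaleR_sum_right)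
  have "inj T"
  proof (rule linear_injective_0[OF linT, THEN iffD2], intro allI impI)
    fix x assume "T x = 0"
    have "(\<Sum>v\<in>B. x $ (inv_into UNIV b v) *\<^sub>R v) = (\<Sum>i\<in>UNIV. x $ (inv_into UNIV b (b i)) *\<^sub>R b i)"
      by (rule sum.reindex_bij_betw[OF b, symmetric])
    also have "\<dots> = T x" using b by (simp add: T_def bij_betw_def)
    finally have "(\<Sum>v\<in>B. x $ (inv_into UNIV b v) *\<^sub>R v) = 0" using \<open>T x = 0\<close> by simp
    then have z: "\<forall>v\<in>B. x $ (inv_into UNIV b v) = 0"
      using independentD[OF B(1) finB order_refl, where u = "\<lambda>v. x $ inv_into UNIV b v"] by blast
    have "x $ i = 0" for i
      using z[rule_format, of "b i"] b by (auto simp: bij_betw_def)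
    then show "x = 0" by (simp add: vec_eq_iff)
  qed
  then obtain T' where T': "linear T'" "\<And>x. T' (T x) = x" "\<And>x. T (T' x) = x"
    using linear_injective_isomorphism[OF linT] by auto
  have AT: "A (T x) = T (\<chi> i. c i * x $ i)" for x
    unfolding T_def linear_sum[OF lin] linear_cmul[OF lin] c by (simp add: mult.commute)
  have dil: "dilation A r x = T (\<chi> i. r powr c i * T' x $ i)" if r: "0 < r" for r x
  proof -
    have pow: "((\<lambda>x. ln r *\<^sub>R A x) ^^ k) (T y) = (\<Sum>i\<in>UNIV. (ln r * c i) ^ k *\<^sub>R y $ i *\<^sub>R b i)" for k y
    proof (induction k arbitrary: y)
      case 0 then show ?case by (simp add: T_def)
    next
      case (Suc k)
      have "ln r *\<^sub>R A (T y) = T (\<chi> i. ln r * c i * y $ i)"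
        unfolding AT linear_cmul[OF linT, symmetric] by (rule arg_cong[of _ _ T]) (simp add: vec_eq_iff)
      then show ?case by (simp add: funpow_Suc_right Suc.IH mult_ac del: funpow.simps)
    qed
    have "(\<lambda>k. (ln r * c i) ^ k /\<^sub>R fact k) sums exp (ln r * c i)" for i by (rule exp_converges)
    then have "(\<lambda>k. \<Sum>i\<in>UNIV. ((ln r * c i) ^ k /\<^sub>R fact k) *\<^sub>R T' x $ i *\<^sub>R b i) sums (\<Sum>i\<in>UNIV. exp (ln r * c i) *\<^sub>R T' x $ i *\<^sub>R b i)"
      by (intro sums_sum sums_scaleR_left)
    moreover have "((\<lambda>x. ln r *\<^sub>R A x) ^^ k) x /\<^sub>R fact k = (\<Sum>i\<in>UNIV. ((ln r * c i) ^ k /\<^sub>R fact k) *\<^sub>R T' x $ i *\<^sub>R b i)" for k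
      using pow[of k "T' x"] by (simp add: T' scaleR_sum_right mult_ac)
    ultimately have "operator_exp (\<lambda>x. ln r *\<^sub>R A x) x = (\<Sum>i\<in>UNIV. exp (ln r * c i) *\<^sub>R T' x $ i *\<^sub>R b i)"
      unfolding operator_exp_def by (simp add: sums_iff)
    also have "\<dots> = T (\<chi> i. r powr c i * T' x $ i)"
      using r by (simp add: T_def powr_def mult.commute)
    finally show ?thesis by (simp add: dilation_def)
  qed
  have trace: "homogeneous_dimension A = (\<Sum>i\<in>UNIV. c i)"
  proof -
    define \<Delta> where "\<Delta> = (\<lambda>x :: real ^ 'n. \<chi> i. c i * x $ i)"
    have lin\<Delta>: "linear \<Delta>" by (rule linearI) (simp_all add: \<Delta>_def vec_eq_iff algebra_simps)
    have "A = (T \<circ> \<Delta>) \<circ> T'" using AT[of "T' _"] by (auto simp: fun_eq_iff T' \<Delta>_def)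
    then have "matrix A = (matrix T ** matrix \<Delta>) ** matrix T'"
      by (simp add: matrix_compose linT T' lin\<Delta> linear_compose)
    then have "trace (matrix A) = trace (matrix T' ** (matrix T ** matrix \<Delta>))" by (simp only: trace_mul_sym[of _ "matrix T'"])
    also have "matrix T' ** (matrix T ** matrix \<Delta>) = matrix (T' \<circ> (T \<circ> \<Delta>))"
      by (simp add: matrix_compose linT T' lin\<Delta> linear_compose)
    also have "T' \<circ> (T \<circ> \<Delta>) = \<Delta>" by (auto simp: T')
    also have "trace (matrix \<Delta>) = (\<Sum>i\<in>UNIV. c i)" by (simp add: trace_def matrix_def \<Delta>_def axis_def)
    finally show ?thesis by (simp add: homogeneous_dimension_def)
  qed
  show thesis by (rule that[OF linT T'(1,3,2) pos[OF b_nz c] dil trace])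
qed

context homogeneous_group begin

abbreviation dil :: "real \<Rightarrow> real ^ 'n \<Rightarrow> real ^ 'n" where "dil \<equiv> dilation A"

abbreviation Q where "Q \<equiv> homogeneous_dimension A"

lemma linear_dilation: "0 < r \<Longrightarrow> linear (dil r)"
  using dilation_morphism by (simp add: lie_algebra_morphism_def)

lemma dilation_gmult: "0 < r \<Longrightarrow> dil r (gmult x y) = gmult (dil r x) (dil r y)"
  by (rule lie_algebra_morphism_imp_group_morphism[OF dilation_morphism])

lemma dilation_diagonal:
  obtains T T' :: "real ^ 'n \<Rightarrow> real ^ 'n" and c :: "'n \<Rightarrow> real" where
    "linear T" "linear T'" "\<And>x. T (T' x) = x" "\<And>x. T' (T x) = x" "\<And>i. 0 < c i"
    "\<And>r x. 0 < r \<Longrightarrow> dil r x = T (\<chi> i. r powr c i * T' x $ i)" "Q = (\<Sum>i\<in>UNIV. c i)"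
proof (rule dilation_representation[OF linear_A diagonalisable_A])
  fix v c assume "v \<noteq> 0" "A v = c *\<^sub>R v" then show "0 < c" by (rule eigenvalues_pos)
qed (rule that)

lemma dilation_dilation: "0 < r \<Longrightarrow> 0 < s \<Longrightarrow> dil r (dil s x) = dil (r * s) x"
  by (rule dilation_diagonal) (simp_all add: powr_mult mult_ac)

lemma dilation_1 [simp]: "dil 1 x = x"
  by (rule dilation_diagonal) simp_all

lemma dilation_inverse [simp]:
  "0 < r \<Longrightarrow> dil r (dil (inverse r) x) = x" "0 < r \<Longrightarrow> dil (inverse r) (dil r x) = x"
  by (simp_all add: dilation_dilation)

lemma dilation_tendsto:
  assumes r: "(r \<longlongrightarrow> r0) F" "0 < r0"
  shows "((\<lambda>t. dil (r t) x) \<longlongrightarrow> dil r0 x) F"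
proof -
  obtain T T' :: "real ^ 'n \<Rightarrow> real ^ 'n" and c :: "'n \<Rightarrow> real" where T: "linear T" "linear T'" "\<And>x. T (T' x) = x" "\<And>x. T' (T x) = x" "\<And>i. 0 < c i"
    "\<And>r x. 0 < r \<Longrightarrow> dil r x = T (\<chi> i. r powr c i * T' x $ i)" "Q = (\<Sum>i\<in>UNIV. c i)"
    by (rule dilation_diagonal) (rule that)
  have "((\<lambda>t. T (\<chi> i. r t powr c i * T' x $ i)) \<longlongrightarrow> T (\<chi> i. r0 powr c i * T' x $ i)) F"
    using r by (intro bounded_linear.tendsto[OF linear_conv_bounded_linear[THEN iffD1, OF T(1)]] tendsto_intros) auto
  moreover have "\<forall>\<^sub>F t in F. T (\<chi> i. r t powr c i * T' x $ i) = dil (r t) x"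
    using order_tendstoD(1)[OF r] by eventually_elim (simp add: T(6))
  ultimately show ?thesis using r(2) by (simp add: T(6) tendsto_cong)
qed

text \<open>This is where the eigenvalues of \<open>A\<close> have to be positive: each coordinate
  in the eigenbasis is multiplied by a positive power of a null sequence.\<close>

lemma dilation_tendsto_0: "(\<lambda>n. dil (inverse (real (Suc n))) x) \<longlonglongrightarrow> 0"
proof -
  obtain T T' :: "real ^ 'n \<Rightarrow> real ^ 'n" and c :: "'n \<Rightarrow> real" where T: "linear T" "linear T'" "\<And>x. T (T' x) = x" "\<And>x. T' (T x) = x" "\<And>i. 0 < c i"
    "\<And>r x. 0 < r \<Longrightarrow> dil r x = T (\<chi> i. r powr c i * T' x $ i)" "Q = (\<Sum>i\<in>UNIV. c i)"
    by (rule dilation_diagonal) (rule that)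
  have "(\<lambda>n. inverse (real (Suc n)) powr c i) \<longlonglongrightarrow> 0" for i
    using tendsto_powr'[OF LIMSEQ_inverse_real_of_nat tendsto_const, of "c i"] T(5)[of i] by simp
  then have "(\<lambda>n. T (\<chi> i. inverse (real (Suc n)) powr c i * T' x $ i)) \<longlonglongrightarrow> T (\<chi> i. 0 * T' x $ i)"
    by (intro bounded_linear.tendsto[OF linear_conv_bounded_linear[THEN iffD1, OF T(1)]] tendsto_intros)
  moreover have "(\<chi> i. 0 * T' x $ i) = 0" by (simp add: vec_eq_iff)
  ultimately show ?thesis using linear_0[OF T(1)] by (simp add: T(6))
qed

lemma ldet_dilation: "0 < r \<Longrightarrow> ldet (dil r) = r powr Q"
proof -
  assume r: "0 < r"
  obtain T T' :: "real ^ 'n \<Rightarrow> real ^ 'n" and c :: "'n \<Rightarrow> real" where T: "linear T" "linear T'" "\<And>x. T (T' x) = x" "\<And>x. T' (T x) = x" "\<And>i. 0 < c i"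
    "\<And>r x. 0 < r \<Longrightarrow> dil r x = T (\<chi> i. r powr c i * T' x $ i)" "Q = (\<Sum>i\<in>UNIV. c i)"
    by (rule dilation_diagonal) (rule that)
  let ?D = "\<lambda>x :: real ^ 'n. \<chi> i. r powr c i * x $ i"
  have linD: "linear ?D" by (rule linearI) (simp_all add: vec_eq_iff algebra_simps)
  have "ldet (dil r) = ldet (\<lambda>x. T (?D (T' x)))"
    by (rule arg_cong[of _ _ ldet]) (simp add: T(6) r fun_eq_iff)
  also have "\<dots> = ldet T * (ldet ?D * ldet T')"
    using ldet_compose[OF T(1) linear_compose[OF T(2) linD]] ldet_compose[OF linD T(2)] by (simp add: o_def)
  also have "ldet T * (ldet ?D * ldet T') = ldet ?D * (ldet T * ldet T')" by simp
  also have "ldet T * ldet T' = 1" using ldet_compose[OF T(1,2)] by (simp add: T(3))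
  also have "ldet ?D = (\<Prod>i\<in>UNIV. r powr c i)" by (rule ldet_diagonal)
  also have "\<dots> = r powr Q" using r by (simp add: T(7) powr_sum)
  finally show ?thesis by simp
qed

lemma ldet_D2: "ldet (D2 y z) = 1"
proof -
  have inv: "ldet (D2 y z) = ldet (D2 (dil r y) (dil r z))" if r: "0 < r" for r
  proof -
    note linr = linear_dilation[OF r]
    have dr: "(dil r has_derivative dil r) (at x)" for x
      by (rule linear_imp_has_derivative[OF linr])
    have "((\<lambda>z. dil r (gmult y z)) has_derivative (\<lambda>v. dil r (D2 y z v))) (at z)"
      by (rule has_derivative_compose[OF D2_has_derivative dr])
    moreover have "((\<lambda>z. gmult (dil r y) (dil r z)) has_derivative (\<lambda>v. D2 (dil r y) (dil r z) (dil r v))) (at z)"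
      by (rule has_derivative_compose[OF dr D2_has_derivative])
    ultimately have "(\<lambda>v. dil r (D2 y z v)) = (\<lambda>v. D2 (dil r y) (dil r z) (dil r v))"
      using has_derivative_unique by (simp add: dilation_gmult[OF r])
    \<comment> \<open>Both sides contain the nonzero factor \<open>r powr Q\<close>, which
      cancels.\<close>
    then have "ldet (dil r) * ldet (D2 y z) = ldet (D2 (dil r y) (dil r z)) * ldet (dil r)"
      by (simp add: ldet_compose[OF linr linear_D2, symmetric] ldet_compose[OF linear_D2 linr, symmetric])
    then show ?thesis using r by (simp add: ldet_dilation)
  qed
  define r where "r n = inverse (real (Suc n))" for n
  define \<Phi> where "\<Phi> = (\<lambda>p. ldet (D2 (fst p) (snd p)))"
  have "continuous_on UNIV \<Phi>"
    unfolding \<Phi>_def by (intro continuous_on_ldet continuous_intros)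
  moreover have "(\<lambda>n. (dil (r n) y, dil (r n) z)) \<longlonglongrightarrow> (0, 0)"
    unfolding r_def by (intro tendsto_Pair dilation_tendsto_0)
  ultimately have "(\<lambda>n. \<Phi> (dil (r n) y, dil (r n) z)) \<longlonglongrightarrow> \<Phi> (0, 0)"
    by (rule continuous_on_tendsto_compose) auto
  then have "(\<lambda>n. ldet (D2 (dil (r n) y) (dil (r n) z))) \<longlonglongrightarrow> ldet (D2 0 0)" by (simp add: \<Phi>_def)
  moreover have "ldet (D2 (dil (r n) y) (dil (r n) z)) = ldet (D2 y z)" for n
    by (rule inv[symmetric]) (simp add: r_def)
  ultimately have "(\<lambda>n. ldet (D2 y z)) \<longlonglongrightarrow> ldet (\<lambda>v. v)" by (simp add: D2_0_left[abs_def])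
  then show ?thesis by (simp add: LIMSEQ_const_iff)
qed

lemma emeasure_translated_dilated:
  assumes S: "open S" "bounded S" and r: "0 < r"
  shows "emeasure lborel ((\<lambda>z. gmult y (dil r z)) ` S) = ennreal (r powr Q * measure lborel S)"
proof (rule emeasure_image_constant_ldet[where f' = "\<lambda>z v. D2 y (dil r z) (dil r v)"])
  show "S \<in> sets borel" "bounded S" using S by auto
  \<comment> \<open>As a preimage under the continuous inverse map the image of \<open>S\<close> is
    open, hence Borel.\<close>
  have eq: "(\<lambda>z. gmult y (dil r z)) ` S = (\<lambda>w. dil (inverse r) (gmult (- y) w)) -` S"
  proof (intro set_eqI iffI)
    fix w assume "w \<in> (\<lambda>z. gmult y (dil r z)) ` S"
    then obtain z where z: "z \<in> S" "w = gmult y (dil r z)" by blast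
    have "gmult (- y) w = dil r z" unfolding z(2) by (simp add: assoc[symmetric])
    then show "w \<in> (\<lambda>w. dil (inverse r) (gmult (- y) w)) -` S" using z r by simp
  next
    fix w assume "w \<in> (\<lambda>w. dil (inverse r) (gmult (- y) w)) -` S"
    moreover have "w = gmult y (dil r (dil (inverse r) (gmult (- y) w)))"
      using r by (simp add: assoc[symmetric])
    ultimately show "w \<in> (\<lambda>z. gmult y (dil r z)) ` S" by blast
  qed
  have "continuous_on UNIV (\<lambda>w. dil (inverse r) (gmult (- y) w))"
    by (rule continuous_on_compose2[OF linear_continuous_on[OF linear_conv_bounded_linear[THEN iffD1, OF linear_dilation]]])
      (use r in \<open>auto intro!: continuous_intros\<close>)
  then have "open ((\<lambda>z. gmult y (dil r z)) ` S)"
    unfolding eq using S(1) open_vimage by blast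
  then show "(\<lambda>z. gmult y (dil r z)) ` S \<in> sets borel" by simp
  fix z
  show "((\<lambda>z. gmult y (dil r z)) has_derivative (\<lambda>v. D2 y (dil r z) (dil r v))) (at z)"
    by (rule has_derivative_compose[OF linear_imp_has_derivative[OF linear_dilation[OF r]] D2_has_derivative])
  show "\<bar>ldet (\<lambda>v. D2 y (dil r z) (dil r v))\<bar> = r powr Q"
    by (simp add: ldet_compose[OF linear_D2 linear_dilation[OF r]] ldet_D2 ldet_dilation[OF r])
  show "inj_on (\<lambda>z. gmult y (dil r z)) S"
    by (rule inj_onI) (metis left_cancel dilation_inverse(2) r)
qed

end

section \<open>Homogeneous quasi-norms: bounded balls, quasi-triangle inequality, volume\<close>

locale homogeneous_group_quasi_norm = homogeneous_group gmult ginv A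
  for gmult and ginv A :: "real ^ 'n \<Rightarrow> real ^ 'n" +
  fixes N :: "real ^ 'n \<Rightarrow> real"
  assumes quasi_norm: "homogeneous_quasi_norm ginv A N"
begin

lemma N_continuous: "continuous_on S N"
  using quasi_norm continuous_on_subset[of UNIV N S] by (simp add: homogeneous_quasi_norm_def)

lemma N_nonneg [simp]: "0 \<le> N x"
  using quasi_norm by (simp add: homogeneous_quasi_norm_def)

lemma N_minus [simp]: "N (- x) = N x"
  using quasi_norm by (simp add: homogeneous_quasi_norm_def ginv_eq_minus)

lemma N_dilation: "0 < r \<Longrightarrow> N (dil r x) = r * N x"
  using quasi_norm by (simp add: homogeneous_quasi_norm_def)

lemma N_eq_0_iff [simp]: "N x = 0 \<longleftrightarrow> x = 0"
  using quasi_norm by (simp add: homogeneous_quasi_norm_def)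

lemma N_0 [simp]: "N 0 = 0"
  by simp

text \<open>Let \<open>m\<close> be the minimum of \<open>N\<close> on the Euclidean unit sphere. A
  point outside the open unit ball is moved onto the sphere by some dilation of factor at most 1, by
  the intermediate value theorem, and this does not increase \<open>N\<close>; so its quasi-norm is
  at least \<open>m\<close>. Thus \<open>N x < m\<close> implies \<open>norm x < 1\<close>, and
  dilations carry this to all radii.\<close>

lemma N_ball_bounded: "bounded {x. N x \<le> t}"
proof -
  have "compact (sphere (0 :: real ^ 'n) 1)" by simp
  then obtain m where m: "0 < m" "\<And>x. norm x = 1 \<Longrightarrow> m \<le> N x"
  proof (cases "sphere (0 :: real ^ 'n) 1 = {}")
    case False
    obtain a where a: "a \<in> sphere 0 1" "\<And>x. x \<in> sphere 0 1 \<Longrightarrow> N a \<le> N x"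
      using continuous_attains_inf[OF compact_sphere False N_continuous] by blast
    show ?thesis
    proof (rule that[of "N a"])
      show "0 < N a" using a(1) N_nonneg[of a] N_eq_0_iff[of a] by (metis less_eq_real_def mem_sphere_0 norm_zero zero_neq_one)
    qed (use a in auto)
  qed (auto intro: that[of 1])
  have small: "norm x < 1" if x: "N x < m" for x
  proof (rule ccontr)
    assume "\<not> norm x < 1"
    obtain n where n: "norm (dil (inverse (real (Suc n))) x) < 1"
    proof -
      have "(\<lambda>n. norm (dil (inverse (real (Suc n))) x)) \<longlonglongrightarrow> norm (0 :: real ^ 'n)"
        by (intro tendsto_norm dilation_tendsto_0)
      then have "\<forall>\<^sub>F n in sequentially. norm (dil (inverse (real (Suc n))) x) < 1"
        by (rule order_tendstoD) simp
      then obtain n where "norm (dil (inverse (real (Suc n))) x) < 1"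
        using eventually_happens'[OF sequentially_bot] by blast
      then show ?thesis by (rule that)
    qed
    define s where "s = inverse (real (Suc n))"
    have s: "0 < s" "s \<le> 1" by (auto simp: s_def inverse_le_1_iff)
    have "continuous_on {s..1} (\<lambda>r. norm (dil r x))"
      using s by (auto simp: continuous_on_def intro!: tendsto_norm dilation_tendsto tendsto_ident_at)
    from IVT'[OF _ _ s(2) this, of 1]
    obtain r where r: "s \<le> r" "r \<le> 1" "norm (dil r x) = 1"
      using n \<open>\<not> norm x < 1\<close> by (auto simp: s_def)
    then have "m \<le> r * N x" using m(2)[of "dil r x"] N_dilation[of r x] s by auto
    also have "\<dots> \<le> N x" using r(2) s r(1) by (simp add: mult_left_le_one_le)
    finally show False using x by simp
  qed
  \<comment> \<open>The dilation by \<open>r\<close> brings values of \<open>N\<close> up to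
    \<open>max t 1\<close> down to at most \<open>m / 2\<close>; the maximum keeps \<open>r\<close>
    positive for every \<open>t\<close>.\<close>
  define r where "r = m / (2 * max t 1)"
  have r: "0 < r" using m(1) by (simp add: r_def)
  have "{x. N x \<le> t} \<subseteq> dil (inverse r) ` ball 0 1"
  proof
    fix x assume "x \<in> {x. N x \<le> t}"
    then have "N (dil r x) \<le> r * t" using r by (simp add: N_dilation)
    also have "\<dots> \<le> r * max t 1" using r by (intro mult_left_mono) auto
    also have "\<dots> < m" using m(1) by (simp add: r_def)
    finally have "dil r x \<in> ball 0 1" using small by simp
    moreover have "x = dil (inverse r) (dil r x)" using r by simp
    ultimately show "x \<in> dil (inverse r) ` ball 0 1" by blast
  qed
  moreover have "bounded (dil (inverse r) ` ball 0 1)"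
    using r by (intro bounded_linear_image bounded_ball linear_conv_bounded_linear[THEN iffD1] linear_dilation) simp
  ultimately show ?thesis using bounded_subset by blast
qed

text \<open>Both sides are homogeneous of degree 1, so \<open>N x + N y\<close> may be scaled to 1.
  Then \<open>x\<close> and \<open>y\<close> lie in a compact quasi-ball, on whose square
  \<open>N (gmult x y)\<close> is bounded by continuity.\<close>

lemma quasi_triangle: "\<exists>\<kappa>>0. \<forall>x y. N (gmult x y) \<le> \<kappa> * (N x + N y)"
proof -
  define S where "S = {x. N x \<le> 1}"
  have "compact S"
    unfolding S_def compact_eq_bounded_closed
    using N_ball_bounded by (auto intro!: closed_Collect_le N_continuous continuous_intros)
  then have "compact (S \<times> S)" by (intro compact_Times)
  moreover have "continuous_on (S \<times> S) (\<lambda>p. N (gmult (fst p) (snd p)))"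
    by (rule continuous_on_compose2[OF N_continuous[of UNIV]]) (auto intro!: continuous_intros)
  ultimately have "compact ((\<lambda>p. N (gmult (fst p) (snd p))) ` (S \<times> S))"
    by (rule compact_continuous_image[rotated])
  from compact_imp_bounded[OF this] obtain \<kappa>0 where "\<forall>p\<in>S \<times> S. norm (N (gmult (fst p) (snd p))) \<le> \<kappa>0"
    unfolding bounded_iff by auto
  then have \<kappa>0: "N (gmult x y) \<le> \<kappa>0" if "x \<in> S" "y \<in> S" for x y
    using that by (auto dest: abs_le_D1)
  have "N (gmult x y) \<le> max \<kappa>0 1 * (N x + N y)" for x y
  proof (cases "N x + N y = 0")
    case True
    then have "N x = 0" "N y = 0" using N_nonneg[of x] N_nonneg[of y] by linarith+
    then show ?thesis by simp
  next
    case False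
    define r where "r = N x + N y"
    have r: "0 < r" using False add_nonneg_nonneg[OF N_nonneg[of x] N_nonneg[of y]] unfolding r_def by linarith
    have "dil (inverse r) x \<in> S" "dil (inverse r) y \<in> S"
    proof -
      have "inverse r * N x \<le> inverse r * r" "inverse r * N y \<le> inverse r * r"
        using r N_nonneg[of x] N_nonneg[of y] by (intro mult_left_mono; simp add: r_def)+
      then show "dil (inverse r) x \<in> S" "dil (inverse r) y \<in> S"
        using r by (simp_all add: S_def N_dilation)
    qed
    then have "N (gmult (dil (inverse r) x) (dil (inverse r) y)) \<le> max \<kappa>0 1" using \<kappa>0 by (simp add: le_max_iff_disj)
    then have "inverse r * N (gmult x y) \<le> max \<kappa>0 1"
      using r by (simp add: dilation_gmult[symmetric] N_dilation)
    then show ?thesis using r by (simp add: r_def[symmetric] field_simps)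
  qed
  then show ?thesis by (intro exI[of _ "max \<kappa>0 1"]) auto
qed

text \<open>The quasi-ball about \<open>y\<close> is the unit quasi-ball dilated and then
  left-translated, so the measure of the unit quasi-ball serves as \<open>c\<close>.\<close>

lemma emeasure_quasi_ball:
  "\<exists>c\<ge>0. \<forall>y r. 0 < r \<longrightarrow> emeasure lborel {x. N (gmult (- y) x) < r} \<le> ennreal (c * r powr Q)"
proof (intro exI[of _ "measure lborel {x. N x < 1}"] conjI allI impI)
  fix y and r :: real assume r: "0 < r"
  have "open {x. N x < 1}" by (intro open_Collect_less N_continuous continuous_intros)
  moreover have "bounded {x. N x < 1}" using N_ball_bounded[of 1] by (rule bounded_subset) auto
  ultimately have "emeasure lborel ((\<lambda>z. gmult y (dil r z)) ` {x. N x < 1}) = ennreal (r powr Q * measure lborel {x. N x < 1})"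
    using r by (intro emeasure_translated_dilated)
  moreover have "{x. N (gmult (- y) x) < r} = (\<lambda>z. gmult y (dil r z)) ` {x. N x < 1}"
  proof (intro set_eqI iffI)
    fix w assume "w \<in> {x. N (gmult (- y) x) < r}"
    then have "N (dil (inverse r) (gmult (- y) w)) < 1" using r by (simp add: N_dilation field_simps)
    moreover have "w = gmult y (dil r (dil (inverse r) (gmult (- y) w)))"
      using r by (simp add: assoc[symmetric])
    ultimately show "w \<in> (\<lambda>z. gmult y (dil r z)) ` {x. N x < 1}" by blast
  next
    fix w assume "w \<in> (\<lambda>z. gmult y (dil r z)) ` {x. N x < 1}"
    then obtain z where z: "N z < 1" "w = gmult y (dil r z)" by blast
    have "gmult (- y) w = dil r z" unfolding z(2) by (simp add: assoc[symmetric])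
    then show "w \<in> {x. N (gmult (- y) x) < r}" using z r by (simp add: N_dilation)
  qed
  ultimately show "emeasure lborel {x. N (gmult (- y) x) < r} \<le> ennreal (measure lborel {x. N x < 1} * r powr Q)"
    by (simp add: mult.commute)
qed simp

end

subsection \<open>The Stein--Weiss inequality\<close>

lemma sigma_finite_lebesgue: "sigma_finite_measure (lebesgue :: 'a::euclidean_space measure)"
proof
  obtain A :: "'a set set" where A: "countable A" "A \<subseteq> sets lborel" "\<Union>A = space lborel"
    "\<forall>a\<in>A. emeasure lborel a \<noteq> \<infinity>"
    using lborel.sigma_finite_countable by blast
  then show "\<exists>A :: 'a set set. countable A \<and> A \<subseteq> sets lebesgue \<and> \<Union>A = space lebesgue \<and> (\<forall>a\<in>A. emeasure lebesgue a \<noteq> \<infinity>)"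
    by (intro exI[of _ A]) (auto intro: sets_completionI_sets)
qed

context homogeneous_group_quasi_norm begin

text \<open>The product here is one of two completed measures. Joint measurability comes from
  continuity, through the product of the Borel sigma-algebras.\<close>

lemma distance_measurable:
  "(\<lambda>(x, y). N (gmult (- y) x)) \<in> borel_measurable (lebesgue \<Otimes>\<^sub>M lebesgue)"
proof -
  have "continuous_on UNIV (\<lambda>p. N (gmult (- snd p) (fst p)))"
    by (rule continuous_on_compose2[OF N_continuous[of UNIV]]) (auto intro!: continuous_intros)
  then have 1: "(\<lambda>p. N (gmult (- snd p) (fst p))) \<in> borel_measurable (borel \<Otimes>\<^sub>M borel)"
    unfolding borel_prod by (rule borel_measurable_continuous_onI)
  have [measurable]: "(\<lambda>x. x) \<in> lebesgue \<rightarrow>\<^sub>M (borel :: (real ^ 'n) measure)"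
    by (rule measurable_completion) simp
  have "(\<lambda>p. (fst p, snd p)) \<in> lebesgue \<Otimes>\<^sub>M lebesgue \<rightarrow>\<^sub>M (borel :: (real ^ 'n) measure) \<Otimes>\<^sub>M (borel :: (real ^ 'n) measure)"
    by (intro measurable_Pair measurable_compose[OF measurable_fst] measurable_compose[OF measurable_snd]) simp_all
  from measurable_compose[OF this 1] show ?thesis by (simp add: case_prod_beta)
qed

lemma normalized_bound:
  assumes "0 < lam" "lam < Q" "1 < p" "1 < q" "1 / p + 1 / q + (\<alpha> + lam) / Q = 2"
    "0 \<le> \<alpha>" "\<alpha> < Q * (1 - 1 / p)" "\<alpha> + lam \<le> Q"
  shows "\<exists>B\<ge>0. \<forall>f g. f \<in> borel_measurable lebesgue \<longrightarrow> g \<in> borel_measurable lebesgue \<longrightarrow>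
    (\<forall>x. 0 \<le> f x) \<longrightarrow> (\<forall>x. 0 \<le> g x) \<longrightarrow>
    (\<integral>\<^sup>+x. ennreal (f x powr p) \<partial>lebesgue) \<le> 1 \<longrightarrow> (\<integral>\<^sup>+x. ennreal (g x powr q) \<partial>lebesgue) \<le> 1 \<longrightarrow>
    (\<integral>\<^sup>+y. \<integral>\<^sup>+x. ennreal (f x) * ennreal (g y) *
        ennreal (N x powr (- \<alpha>) * N (gmult (- y) x) powr (- lam)) \<partial>lebesgue \<partial>lebesgue) \<le> ennreal B"
proof -
  obtain \<kappa> where \<kappa>: "0 < \<kappa>" "\<And>x y. N (gmult x y) \<le> \<kappa> * (N x + N y)" using quasi_triangle by blast
  obtain c where c: "0 \<le> c" "\<And>y r. 0 < r \<Longrightarrow> emeasure lborel {x. N (gmult (- y) x) < r} \<le> ennreal (c * r powr Q)"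
    using emeasure_quasi_ball by blast
  have "open {x. N (gmult (- y) x) < r}" for y r
    by (rule open_Collect_less[OF continuous_on_compose2[OF N_continuous[of UNIV]]]) (auto intro!: continuous_intros)
  then have ball: "emeasure lebesgue {x. N (gmult (- y) x) < r} \<le> ennreal (c * r powr Q)" if "0 < r" for y r
    using c(2)[OF that, of y] by simp
  \<comment> \<open>Symmetry of \<open>N\<close> under inversion makes the sets
    \<open>{y. N (gmult (- y) x) < r}\<close> left translates of a quasi-ball as well.\<close>
  have sym: "N (gmult (- y) x) = N (gmult (- x) y)" for x y
    using N_minus[of "gmult (- y) x"] by (simp only: minus_gmult_distrib minus_minus)
  have tri: "N y \<le> \<kappa> * (N x + N (gmult (- y) x))" for x y
    using \<kappa>(2)[of x "gmult (- x) y"] sym[of y x] by (simp add: assoc[symmetric])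
  show ?thesis
  proof (rule stein_weiss_kernel_bound[where c = c and \<kappa> = \<kappa>, OF sigma_finite_lebesgue _ distance_measurable])
    show "N \<in> borel_measurable lebesgue"
      by (intro measurable_completion) (simp add: borel_measurable_continuous_onI N_continuous)
    fix r :: real assume "0 < r"
    then show "emeasure lebesgue {x. N x < r} \<le> ennreal (c * r powr Q)" using ball[of r 0] by simp
    fix x y
    show "emeasure lebesgue {x. N (gmult (- y) x) < r} \<le> ennreal (c * r powr Q)" by (rule ball) fact
    show "emeasure lebesgue {y. N (gmult (- y) x) < r} \<le> ennreal (c * r powr Q)"
      unfolding sym[of _ x] by (rule ball) fact
  qed (use assms \<kappa> c tri in auto)
qed

text \<open>The functions are divided by numbers \<open>s\<close> and \<open>t\<close> strictly
  above their norms, which covers norm 0 without a separate case; then \<open>s\<close> and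
  \<open>t\<close> tend to the norms. Integrability is part of the claim because a Bochner integral
  that fails to converge has the value 0, for which the bound would say nothing.\<close>

lemma stein_weiss:
  assumes "0 < lam" "lam < Q" "1 < p" "1 < q" "1 / p + 1 / q + (\<alpha> + lam) / Q = 2"
    "0 \<le> \<alpha>" "\<alpha> < Q * (1 - 1 / p)" "\<alpha> + lam \<le> Q"
  shows "\<exists>C>0. \<forall>f g. in_Lp p f \<longrightarrow> in_Lp q g \<longrightarrow>
    integrable (lebesgue \<Otimes>\<^sub>M lebesgue)
      (\<lambda>(x, y). cnj (f x) * g y / of_real (N x powr \<alpha> * N (gmult (ginv y) x) powr lam)) \<and>
    norm (LINT y|lebesgue. LINT x|lebesgue.
        cnj (f x) * g y / of_real (N x powr \<alpha> * N (gmult (ginv y) x) powr lam))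
      \<le> C * Lp_norm p f * Lp_norm q g"
proof -
  interpret P: pair_sigma_finite "lebesgue :: (real ^ 'n) measure" "lebesgue :: (real ^ 'n) measure"
    by (intro pair_sigma_finite.intro sigma_finite_lebesgue)
  obtain B where B: "0 \<le> B" "\<And>f g. f \<in> borel_measurable lebesgue \<Longrightarrow> g \<in> borel_measurable lebesgue \<Longrightarrow>
    (\<forall>x. 0 \<le> f x) \<Longrightarrow> (\<forall>x. 0 \<le> g x) \<Longrightarrow>
    (\<integral>\<^sup>+x. ennreal (f x powr p) \<partial>lebesgue) \<le> 1 \<Longrightarrow> (\<integral>\<^sup>+x. ennreal (g x powr q) \<partial>lebesgue) \<le> 1 \<Longrightarrow>
    (\<integral>\<^sup>+y. \<integral>\<^sup>+x. ennreal (f x) * ennreal (g y) *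
        ennreal (N x powr (- \<alpha>) * N (gmult (- y) x) powr (- lam)) \<partial>lebesgue \<partial>lebesgue) \<le> ennreal B"
    by atomize_elim (rule normalized_bound[OF assms])
  have normalized: "(\<integral>\<^sup>+x. ennreal ((norm (f x) / s) powr r) \<partial>lebesgue) \<le> 1"
    if f: "in_Lp r f" and s: "Lp_norm r f < s" and r: "1 < r" for f :: "real ^ 'n \<Rightarrow> complex" and r s
  proof -
    define I where "I = (LINT x|lebesgue. norm (f x) powr r)"
    have I0: "0 \<le> I" unfolding I_def by (intro integral_nonneg_AE) auto
    have s0: "0 < s" using s unfolding Lp_norm_def by (rule le_less_trans[rotated]) simp
    have "I = Lp_norm r f powr r" using I0 r by (simp add: Lp_norm_def I_def[symmetric] powr_powr)
    also have "\<dots> \<le> s powr r" using s r by (intro powr_mono2) (auto simp: Lp_norm_def)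
    finally have le: "I / s powr r \<le> 1" using s0 by (simp add: divide_le_eq)
    have "(\<integral>\<^sup>+x. ennreal ((norm (f x) / s) powr r) \<partial>lebesgue) = (\<integral>\<^sup>+x. ennreal (norm (f x) powr r / s powr r) \<partial>lebesgue)"
      using s0 by (simp add: powr_divide)
    also have "\<dots> = ennreal (LINT x|lebesgue. norm (f x) powr r / s powr r)"
      using f by (intro nn_integral_eq_integral) (auto simp: in_Lp_def)
    also have "\<dots> = ennreal (I / s powr r)" by (simp add: I_def)
    also have "\<dots> \<le> 1" using le ennreal_leI by fastforce
    finally show ?thesis .
  qed
  show ?thesis
  \<comment> \<open>Adding 1 makes the constant positive even if \<open>B = 0\<close>.\<close>
  proof (intro exI[of _ "B + 1"] conjI allI impI)
    show "0 < B + 1" using B(1) by simp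
    fix f g :: "real ^ 'n \<Rightarrow> complex"
    assume f: "in_Lp p f" and g: "in_Lp q g"
    define h where "h x y = cnj (f x) * g y / of_real (N x powr \<alpha> * N (gmult (ginv y) x) powr lam)" for x y
    define K where "K x y = N x powr (- \<alpha>) * N (gmult (- y) x) powr (- lam)" for x y
    have [measurable]: "f \<in> borel_measurable lebesgue" "g \<in> borel_measurable lebesgue"
      using f g by (auto simp: in_Lp_def)
    have [measurable]: "N \<in> borel_measurable lebesgue"
      by (intro measurable_completion) (simp add: borel_measurable_continuous_onI N_continuous)
    note distance_measurable[measurable]
    have [measurable]: "(\<lambda>(x, y). K x y) \<in> borel_measurable (lebesgue \<Otimes>\<^sub>M lebesgue)"
      unfolding K_def by measurable
    have [measurable]: "(\<lambda>x. K x y) \<in> borel_measurable lebesgue" for y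
      using measurable_compose[OF measurable_Pair2'[of y lebesgue lebesgue], of "\<lambda>(x, y). K x y"] by simp
    have [measurable]: "cnj \<in> borel_measurable borel"
      by (intro borel_measurable_continuous_onI continuous_intros)
    have h_meas[measurable]: "(\<lambda>(x, y). h x y) \<in> borel_measurable (lebesgue \<Otimes>\<^sub>M lebesgue)"
      unfolding h_def ginv_eq_minus by measurable
    \<comment> \<open>The identity holds at the singularities too: there division by 0 on the left
      and \<open>0 powr a\<close> on the right are both 0.\<close>
    have norm_h: "norm (h x y) = norm (f x) * norm (g y) * K x y" for x y
      by (simp add: h_def K_def ginv_eq_minus norm_mult norm_divide powr_minus divide_inverse norm_inverse abs_mult del: of_real_mult)
    define J where "J = (\<integral>\<^sup>+z. ennreal (norm (case z of (x, y) \<Rightarrow> h x y)) \<partial>(lebesgue \<Otimes>\<^sub>M lebesgue))"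
    have J_eq: "J = (\<integral>\<^sup>+y. \<integral>\<^sup>+x. ennreal (norm (f x)) * ennreal (norm (g y)) * ennreal (K x y) \<partial>lebesgue \<partial>lebesgue)"
    proof -
      have "J = (\<integral>\<^sup>+y. \<integral>\<^sup>+x. ennreal (norm (h x y)) \<partial>lebesgue \<partial>lebesgue)"
        unfolding J_def by (subst P.nn_integral_snd[symmetric]) auto
      then show ?thesis by (simp add: norm_h ennreal_mult K_def)
    qed
    have J_le: "J \<le> ennreal (B * s * t)" if s: "Lp_norm p f < s" and t: "Lp_norm q g < t" for s t
    proof -
      have s0: "0 < s" using s unfolding Lp_norm_def by (rule le_less_trans[rotated]) simp
      have t0: "0 < t" using t unfolding Lp_norm_def by (rule le_less_trans[rotated]) simp
      have "J = (\<integral>\<^sup>+y. \<integral>\<^sup>+x. ennreal (s * t) * (ennreal (norm (f x) / s) * ennreal (norm (g y) / t) * ennreal (K x y)) \<partial>lebesgue \<partial>lebesgue)"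
        unfolding J_eq using s0 t0 by (intro nn_integral_cong) (simp add: ennreal_mult[symmetric] K_def)
      also have "\<dots> = ennreal (s * t) * (\<integral>\<^sup>+y. \<integral>\<^sup>+x. ennreal (norm (f x) / s) * ennreal (norm (g y) / t) * ennreal (K x y) \<partial>lebesgue \<partial>lebesgue)"
      proof -
        have [measurable]: "(\<lambda>(y, x). K x y) \<in> borel_measurable (lebesgue \<Otimes>\<^sub>M lebesgue)"
          using measurable_pair_swap[of "\<lambda>(x, y). K x y" lebesgue lebesgue borel] by (simp add: case_prod_beta)
        show ?thesis by (subst nn_integral_cmult, measurable) (rule nn_integral_cmult, measurable)
      qed
      also have "\<dots> \<le> ennreal (s * t) * ennreal B"
        unfolding K_def using s0 t0 normalized[OF f s assms(3)] normalized[OF g t assms(4)]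
        by (intro mult_left_mono B(2)) auto
      also have "\<dots> = ennreal (B * s * t)" using s0 t0 B(1) by (simp add: ennreal_mult[symmetric] mult_ac)
      finally show ?thesis .
    qed
    have J_fin: "J < \<infinity>"
      using J_le[of "Lp_norm p f + 1" "Lp_norm q g + 1"] by (auto simp: less_top[symmetric] top_unique)
    have int: "integrable (lebesgue \<Otimes>\<^sub>M lebesgue) (\<lambda>(x, y). h x y)"
      using J_fin unfolding J_def by (intro integrableI_bounded) auto
    show "integrable (lebesgue \<Otimes>\<^sub>M lebesgue)
      (\<lambda>(x, y). cnj (f x) * g y / of_real (N x powr \<alpha> * N (gmult (ginv y) x) powr lam))"
      using int unfolding h_def .
    have le_J: "ennreal (norm (LINT y|lebesgue. LINT x|lebesgue. h x y)) \<le> J"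
      unfolding J_def P.integral_snd[OF int] by (rule integral_norm_bound_ennreal[OF int])
    have a0: "0 \<le> Lp_norm p f" "0 \<le> Lp_norm q g" by (auto simp: Lp_norm_def)
    have "norm (LINT y|lebesgue. LINT x|lebesgue. h x y) \<le> B * Lp_norm p f * Lp_norm q g"
    proof (rule LIMSEQ_le_const)
      show "(\<lambda>n. B * (Lp_norm p f + inverse (real (Suc n))) * (Lp_norm q g + inverse (real (Suc n))))
        \<longlonglongrightarrow> B * Lp_norm p f * Lp_norm q g"
        by (rule tendsto_eq_intros LIMSEQ_inverse_real_of_nat refl | simp)+
      show "\<exists>n0. \<forall>n\<ge>n0. norm (LINT y|lebesgue. LINT x|lebesgue. h x y)
        \<le> B * (Lp_norm p f + inverse (real (Suc n))) * (Lp_norm q g + inverse (real (Suc n)))"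
      proof (intro exI allI impI)
        fix n
        have "0 \<le> B * (Lp_norm p f + inverse (real (Suc n))) * (Lp_norm q g + inverse (real (Suc n)))"
          using B(1) a0 by simp
        then show "norm (LINT y|lebesgue. LINT x|lebesgue. h x y)
          \<le> B * (Lp_norm p f + inverse (real (Suc n))) * (Lp_norm q g + inverse (real (Suc n)))"
          using order_trans[OF le_J J_le[of "Lp_norm p f + inverse (real (Suc n))" "Lp_norm q g + inverse (real (Suc n))"]]
          by (simp del: of_nat_Suc)
      qed
    qed
    also have "\<dots> \<le> (B + 1) * Lp_norm p f * Lp_norm q g"
      using a0 by (intro mult_right_mono) auto
    finally show "norm (LINT y|lebesgue. LINT x|lebesgue.
        cnj (f x) * g y / of_real (N x powr \<alpha> * N (gmult (ginv y) x) powr lam))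
      \<le> (B + 1) * Lp_norm p f * Lp_norm q g"
      unfolding h_def .
  qed
qed

end

theorem theorem4p1:
  fixes gmult :: "real ^ 'n \<Rightarrow> real ^ 'n \<Rightarrow> real ^ 'n"
    and ginv A :: "real ^ 'n \<Rightarrow> real ^ 'n"
    and N :: "real ^ 'n \<Rightarrow> real"
    and Q \<alpha> lam p p' q :: real
  assumes "homogeneous_group gmult ginv A"
    and "Q = homogeneous_dimension A"
    and "homogeneous_quasi_norm ginv A N"
    and "0 < lam" and "lam < Q"
    and "1 < p" and "1 < q"
    and "1 / p + 1 / q + (\<alpha> + lam) / Q = 2"
    and "1 / p + 1 / p' = 1"
    and "0 \<le> \<alpha>" and "\<alpha> < Q / p'" and "\<alpha> + lam \<le> Q"
  shows "\<exists>C>0. \<forall>f g. in_Lp p f \<longrightarrow> in_Lp q g \<longrightarrow>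
    integrable (lebesgue \<Otimes>\<^sub>M lebesgue)
      (\<lambda>(x, y). cnj (f x) * g y / of_real (N x powr \<alpha> * N (gmult (ginv y) x) powr lam)) \<and>
    norm (LINT y|lebesgue. LINT x|lebesgue.
        cnj (f x) * g y / of_real (N x powr \<alpha> * N (gmult (ginv y) x) powr lam))
      \<le> C * Lp_norm p f * Lp_norm q g"
proof -
  interpret homogeneous_group_quasi_norm gmult ginv A N
    using assms(1,3) by (simp add: homogeneous_group_quasi_norm_def homogeneous_group_quasi_norm_axioms_def)
  have "1 / p' = 1 - 1 / p" using assms(9) by simp
  then have "\<alpha> < Q * (1 - 1 / p)" using assms(11) by (metis divide_inverse inverse_eq_divide)
  then show ?thesis using assms(4-8,10,12) unfolding assms(2) by (intro stein_weiss)
qed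

end
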